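(* Let $A$ be the generator of an analytic and exponentially stable $C_0$-semigroup $T=(T(t))_{t\ge 0}$ on a Banach space $X$, let $U$ be a Banach space and let $B\in\mathcal{L}(U,X_{-1})$. Let $\beta\in(0,1)$. Then the following are equivalent: (a) $B$ is finite-time $L^p$-admissible for $T$ for all $p>\frac{1}{1-\beta}$. (b) $B$ is a bounded map from $U$ into $X_{-\alpha}$ for all $\alpha>\beta$ ($\alpha\le 1$).
   Context: $X_{-1}$ is the completion of $X$ with respect to the norm $\|z\|_{X_{-1}}=\|(sI-A)^{-1}z\|_X$ for some fixed $s\in\rho(A)$ (different $s$ give equivalent norms). $T$ extends to a $C_0$-semigroup on $X_{-1}$, again denoted $T$. $T$ is exponentially stable if its growth bound $\omega(T)$ is negative. Analyticity of a $C_0$-semigroup is meant in the standard sense (holomorphic extension to a sector $\{z\ne0:|\arg z|<\varphi\}$ for some $\varphi\in(0,\pi/2]$). For $\alpha\in(0,1)$, $(-A)^{-\alpha}\in\mathcal{L}(X)$ denotes the usual (negative) fractional power, and $X_{-\alpha}$ is the completion of $X$ with respect to the norm $\|x\|_{-\alpha}=\|(-A)^{-\alpha}x\|_X$; it is regarded as a subspace of $X_{-1}$, so that $X\subset X_{-\alpha}\subset X_{-1}$. "$B$ is bounded into $X_{-\alpha}$" means $B(U)\subset X_{-\alpha}$ and $B\in\mathcal{L}(U,X_{-\alpha})$. For $1\le p\le\infty$, $B\in\mathcal{L}(U,X_{-1})$ is finite-time $L^p$-admissible for $T$ if for every $t\ge 0$ and every $u\in L^p([0,t],U)$ the ($X_{-1}$-valued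 Bochner) integral $\int_0^tT(t-s)Bu(s)\,ds$ lies in $X$ and there is $C>0$ (possibly depending on $t$) with $\|\int_0^tT(t-s)Bu(s)\,ds\|_X\le C\|u\|_{L^p([0,t],U)}$ for all $u\in L^p([0,t],U)$. *)

theory Defs
  imports "HOL-Analysis.Analysis" "HOL-Probability.Essential_Supremum"
begin

section \<open>Complex Banach spaces\<close>

class cbanach = banach +
  fixes scaleC :: "complex \<Rightarrow> 'a \<Rightarrow> 'a"  (infixr \<open>*\<^sub>C\<close> 75)
  assumes scaleC_add_right: "a *\<^sub>C (x + y) = a *\<^sub>C x + a *\<^sub>C y"
    and scaleC_add_left: "(a + b) *\<^sub>C x = a *\<^sub>C x + b *\<^sub>C x"
    and scaleC_scaleC: "a *\<^sub>C (b *\<^sub>C x) = (a * b) *\<^sub>C x"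
    and scaleR_scaleC: "r *\<^sub>R x = complex_of_real r *\<^sub>C x"
    and norm_scaleC: "norm (a *\<^sub>C x) = cmod a * norm x"

instantiation complex :: cbanach
begin

definition scaleC_complex :: "complex \<Rightarrow> complex \<Rightarrow> complex"
  where "scaleC_complex = (*)"

instance
  by intro_classes (auto simp: scaleC_complex_def algebra_simps norm_mult scaleR_conv_of_real)

end

definition clinear :: "('a::cbanach \<Rightarrow> 'b::cbanach) \<Rightarrow> bool"
  where "clinear f \<longleftrightarrow> (\<forall>x y. f (x + y) = f x + f y) \<and> (\<forall>c x. f (c *\<^sub>C x) = c *\<^sub>C f x)"

definition bounded_clinear :: "('a::cbanach \<Rightarrow> 'b::cbanach) \<Rightarrow> bool"
  where "bounded_clinear f \<longleftrightarrow> clinear f \<and> (\<exists>K. \<forall>x. norm (f x) \<le> K * norm x)"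


section \<open>Bochner integral and Lebesgue-Bochner spaces\<close>

text \<open>The Bochner integral of the library requires a second countable range type. As the Banach
  spaces here need not be separable, the same definition is given below with Borel measurability
  replaced by strong measurability. It is only used over complete measures (Lebesgue measure
  on a subset of the line), so that norms of strongly measurable functions are measurable.\<close>

definition strongly_measurable :: "'s measure \<Rightarrow> ('s \<Rightarrow> 'a::real_normed_vector) \<Rightarrow> bool"
  where "strongly_measurable M f \<longleftrightarrow>
    (\<exists>g. (\<forall>i::nat. simple_function M (g i)) \<and> (AE x in M. (\<lambda>i. g i x) \<longlonglongrightarrow> f x))"

definition has_strong_bochner_integral ::
    "'s measure \<Rightarrow> ('s \<Rightarrow> 'a::real_normed_vector) \<Rightarrow> 'a \<Rightarrow> bool"
  where "has_strong_bochner_integral M f z \<longleftrightarrow>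
    strongly_measurable M f \<and>
    (\<exists>g. (\<forall>i::nat. Bochner_Integration.simple_bochner_integrable M (g i)) \<and>
         (\<lambda>i. \<integral>\<^sup>+x. ennreal (norm (f x - g i x)) \<partial>M) \<longlonglongrightarrow> 0 \<and>
         (\<lambda>i. Bochner_Integration.simple_bochner_integral M (g i)) \<longlonglongrightarrow> z)"

definition strong_bochner_integral ::
    "'s measure \<Rightarrow> ('s \<Rightarrow> 'a::real_normed_vector) \<Rightarrow> 'a"
  where "strong_bochner_integral M f = (THE z. has_strong_bochner_integral M f z)"

definition Lp_space :: "'s measure \<Rightarrow> ennreal \<Rightarrow> ('s \<Rightarrow> 'a::real_normed_vector) set"
  where "Lp_space M p = {u. strongly_measurable M u \<and>
    (if p = \<infinity> then esssup M (\<lambda>x. ennreal (norm (u x))) < \<infinity>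
     else (\<integral>\<^sup>+x. ennreal (norm (u x) powr enn2real p) \<partial>M) < \<infinity>)}"

definition Lp_norm :: "'s measure \<Rightarrow> ennreal \<Rightarrow> ('s \<Rightarrow> 'a::real_normed_vector) \<Rightarrow> real"
  where "Lp_norm M p u =
    (if p = \<infinity> then enn2real (esssup M (\<lambda>x. ennreal (norm (u x))))
     else enn2real (\<integral>\<^sup>+x. ennreal (norm (u x) powr enn2real p) \<partial>M) powr (1 / enn2real p))"


section \<open>Semigroups, generators, resolvents\<close>

text \<open>Semigroups are families indexed by all reals; their values at negative times are
  irrelevant. An unbounded operator is given by its domain \<open>D\<close> and a function \<open>A\<close> whose values
  outside \<open>D\<close> are irrelevant.\<close>

definition C0_semigroup :: "(real \<Rightarrow> 'a::cbanach \<Rightarrow> 'a) \<Rightarrow> bool"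
  where "C0_semigroup T \<longleftrightarrow>
    (\<forall>t\<ge>0. bounded_clinear (T t)) \<and>
    (\<forall>x. T 0 x = x) \<and>
    (\<forall>s\<ge>0. \<forall>t\<ge>0. \<forall>x. T (s + t) x = T s (T t x)) \<and>
    (\<forall>x. ((\<lambda>t. T t x) \<longlongrightarrow> x) (at_right 0))"

definition is_generator :: "'a set \<Rightarrow> ('a \<Rightarrow> 'a) \<Rightarrow> (real \<Rightarrow> 'a::cbanach \<Rightarrow> 'a) \<Rightarrow> bool"
  where "is_generator D A T \<longleftrightarrow>
    D = {x. \<exists>y. ((\<lambda>h. (T h x - x) /\<^sub>R h) \<longlongrightarrow> y) (at_right 0)} \<and>
    (\<forall>x\<in>D. ((\<lambda>h. (T h x - x) /\<^sub>R h) \<longlongrightarrow> A x) (at_right 0))"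

definition resolvent :: "'a set \<Rightarrow> ('a \<Rightarrow> 'a) \<Rightarrow> complex \<Rightarrow> 'a::cbanach \<Rightarrow> 'a"
  where "resolvent D A s = inv_into D (\<lambda>x. s *\<^sub>C x - A x)"

definition resolvent_set :: "'a set \<Rightarrow> ('a::cbanach \<Rightarrow> 'a) \<Rightarrow> complex set"
  where "resolvent_set D A =
    {s. bij_betw (\<lambda>x. s *\<^sub>C x - A x) D UNIV \<and> bounded_clinear (resolvent D A s)}"

text \<open>The growth bound may be \<open>-\<infinity>\<close>.\<close>

definition growth_bound :: "(real \<Rightarrow> 'a::cbanach \<Rightarrow> 'a) \<Rightarrow> ereal"
  where "growth_bound T =
    Inf (ereal ` {\<omega>. \<exists>M\<ge>1. \<forall>t\<ge>0. onorm (T t) \<le> M * exp (\<omega> * t)})"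

definition exponentially_stable :: "(real \<Rightarrow> 'a::cbanach \<Rightarrow> 'a) \<Rightarrow> bool"
  where "exponentially_stable T \<longleftrightarrow> growth_bound T < 0"

definition sector :: "real \<Rightarrow> complex set"
  where "sector \<phi> = {z. z \<noteq> 0 \<and> \<bar>Arg z\<bar> < \<phi>}"

text \<open>Holomorphy of an operator-valued map with respect to the operator norm.\<close>

definition op_holomorphic_on :: "(complex \<Rightarrow> 'a::cbanach \<Rightarrow> 'a) \<Rightarrow> complex set \<Rightarrow> bool"
  where "op_holomorphic_on S \<Omega> \<longleftrightarrow>
    (\<forall>z\<in>\<Omega>. \<exists>L. bounded_clinear L \<and>
      ((\<lambda>w. onorm (\<lambda>x. inverse (w - z) *\<^sub>C (S w x - S z x) - L x)) \<longlongrightarrow> 0) (at z within \<Omega>))"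

definition analytic_semigroup :: "(real \<Rightarrow> 'a::cbanach \<Rightarrow> 'a) \<Rightarrow> bool"
  where "analytic_semigroup T \<longleftrightarrow> C0_semigroup T \<and>
    (\<exists>\<phi> S. 0 < \<phi> \<and> \<phi> \<le> pi / 2 \<and>
      (\<forall>t\<ge>0. S (complex_of_real t) = T t) \<and>
      (\<forall>z\<in>sector \<phi>. bounded_clinear (S z)) \<and>
      op_holomorphic_on S (sector \<phi>) \<and>
      (\<forall>z\<in>sector \<phi>. \<forall>w\<in>sector \<phi>. \<forall>x. S (z + w) x = S z (S w x)) \<and>
      (\<forall>\<psi>. 0 < \<psi> \<and> \<psi> < \<phi> \<longrightarrow>
        (\<forall>x. ((\<lambda>z. S z x) \<longlongrightarrow> x) (at 0 within sector \<psi>))))"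


section \<open>Extrapolation spaces\<close>

text \<open>\<open>is_completion n \<iota>\<close>: the Banach space \<open>'b\<close> with the embedding \<open>\<iota>\<close> is a completion of
  \<open>'a\<close> with respect to the norm \<open>n\<close>.\<close>

definition is_completion :: "('a::cbanach \<Rightarrow> real) \<Rightarrow> ('a \<Rightarrow> 'b::cbanach) \<Rightarrow> bool"
  where "is_completion n \<iota> \<longleftrightarrow>
    clinear \<iota> \<and> (\<forall>x. norm (\<iota> x) = n x) \<and> closure (range \<iota>) = UNIV"

definition extended_semigroup ::
    "('a::cbanach \<Rightarrow> 'b::cbanach) \<Rightarrow> (real \<Rightarrow> 'a \<Rightarrow> 'a) \<Rightarrow> real \<Rightarrow> 'b \<Rightarrow> 'b"
  where "extended_semigroup \<iota> T t =
    (THE S. bounded_clinear S \<and> (\<forall>x. S (\<iota> x) = \<iota> (T t x)))"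

text \<open>\<open>(-A)\<^sup>-\<^sup>\<alpha> x = \<Gamma>(\<alpha>)\<^sup>-\<^sup>1 \<integral>\<^sub>0\<^sup>\<infinity> t\<^sup>\<alpha>\<^sup>-\<^sup>1 T(t) x dt\<close> for the generator \<open>A\<close> of an exponentially stable
  semigroup \<open>T\<close> and \<open>\<alpha> > 0\<close>; for \<open>\<alpha> = 1\<close> this is \<open>(-A)\<^sup>-\<^sup>1\<close>.\<close>

definition neg_frac_power :: "(real \<Rightarrow> 'a::cbanach \<Rightarrow> 'a) \<Rightarrow> real \<Rightarrow> 'a \<Rightarrow> 'a"
  where "neg_frac_power T \<alpha> x =
    (1 / Gamma \<alpha>) *\<^sub>R
      strong_bochner_integral (lebesgue_on {0<..}) (\<lambda>t. (t powr (\<alpha> - 1)) *\<^sub>R T t x)"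

definition frac_norm :: "(real \<Rightarrow> 'a::cbanach \<Rightarrow> 'a) \<Rightarrow> real \<Rightarrow> 'a \<Rightarrow> real"
  where "frac_norm T \<alpha> x = norm (neg_frac_power T \<alpha> x)"

text \<open>The completion \<open>X\<^sub>-\<^sub>\<alpha>\<close> as a subspace of \<open>X\<^sub>-\<^sub>1\<close>: a point of the completion is represented
  by a sequence in \<open>X\<close> that is Cauchy for the norm of \<open>X\<^sub>-\<^sub>\<alpha>\<close>, and it is identified with
  the limit of that sequence in \<open>X\<^sub>-\<^sub>1\<close>; its norm is the limit of the norms of the sequence.\<close>

definition represents_frac ::
    "('a::cbanach \<Rightarrow> 'b::cbanach) \<Rightarrow> (real \<Rightarrow> 'a \<Rightarrow> 'a) \<Rightarrow> real \<Rightarrow> (nat \<Rightarrow> 'a) \<Rightarrow> 'b \<Rightarrow> bool"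
  where "represents_frac \<iota> T \<alpha> x z \<longleftrightarrow>
    (\<forall>e>0. \<exists>N. \<forall>m\<ge>N. \<forall>n\<ge>N. frac_norm T \<alpha> (x m - x n) < e) \<and> (\<lambda>n. \<iota> (x n)) \<longlonglongrightarrow> z"

definition X_neg :: "('a::cbanach \<Rightarrow> 'b::cbanach) \<Rightarrow> (real \<Rightarrow> 'a \<Rightarrow> 'a) \<Rightarrow> real \<Rightarrow> 'b set"
  where "X_neg \<iota> T \<alpha> = {z. \<exists>x. represents_frac \<iota> T \<alpha> x z}"

definition norm_X_neg ::
    "('a::cbanach \<Rightarrow> 'b::cbanach) \<Rightarrow> (real \<Rightarrow> 'a \<Rightarrow> 'a) \<Rightarrow> real \<Rightarrow> 'b \<Rightarrow> real"
  where "norm_X_neg \<iota> T \<alpha> z =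
    (THE r. \<exists>x. represents_frac \<iota> T \<alpha> x z \<and> (\<lambda>n. frac_norm T \<alpha> (x n)) \<longlonglongrightarrow> r)"

definition bounded_into_X_neg ::
    "('a::cbanach \<Rightarrow> 'b::cbanach) \<Rightarrow> (real \<Rightarrow> 'a \<Rightarrow> 'a) \<Rightarrow> real \<Rightarrow> ('u::cbanach \<Rightarrow> 'b) \<Rightarrow> bool"
  where "bounded_into_X_neg \<iota> T \<alpha> B \<longleftrightarrow>
    clinear B \<and> range B \<subseteq> X_neg \<iota> T \<alpha> \<and>
    (\<exists>K. \<forall>v. norm_X_neg \<iota> T \<alpha> (B v) \<le> K * norm v)"


section \<open>Admissibility\<close>

definition Lp_admissible ::
    "('a::cbanach \<Rightarrow> 'b::cbanach) \<Rightarrow> (real \<Rightarrow> 'a \<Rightarrow> 'a) \<Rightarrow> ennreal \<Rightarrow> ('u::cbanach \<Rightarrow> 'b) \<Rightarrow> bool"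
  where "Lp_admissible \<iota> T p B \<longleftrightarrow>
    (\<forall>t\<ge>0. \<exists>C>0. \<forall>u\<in>Lp_space (lebesgue_on {0..t}) p. \<exists>x.
      has_strong_bochner_integral (lebesgue_on {0..t})
        (\<lambda>s. extended_semigroup \<iota> T (t - s) (B (u s))) (\<iota> x) \<and>
      norm x \<le> C * Lp_norm (lebesgue_on {0..t}) p u)"

end

theory Submission
  imports Defs "HOL-Complex_Analysis.Cauchy_Integral_Formula"
begin

text \<open>Through the resolvent \<open>R = (s - A)\<^sup>-\<^sup>1\<close> the space \<open>X\<^sub>-\<^sub>1\<close> is isometric to \<open>X\<close>, and \<open>z \<in> X\<^sub>-\<^sub>\<alpha>\<close> holds
  iff \<open>P\<^sub>\<alpha> J z \<in> D(A)\<close>, where \<open>J : X\<^sub>-\<^sub>1 \<rightarrow> X\<close> is the isometry and \<open>P\<^sub>\<alpha> x = \<integral>\<^sub>0\<^sup>\<infinity> t\<^sup>\<alpha>\<^sup>-\<^sup>1 T(t) x dt\<close>.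

  If \<open>B\<close> is \<open>L\<^sup>p\<close>-admissible and \<open>p (1 - \<alpha>) < 1\<close>, the inputs \<open>u(s) = (1 - s)\<^sup>\<alpha>\<^sup>-\<^sup>1 v\<close> belong to \<open>L\<^sup>p\<close>, so
  \<open>\<integral>\<^sub>0\<^sup>1 t\<^sup>\<alpha>\<^sup>-\<^sup>1 T(t) B v dt\<close> lies in \<open>X\<close> with norm at most \<open>C \<parallel>v\<parallel>\<close>; the rest of the integral lies in
  \<open>X\<close> because \<open>T(1)\<close> maps \<open>X\<^sub>-\<^sub>1\<close> into \<open>X\<close>.

  Conversely, Cauchy's estimate gives \<open>\<parallel>A T(t)\<parallel> \<le> C / t\<close>, and \<open>(-A)\<^sup>\<alpha>\<^sup>-\<^sup>1 (-A)\<^sup>-\<^sup>\<alpha> = (-A)\<^sup>-\<^sup>1\<close> then yields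
  \<open>\<parallel>T(t) x\<parallel> \<le> C t\<^sup>-\<^sup>\<alpha> \<parallel>P\<^sub>\<alpha> x\<parallel>\<close>. Hence \<open>\<parallel>T(t) B v\<parallel> \<le> C t\<^sup>-\<^sup>\<alpha> \<parallel>v\<parallel>\<close> whenever \<open>B\<close> is bounded into \<open>X\<^sub>-\<^sub>\<alpha>\<close>, and
  Hoelder's inequality gives admissibility as soon as \<open>\<alpha> < 1 - 1 / p\<close>.

  Since \<open>X\<close> need not be separable, identities between vector-valued integrals are checked on bounded
  real functionals, which separate points by the Hahn--Banach theorem.\<close>

section \<open>Norming functionals and uniform boundedness\<close>

text \<open>Outside \<open>extrapolated_semigroupE\<close> and the final theorem only bounded
  operators occur: the generator enters through \<open>L t\<close>, through the resolvent
  \<open>R\<close>, and through \<open>Q t\<close>, which is \<open>(s - A) T(t)\<close>. Since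
  \<open>s\<close> is an arbitrary point of the resolvent set, \<open>R\<close> need not be the
  inverse of \<open>-A\<close>; it only transports X_{-1} onto X, and all powers come from the
  integral \<open>P\<close>. Analyticity is consumed in \<open>analytic_semigroupE\<close>. Its
  definition provides strong continuity at 0 in smaller sectors, but no operator bound there, so
  uniform boundedness has to supply that bound before Cauchy's estimate applies. The power
  t^(-\<alpha>) arises because \<open>A T(t) T(r)\<close> has norm at most C/(t+r), and the integral
  of r^(-\<alpha>)/(t+r) over r > 0 scales like t^(-\<alpha>). The two directions work on opposite
  sides of the line \<alpha> = 1 - 1/p: the first picks p with 1 - 1/p < \<alpha>, the second picks
  \<alpha> < 1 - 1/p. The line itself is never treated; the equivalence rests on both ranges, p >
  1/(1-\<beta>) and \<alpha> > \<beta>, being open at the critical end.\<close>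

definition sublinear :: "('a::real_vector \<Rightarrow> real) \<Rightarrow> bool"
  where "sublinear q \<longleftrightarrow> (\<forall>x y. q (x + y) \<le> q x + q y) \<and> (\<forall>c>0. \<forall>x. q (c *\<^sub>R x) \<le> c * q x)"

lemma sublinearD:
  assumes "sublinear q"
  shows "q (x + y) \<le> q x + q y" and "c > 0 \<Longrightarrow> q (c *\<^sub>R x) = c * q x" and "q 0 = 0"
    and "- q (- x) \<le> q x"
proof -
  show add: "q (x + y) \<le> q x + q y" for x y
    using assms by (simp add: sublinear_def)
  have le: "q (c *\<^sub>R x) \<le> c * q x" if "c > 0" for c x
    using assms that by (simp add: sublinear_def)
  show "q (c *\<^sub>R x) = c * q x" if "c > 0"
  proof (rule antisym[OF le[OF that]])
    have "q (inverse c *\<^sub>R (c *\<^sub>R x)) \<le> inverse c * q (c *\<^sub>R x)"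
      using that by (intro le) simp
    then show "c * q x \<le> q (c *\<^sub>R x)"
      using that by (simp add: field_simps)
  qed
  show zero: "q 0 = 0"
    \<comment> \<open>The factor 2 gives \<open>q 0 \<ge> 0\<close>, the factor 1/2 gives
      \<open>q 0 \<le> 0\<close>.\<close>
    using le[of 2 0] le[of "1/2" 0] by simp
  show "- q (- x) \<le> q x"
    using add[of x "- x"] zero by simp
qed

text \<open>The infimum of q(x + t x0) - t q(x0) over t >= 0 is sublinear, and t = 0 and t = 1 give
  the two bounds. It serves twice: at a minimal functional it forces additivity, and applied to the
  norm it pins the value at \<open>x0\<close>.\<close>

lemma sublinear_lower_at:
  assumes q: "sublinear q"
  obtains r where "sublinear r" "\<And>x. r x \<le> q x" "\<And>x. r x \<le> q (x + x0) - q x0"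
proof -
  define g where "g x t = q (x + t *\<^sub>R x0) - t * q x0" for x and t :: real
  define r where "r x = (INF t\<in>{0..}. g x t)" for x
  have tq: "q (t *\<^sub>R x0) = t * q x0" if "t \<ge> 0" for t
    using that sublinearD(2,3)[OF q] by (cases "t = 0") auto
  have bdd: "bdd_below (g x ` {0..})" for x
  proof (rule bdd_belowI2)
    fix t :: real assume "t \<in> {0..}"
    then show "- q (- x) \<le> g x t"
      using sublinearD(1)[OF q, of "x + t *\<^sub>R x0" "- x"] tq[of t] by (simp add: g_def)
  qed
  have rle: "r x \<le> g x t" if "t \<ge> 0" for x t
    unfolding r_def using bdd that by (intro cINF_lower) auto
  have ger: "b \<le> r x" if "\<And>t. t \<ge> 0 \<Longrightarrow> b \<le> g x t" for b x
    unfolding r_def using that by (intro cINF_greatest) auto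
  show ?thesis
  proof
    show "sublinear r"
      unfolding sublinear_def
    proof safe
      fix x y
      have "r (x + y) - g y s \<le> g x t" if "s \<ge> 0" "t \<ge> 0" for s t
      proof -
        have "r (x + y) \<le> g (x + y) (t + s)"
          using that by (intro rle) simp
        also have "\<dots> \<le> g x t + g y s"
          using sublinearD(1)[OF q, of "x + t *\<^sub>R x0" "y + s *\<^sub>R x0"]
          by (simp add: g_def algebra_simps)
        finally show ?thesis by simp
      qed
      then have "r (x + y) - g y s \<le> r x" if "s \<ge> 0" for s
        using that by (intro ger) auto
      then have "r (x + y) - r x \<le> g y s" if "s \<ge> 0" for s
        using that by (fastforce simp: algebra_simps)
      then have "r (x + y) - r x \<le> r y"
        by (intro ger)
      then show "r (x + y) \<le> r x + r y" by simp
    next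
      fix c :: real and x assume c: "c > 0"
      have "r (c *\<^sub>R x) / c \<le> g x t" if "t \<ge> 0" for t
      proof -
        have "r (c *\<^sub>R x) \<le> g (c *\<^sub>R x) (c * t)"
          using that c by (intro rle) simp
        also have "\<dots> = c * g x t"
          using sublinearD(2)[OF q c, of "x + t *\<^sub>R x0"] by (simp add: g_def algebra_simps)
        finally show ?thesis using c by (simp add: field_simps)
      qed
      then have "r (c *\<^sub>R x) / c \<le> r x"
        by (intro ger)
      then show "r (c *\<^sub>R x) \<le> c * r x"
        using c by (simp add: field_simps)
    qed
    show "r x \<le> q x" for x using rle[of 0 x] by (simp add: g_def)
    show "r x \<le> q (x + x0) - q x0" for x using rle[of 1 x] by (simp add: g_def)
  qed
qed

text \<open>Hahn--Banach: a minimal sublinear functional is linear.\<close>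

lemma sublinear_above_linear:
  fixes p :: "'a::real_vector \<Rightarrow> real"
  assumes p: "sublinear p"
  obtains f where "linear f" "\<And>x. f x \<le> p x"
proof -
  define A where "A = {q. sublinear q \<and> (\<forall>x. q x \<le> p x)}"
  \<comment> \<open>The order is reversed: \<open>P q r\<close> puts \<open>r\<close> below
    \<open>q\<close>, so Zorn's maximal element is a minimal sublinear functional.\<close>
  define P where "P = (\<lambda>q r :: 'a \<Rightarrow> real. \<forall>x. r x \<le> q x)"
  \<comment> \<open>This common lower bound keeps infima of chains finite.\<close>
  have low: "- p (- x) \<le> q x" if "q \<in> A" for q x
    using that sublinearD(4)[of q x] by (auto simp: A_def intro: order_trans[rotated])
  have "\<exists>m\<in>A. \<forall>a\<in>A. P m a \<longrightarrow> a = m"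
  proof (rule predicate_Zorn)
    show "partial_order_on A (relation_of P A)"
    proof (rule partial_order_on_relation_ofI)
      show "a = b" if "P a b" "P b a" for a b
        using that by (intro ext antisym) (auto simp: P_def)
    qed (auto simp: P_def intro: order_trans)
  next
    fix C assume C: "C \<in> Chains (relation_of P A)"
    then have total: "P q r \<or> P r q" if "q \<in> C" "r \<in> C" for q r
      using that by (auto simp: Chains_def relation_of_def)
    have CA: "C \<subseteq> A"
      using C by (auto simp: Chains_def relation_of_def)
    show "\<exists>u\<in>A. \<forall>a\<in>C. P a u"
    proof (cases "C = {}")
      case True
      then show ?thesis using p by (auto simp: A_def)
    next
      case False
      define u where "u x = (INF q\<in>C. q x)" for x
      have bdd: "bdd_below ((\<lambda>q. q x) ` C)" for x
        using CA low by (intro bdd_belowI2[of _ "- p (- x)"]) auto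
      have ule: "u x \<le> q x" if "q \<in> C" for q x
        unfolding u_def using bdd that by (intro cINF_lower) auto
      have geu: "b \<le> u x" if "\<And>q. q \<in> C \<Longrightarrow> b \<le> q x" for b x
        unfolding u_def using that False by (intro cINF_greatest) auto
      have "sublinear u"
        unfolding sublinear_def
      proof safe
        fix x y
        \<comment> \<open>Here the chain property is used: the smaller of \<open>q\<close> and
          \<open>r\<close> serves for both arguments.\<close>
        have "u (x + y) - r y \<le> q x" if qr: "q \<in> C" "r \<in> C" for q r
        proof -
          obtain m where m: "m \<in> C" "m x \<le> q x" "m y \<le> r y"
            using total[OF qr] qr unfolding P_def by blast
          have "u (x + y) \<le> m (x + y)" using m ule by blast
          also have "\<dots> \<le> m x + m y"
            using m(1) CA by (intro sublinearD(1)) (auto simp: A_def)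
          finally show ?thesis using m by linarith
        qed
        then have "u (x + y) - r y \<le> u x" if "r \<in> C" for r
          using that by (intro geu) auto
        then have "u (x + y) - u x \<le> r y" if "r \<in> C" for r
          using that by (fastforce simp: algebra_simps)
        then have "u (x + y) - u x \<le> u y"
          by (intro geu)
        then show "u (x + y) \<le> u x + u y" by simp
      next
        fix c :: real and x assume c: "c > 0"
        have "u (c *\<^sub>R x) / c \<le> q x" if "q \<in> C" for q
        proof -
          have "u (c *\<^sub>R x) \<le> q (c *\<^sub>R x)" using that by (rule ule)
          also have "\<dots> = c * q x"
            using that CA c by (intro sublinearD(2)) (auto simp: A_def)
          finally show ?thesis using c by (simp add: field_simps)
        qed
        then have "u (c *\<^sub>R x) / c \<le> u x" by (intro geu)
        then show "u (c *\<^sub>R x) \<le> c * u x" using c by (simp add: field_simps)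
      qed
      moreover obtain q where "q \<in> C" using False by auto
      then have "u x \<le> p x" for x
        using ule[of q x] CA by (force simp: A_def intro: order_trans)
      ultimately have "u \<in> A" by (simp add: A_def)
      then show ?thesis using ule by (auto simp: P_def)
    qed
  qed
  then obtain m where m: "m \<in> A" and minm: "\<And>a. a \<in> A \<Longrightarrow> P m a \<Longrightarrow> a = m"
    by blast
  have sub: "sublinear m" using m by (simp add: A_def)
  have add: "m (x + y) = m x + m y" for x y
  proof (rule antisym)
    show "m (x + y) \<le> m x + m y" using sub by (rule sublinearD)
    \<comment> \<open>Minimality will force \<open>r = m\<close>, and the second bound on
      \<open>r\<close> then becomes superadditivity of \<open>m\<close>.\<close>
    obtain r where r: "sublinear r" "\<And>x. r x \<le> m x" "\<And>x. r x \<le> m (x + y) - m y"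
      by (rule sublinear_lower_at[OF sub, of y]) (rule that)
    have "\<And>x. m x \<le> p x" using m by (simp add: A_def)
    then have "r = m"
      using r by (intro minm) (auto simp: A_def P_def intro: order_trans)
    then show "m x + m y \<le> m (x + y)" using r(3)[of x] by simp
  qed
  have neg: "m (- x) = - m x" for x
    using add[of x "- x"] sublinearD(3)[OF sub] by simp
  have "m (c *\<^sub>R x) = c * m x" for c x
  proof -
    consider "c > 0" | "c = 0" | "c < 0" by linarith
    then show ?thesis
    proof cases
      case 3
      then have "m ((- c) *\<^sub>R (- x)) = (- c) * m (- x)"
        using sub by (intro sublinearD) auto
      then show ?thesis by (simp add: neg)
    qed (use sublinearD[OF sub] in auto)
  qed
  with add have "linear m" by (auto intro: linearI)
  with m show thesis by (intro that) (auto simp: A_def)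
qed

text \<open>A linear functional below the norm need not attain it at \<open>x0\<close>. Below the
  lowered functional \<open>r\<close> it must: r(-x0) <= norm 0 - norm x0, so f(x0) >= norm
  x0.\<close>

lemma norming_functional:
  fixes x0 :: "'a::real_normed_vector"
  obtains \<phi> :: "'a \<Rightarrow> real"
  where "bounded_linear \<phi>" "\<And>x. \<bar>\<phi> x\<bar> \<le> norm x" "\<phi> x0 = norm x0"
proof -
  have "sublinear (norm :: 'a \<Rightarrow> real)"
    by (auto simp: sublinear_def norm_triangle_ineq)
  then obtain r where r: "sublinear r" "\<And>x. r x \<le> norm x" "\<And>x. r x \<le> norm (x + x0) - norm x0"
    by (rule sublinear_lower_at[of norm x0]) (rule that)
  obtain f where f: "linear f" "\<And>x. f x \<le> r x"
    by (rule sublinear_above_linear[OF r(1)]) (rule that)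
  have le: "f x \<le> norm x" for x using f(2) r(2) by (rule order_trans)
  have bd: "\<bar>f x\<bar> \<le> norm x" for x
    using le[of x] le[of "- x"] linear_neg[OF f(1), of x] by simp
  have "f (- x0) \<le> - norm x0"
    using f(2)[of "- x0"] r(3)[of "- x0"] by simp
  then have "f x0 = norm x0"
    using le[of x0] linear_neg[OF f(1), of x0] by simp
  moreover have "bounded_linear f"
    using f(1) bd by (intro bounded_linear_intro[of f 1]) (auto simp: linear_add linear_scale)
  ultimately show thesis using that bd by blast
qed

lemma functionals_separate:
  fixes x y :: "'a::real_normed_vector"
  assumes "\<And>\<phi> :: 'a \<Rightarrow> real. bounded_linear \<phi> \<Longrightarrow> \<phi> x = \<phi> y"
  shows "x = y"
proof -
  obtain \<phi> :: "'a \<Rightarrow> real" where \<phi>: "bounded_linear \<phi>" "\<phi> (x - y) = norm (x - y)"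
    by (rule norming_functional[of "x - y"]) (rule that)
  have "\<phi> (x - y) = 0"
    using assms[OF \<phi>(1)] linear_diff[OF bounded_linear.linear[OF \<phi>(1)], of x y] by simp
  with \<phi>(2) show ?thesis by simp
qed

text \<open>Sokal's gliding hump: no Baire category argument is needed.\<close>

lemma uniform_boundedness_sequence:
  fixes F :: "nat \<Rightarrow> 'a::banach \<Rightarrow> 'b::real_normed_vector"
  assumes lin: "\<And>n. bounded_linear (F n)"
    and bdd: "\<And>x. \<exists>K. \<forall>n. norm (F n x) \<le> K"
  obtains K where "\<And>n x. norm (F n x) \<le> K * norm x"
proof (rule ccontr)
  assume "\<not> thesis"
  then have unb: "\<exists>n x. norm (F n x) > K * norm x" for K
    using that by (metis not_less)
  have large: "\<exists>n y. norm y \<le> r \<and> norm (F n y) \<ge> K" if r: "r > 0" for r K :: real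
  proof -
    obtain n x where nx: "norm (F n x) > \<bar>K\<bar> / r * norm x"
      using unb by blast
    interpret bounded_linear "F n" by (rule lin)
    have x: "norm x > 0"
      using nx by (cases "x = 0") (auto simp: zero)
    have "norm (F n ((r / norm x) *\<^sub>R x)) = r / norm x * norm (F n x)"
      using r x by (simp add: scaleR)
    also have "\<dots> \<ge> r / norm x * (\<bar>K\<bar> / r * norm x)"
      using nx r x by (intro mult_left_mono) auto
    also have "r / norm x * (\<bar>K\<bar> / r * norm x) = \<bar>K\<bar>"
      using r x by simp
    finally have "norm (F n ((r / norm x) *\<^sub>R x)) \<ge> K" by linarith
    moreover have "norm ((r / norm x) *\<^sub>R x) \<le> r" using r x by simp
    ultimately show ?thesis by blast
  qed
  have hump: "\<exists>n y. dist x y \<le> r \<and> norm (F n y) \<ge> K" if r: "r > 0" for x r K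
  proof -
    obtain n y where y: "norm y \<le> r" "norm (F n y) \<ge> K"
      using large[OF r] by blast
    interpret bounded_linear "F n" by (rule lin)
    \<comment> \<open>A large value at \<open>y\<close> makes the value at \<open>x + y\<close> or
      at \<open>x - y\<close> large, whatever \<open>x\<close> is.\<close>
    have "F n (x + y) - F n (x - y) = 2 *\<^sub>R F n y"
      by (simp add: add diff scaleR_2)
    then have "2 * norm (F n y) \<le> norm (F n (x + y)) + norm (F n (x - y))"
      using norm_triangle_ineq4[of "F n (x + y)" "F n (x - y)"] by simp
    then consider "norm (F n (x + y)) \<ge> K" | "norm (F n (x - y)) \<ge> K"
      using y(2) by linarith
    then show ?thesis
    proof cases
      case 1
      then show ?thesis
        using y(1) by (intro exI[of _ n] exI[of _ "x + y"]) (simp add: dist_norm)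
    next
      case 2
      then show ?thesis
        using y(1) by (intro exI[of _ n] exI[of _ "x - y"]) (simp add: dist_norm)
    qed
  qed
  \<comment> \<open>Asking for \<open>K + 1\<close> at the new centre leaves, by continuity, at
    least \<open>K\<close> on a whole closed ball around it.\<close>
  have step: "\<exists>x' n r'. dist x x' \<le> r / 2 \<and> 0 < r' \<and> r' \<le> r / 2 \<and>
      (\<forall>y. dist x' y \<le> r' \<longrightarrow> norm (F n y) \<ge> K)" if r: "r > 0" for x r K
  proof -
    obtain n x' where x': "dist x x' \<le> r / 2" "norm (F n x') \<ge> K + 1"
      using hump[of "r / 2" x "K + 1"] r by auto
    have "isCont (F n) x'"
      using lin by (rule linear_continuous_at)
    then obtain d where d: "d > 0" "\<And>y. dist y x' < d \<Longrightarrow> dist (F n y) (F n x') < 1"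
      unfolding continuous_at_eps_delta by (metis zero_less_one)
    have "norm (F n y) \<ge> K" if "dist x' y \<le> min (d / 2) (r / 2)" for y
    proof -
      have "dist (F n y) (F n x') < 1"
        using that d(1) by (intro d(2)) (simp add: dist_commute)
      then have "norm (F n x') - norm (F n y) < 1"
        by (smt (verit) dist_norm norm_minus_commute norm_triangle_ineq2)
      with x'(2) show ?thesis by linarith
    qed
    with x'(1) d(1) r show ?thesis
      by (intro exI[of _ x'] exI[of _ n] exI[of _ "min (d / 2) (r / 2)"]) auto
  qed
  \<comment> \<open>A pair \<open>f k\<close> consists of the centre and the radius of the k-th
    ball.\<close>
  have "\<exists>f :: nat \<Rightarrow> 'a \<times> real. \<forall>k. snd (f k) > 0 \<and>
      (dist (fst (f k)) (fst (f (Suc k))) \<le> snd (f k) / 2 \<and> snd (f (Suc k)) \<le> snd (f k) / 2 \<and>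
       (\<exists>n. \<forall>y. dist (fst (f (Suc k))) y \<le> snd (f (Suc k)) \<longrightarrow> norm (F n y) \<ge> real k))"
  proof (rule dependent_nat_choice)
    show "\<exists>x :: 'a \<times> real. snd x > 0" by (rule exI[of _ "(0, 1)"]) simp
    fix z :: "'a \<times> real" and k assume "snd z > 0"
    from step[OF this, of "fst z" "real k"]
    show "\<exists>y. snd y > 0 \<and> (dist (fst z) (fst y) \<le> snd z / 2 \<and> snd y \<le> snd z / 2 \<and>
       (\<exists>n. \<forall>ya. dist (fst y) ya \<le> snd y \<longrightarrow> norm (F n ya) \<ge> real k))"
      by force
  qed
  then obtain f :: "nat \<Rightarrow> 'a \<times> real" where f:
      "\<And>k. snd (f k) > 0" "\<And>k. dist (fst (f k)) (fst (f (Suc k))) \<le> snd (f k) / 2"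
      "\<And>k. snd (f (Suc k)) \<le> snd (f k) / 2"
      "\<And>k. \<exists>n. \<forall>y. dist (fst (f (Suc k))) y \<le> snd (f (Suc k)) \<longrightarrow> norm (F n y) \<ge> real k"
    by blast
  \<comment> \<open>One step moves the centre by at most r/2 and at least halves the radius, so the
    move is at most the loss of radius; the bound telescopes. In the limit \<open>x\<close> lies in
    every ball.\<close>
  have near: "dist (fst (f k)) (fst (f (k + j))) \<le> snd (f k) - snd (f (k + j))" for k j
  proof (induction j)
    case (Suc j)
    then show ?case
      using f(2)[of "k + j"] f(3)[of "k + j"]
        dist_triangle[of "fst (f k)" "fst (f (k + Suc j))" "fst (f (k + j))"]
      by simp
  qed simp
  have small: "snd (f k) \<le> snd (f 0) * (1 / 2) ^ k" for k
  proof (induction k)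
    case (Suc k)
    then show ?case using f(3)[of k] by simp
  qed simp
  have geo: "(\<lambda>k. snd (f 0) * (1 / 2) ^ k) \<longlonglongrightarrow> 0"
    by (intro tendsto_mult_right_zero LIMSEQ_power_zero) simp
  have snd0: "(\<lambda>k. snd (f k)) \<longlonglongrightarrow> 0"
  proof (rule tendsto_sandwich[OF _ _ tendsto_const geo])
    show "\<forall>\<^sub>F k in sequentially. 0 \<le> snd (f k)"
      using f(1) by (intro always_eventually) (simp add: less_imp_le)
    show "\<forall>\<^sub>F k in sequentially. snd (f k) \<le> snd (f 0) * (1 / 2) ^ k"
      using small by (intro always_eventually) simp
  qed
  have "Cauchy (\<lambda>k. fst (f k))"
  proof (rule metric_CauchyI)
    fix e :: real assume "e > 0"
    then obtain N where N: "\<And>n. n \<ge> N \<Longrightarrow> snd (f n) < e"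
      using snd0 f(1) by (force simp: lim_sequentially dist_real_def)
    have lt: "dist (fst (f m)) (fst (f n)) < e" if "m \<ge> N" "m \<le> n" for m n
      using near[of m "n - m"] N[OF that(1)] f(1)[of n] that by simp
    have "dist (fst (f m)) (fst (f n)) < e" if "m \<ge> N" "n \<ge> N" for m n
      using lt[of m n] lt[of n m] that by (cases "m \<le> n") (auto simp: dist_commute)
    then show "\<exists>M. \<forall>m\<ge>M. \<forall>n\<ge>M. dist (fst (f m)) (fst (f n)) < e"
      by blast
  qed
  then obtain x where x: "(\<lambda>k. fst (f k)) \<longlonglongrightarrow> x"
    by (auto simp: Cauchy_convergent_iff convergent_def)
  have "dist (fst (f k)) x \<le> snd (f k)" for k
  proof (rule LIMSEQ_le_const2)
    show "(\<lambda>j. dist (fst (f k)) (fst (f j))) \<longlonglongrightarrow> dist (fst (f k)) x"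
      by (intro tendsto_intros x)
    show "\<exists>N. \<forall>n\<ge>N. dist (fst (f k)) (fst (f n)) \<le> snd (f k)"
    proof (intro exI allI impI)
      fix n assume "n \<ge> k"
      then show "dist (fst (f k)) (fst (f n)) \<le> snd (f k)"
        using near[of k "n - k"] f(1)[of n] by simp
    qed
  qed
  then have "\<exists>n. norm (F n x) \<ge> real k" for k
    using f(4)[of k] by blast
  moreover obtain K where "\<And>n. norm (F n x) \<le> K" using bdd by blast
  ultimately have "real k \<le> K" for k by (meson order_trans)
  then show False
    by (metis reals_Archimedean2 not_less)
qed

section \<open>The strong Bochner integral\<close>

lemma complete_measure_lebesgue_on:
  assumes "S \<in> sets lebesgue"
  shows "complete_measure (lebesgue_on S)"
proof
  fix A B :: "'a set"
  assume "B \<subseteq> A" "A \<in> null_sets (lebesgue_on S)"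
  then have "A \<in> null_sets lebesgue" "A \<subseteq> S"
    using assms by (auto simp: null_sets_restrict_space)
  then show "B \<in> sets (lebesgue_on S)"
    using \<open>B \<subseteq> A\<close> assms completion.complete2[of B A lborel]
    by (auto simp: sets_restrict_space_iff null_sets_def)
qed

lemma (in complete_measure) borel_measurable_cong_AE:
  assumes f: "f \<in> borel_measurable M" and ae: "AE x in M. f x = g x"
  shows "g \<in> borel_measurable M"
proof (rule measurableI)
  fix A :: "'b set" assume "A \<in> sets borel"
  then have "f -` A \<inter> space M \<in> sets M"
    using f by measurable
  moreover have "AE x in M. x \<in> f -` A \<inter> space M \<longleftrightarrow> x \<in> g -` A \<inter> space M"
    using ae by eventually_elim auto
  ultimately show "g -` A \<inter> space M \<in> sets M"
    using in_sets_AE[of "f -` A \<inter> space M" "g -` A \<inter> space M"] by blast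
qed simp

text \<open>Setting everything to 0 on the exceptional null set makes the convergence pointwise;
  completeness of the measure permits the return to \<open>f\<close>.\<close>

lemma (in complete_measure) strongly_measurable_imp_borel_measurable:
  assumes "strongly_measurable M f"
  shows "f \<in> borel_measurable M"
proof -
  obtain g where g: "\<And>i::nat. simple_function M (g i)" "AE x in M. (\<lambda>i. g i x) \<longlonglongrightarrow> f x"
    using assms by (auto simp: strongly_measurable_def)
  define N where "N = {x \<in> space M. \<not> (\<lambda>i. g i x) \<longlonglongrightarrow> f x}"
  have N: "N \<in> null_sets M" using g(2) by (simp add: AE_iff_null_sets N_def)
  have "(\<lambda>x. if x \<in> N then 0 else f x) \<in> borel_measurable M"
  proof (rule borel_measurable_LIMSEQ_metric)
    fix i
    have "simple_function M (\<lambda>x. if x \<in> N then 0 else g i x)"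
      using N g(1) by (intro simple_function_If_set) auto
    then show "(\<lambda>x. if x \<in> N then 0 else g i x) \<in> borel_measurable M"
      by (rule borel_measurable_simple_function)
  qed (auto simp: N_def)
  moreover have "AE x in M. (if x \<in> N then 0 else f x) = f x"
    using AE_not_in[OF N] by eventually_elim simp
  ultimately show ?thesis by (rule borel_measurable_cong_AE)
qed

lemma strongly_measurable_compose2:
  assumes "strongly_measurable M f" "strongly_measurable M g"
    and "\<And>x y. isCont (\<lambda>(x, y). p x y) (x, y)"
  shows "strongly_measurable M (\<lambda>x. p (f x) (g x))"
proof -
  obtain f' g' where
      f': "\<And>i::nat. simple_function M (f' i)" "AE x in M. (\<lambda>i. f' i x) \<longlonglongrightarrow> f x" and
      g': "\<And>i::nat. simple_function M (g' i)" "AE x in M. (\<lambda>i. g' i x) \<longlonglongrightarrow> g x"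
    using assms(1,2) unfolding strongly_measurable_def by blast
  have "AE x in M. (\<lambda>i. p (f' i x) (g' i x)) \<longlonglongrightarrow> p (f x) (g x)"
    using f'(2) g'(2)
  proof eventually_elim
    case (elim x)
    then have "(\<lambda>i. (f' i x, g' i x)) \<longlonglongrightarrow> (f x, g x)"
      by (intro tendsto_Pair)
    from isCont_tendsto_compose[OF assms(3) this] show ?case by simp
  qed
  moreover have "simple_function M (\<lambda>x. p (f' i x) (g' i x))" for i
    using f'(1) g'(1) by (rule simple_function_compose2)
  ultimately show ?thesis
    unfolding strongly_measurable_def by (rule_tac exI[of _ "\<lambda>i x. p (f' i x) (g' i x)"]) simp
qed

lemma strongly_measurable_simple:
  "simple_function M f \<Longrightarrow> strongly_measurable M f"
  unfolding strongly_measurable_def by (intro exI[of _ "\<lambda>i. f"]) auto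

lemma strongly_measurable_diff:
  "strongly_measurable M f \<Longrightarrow> strongly_measurable M g \<Longrightarrow> strongly_measurable M (\<lambda>x. f x - g x)"
  by (rule strongly_measurable_compose2[where p = "(-)"], assumption, assumption)
     (unfold split_beta, intro continuous_diff continuous_fst continuous_snd continuous_ident)

lemma strongly_measurable_bounded_linear:
  assumes "bounded_linear L" "strongly_measurable M f"
  shows "strongly_measurable M (\<lambda>x. L (f x))"
proof (rule strongly_measurable_compose2[OF assms(2,2), where p = "\<lambda>x y. L x"])
  show "isCont (\<lambda>(x, y). L x) (x, y)" for x y
    unfolding split_beta
    by (rule bounded_linear.isCont[OF assms(1)]) (intro continuous_fst continuous_ident)
qed

lemma strongly_measurable_cong_AE:
  assumes "strongly_measurable M f" "AE x in M. f x = g x"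
  shows "strongly_measurable M g"
proof -
  obtain f' where f': "\<And>i::nat. simple_function M (f' i)" "AE x in M. (\<lambda>i. f' i x) \<longlonglongrightarrow> f x"
    using assms(1) unfolding strongly_measurable_def by blast
  have "AE x in M. (\<lambda>i. f' i x) \<longlonglongrightarrow> g x"
    using f'(2) assms(2) by eventually_elim simp
  with f'(1) show ?thesis unfolding strongly_measurable_def by blast
qed

lemma has_strong_bochner_integral_cong_AE:
  assumes "has_strong_bochner_integral M f z" and ae: "AE x in M. f x = g x"
  shows "has_strong_bochner_integral M g z"
proof -
  have "(\<integral>\<^sup>+x. ennreal (norm (f x - h x)) \<partial>M) = (\<integral>\<^sup>+x. ennreal (norm (g x - h x)) \<partial>M)" for h
    using ae by (intro nn_integral_cong_AE) auto
  with assms strongly_measurable_cong_AE[OF _ ae] show ?thesis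
    by (auto simp: has_strong_bochner_integral_def)
qed

lemma (in complete_measure) has_strong_bochner_integral_bounded_linear:
  assumes L: "bounded_linear L" and f: "has_strong_bochner_integral M f z"
  shows "has_strong_bochner_integral M (\<lambda>x. L (f x)) (L z)"
proof -
  interpret L: bounded_linear L by (rule L)
  obtain K where K: "K > 0" "\<And>x. norm (L x) \<le> norm x * K"
    using L.pos_bounded by blast
  obtain g where g: "\<And>i::nat. Bochner_Integration.simple_bochner_integrable M (g i)"
      "(\<lambda>i. \<integral>\<^sup>+x. ennreal (norm (f x - g i x)) \<partial>M) \<longlonglongrightarrow> 0"
      "(\<lambda>i. Bochner_Integration.simple_bochner_integral M (g i)) \<longlonglongrightarrow> z"
    and fm: "strongly_measurable M f"
    using f by (auto simp: has_strong_bochner_integral_def)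
  have simp_g: "simple_function M (g i)" for i
    using g(1)[of i] by (auto elim: Bochner_Integration.simple_bochner_integrable.cases)
  \<comment> \<open>The detour through strong measurability matters: in a nonseparable space a
    difference of Borel measurable maps need not be Borel measurable.\<close>
  have [measurable]: "(\<lambda>x. f x - g i x) \<in> borel_measurable M" for i
    by (intro strongly_measurable_imp_borel_measurable strongly_measurable_diff fm
        strongly_measurable_simple simp_g)
  have "(\<lambda>i. \<integral>\<^sup>+x. ennreal (norm (L (f x) - L (g i x))) \<partial>M) \<longlonglongrightarrow> 0"
  proof (rule tendsto_sandwich[OF _ _ tendsto_const])
    show "\<forall>\<^sub>F i in sequentially. (\<integral>\<^sup>+x. ennreal (norm (L (f x) - L (g i x))) \<partial>M)
        \<le> ennreal K * (\<integral>\<^sup>+x. ennreal (norm (f x - g i x)) \<partial>M)"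
    proof (rule always_eventually, rule allI)
      fix i
      have "(\<integral>\<^sup>+x. ennreal (norm (L (f x) - L (g i x))) \<partial>M)
          \<le> (\<integral>\<^sup>+x. ennreal K * ennreal (norm (f x - g i x)) \<partial>M)"
        using K by (intro nn_integral_mono)
          (simp add: L.diff[symmetric] ennreal_mult'[symmetric] mult.commute ennreal_leI)
      also have "\<dots> = ennreal K * (\<integral>\<^sup>+x. ennreal (norm (f x - g i x)) \<partial>M)"
        by (rule nn_integral_cmult) measurable
      finally show "(\<integral>\<^sup>+x. ennreal (norm (L (f x) - L (g i x))) \<partial>M)
          \<le> ennreal K * (\<integral>\<^sup>+x. ennreal (norm (f x - g i x)) \<partial>M)" .
    qed
    show "(\<lambda>i. ennreal K * (\<integral>\<^sup>+x. ennreal (norm (f x - g i x)) \<partial>M)) \<longlonglongrightarrow> 0"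
      using ennreal_tendsto_cmult[OF _ g(2), of "ennreal K"] by simp
  qed simp
  moreover have "Bochner_Integration.simple_bochner_integrable M (\<lambda>x. L (g i x))" for i
    using g(1)[of i] Bochner_Integration.simple_bochner_integrable_compose2[of "\<lambda>x y. L x" M "g i" "g i"]
    by (simp add: L.zero)
  moreover have "(\<lambda>i. Bochner_Integration.simple_bochner_integral M (\<lambda>x. L (g i x))) \<longlonglongrightarrow> L z"
    using L.tendsto[OF g(3)]
    by (simp add: Bochner_Integration.simple_bochner_integral_linear[OF L.linear_axioms g(1)])
  moreover have "strongly_measurable M (\<lambda>x. L (f x))"
    using L fm by (rule strongly_measurable_bounded_linear)
  ultimately show ?thesis
    unfolding has_strong_bochner_integral_def
    by (intro conjI exI[of _ "\<lambda>i x. L (g i x)"]) auto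
qed

text \<open>For real values the strong integral is an ordinary Bochner integral, so Fubini,
  substitution and the fundamental theorem become available for vector integrals one functional at a
  time.\<close>

lemma (in complete_measure) has_strong_bochner_integral_functional:
  fixes \<phi> :: "'b::real_normed_vector \<Rightarrow> real"
  assumes "bounded_linear \<phi>" and "has_strong_bochner_integral M f z"
  shows "has_bochner_integral M (\<lambda>x. \<phi> (f x)) (\<phi> z)"
proof -
  have "has_strong_bochner_integral M (\<lambda>x. \<phi> (f x)) (\<phi> z)"
    using assms by (rule has_strong_bochner_integral_bounded_linear)
  then show ?thesis
    unfolding has_strong_bochner_integral_def
    by (auto intro!: has_bochner_integral.intros strongly_measurable_imp_borel_measurable)
qed

lemma (in complete_measure) has_strong_bochner_integral_unique:
  assumes "has_strong_bochner_integral M f y" "has_strong_bochner_integral M f z"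
  shows "y = z"
proof (rule functionals_separate)
  fix \<phi> :: "'b \<Rightarrow> real" assume "bounded_linear \<phi>"
  from has_strong_bochner_integral_functional[OF this assms(1)]
    has_strong_bochner_integral_functional[OF this assms(2)]
  show "\<phi> y = \<phi> z" by (rule has_bochner_integral_eq)
qed

lemma (in complete_measure) strong_bochner_integral_eq:
  "has_strong_bochner_integral M f z \<Longrightarrow> strong_bochner_integral M f = z"
  unfolding strong_bochner_integral_def
  by (rule the_equality) (auto intro: has_strong_bochner_integral_unique)

text \<open>A functional norming \<open>z\<close> reduces the claim to the scalar
  inequality.\<close>

lemma (in complete_measure) has_strong_bochner_integral_norm_le:
  assumes f: "has_strong_bochner_integral M f z"
    and le: "(\<integral>\<^sup>+x. ennreal (norm (f x)) \<partial>M) \<le> ennreal c" and c: "c \<ge> 0"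
  shows "norm z \<le> c"
proof -
  obtain \<phi> :: "'b \<Rightarrow> real" where \<phi>: "bounded_linear \<phi>" "\<And>x. \<bar>\<phi> x\<bar> \<le> norm x" "\<phi> z = norm z"
    by (rule norming_functional[of z]) (rule that)
  have hb: "has_bochner_integral M (\<lambda>x. \<phi> (f x)) (\<phi> z)"
    using \<phi>(1) f by (rule has_strong_bochner_integral_functional)
  then have "ennreal (norm (\<phi> z)) \<le> (\<integral>\<^sup>+x. ennreal (norm (\<phi> (f x))) \<partial>M)"
    by (rule has_bochner_integral_norm_bound)
  also have "\<dots> \<le> (\<integral>\<^sup>+x. ennreal (norm (f x)) \<partial>M)"
    using \<phi>(2) by (intro nn_integral_mono ennreal_leI) simp
  also note le
  finally show ?thesis using \<phi>(3) c by (simp add: ennreal_le_iff)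
qed

lemma norm_simple_bochner_integral_diff_le:
  assumes s: "Bochner_Integration.simple_bochner_integrable M s"
    and t: "Bochner_Integration.simple_bochner_integrable M t"
    and [measurable]: "(\<lambda>x. norm (f x - s x)) \<in> borel_measurable M"
      "(\<lambda>x. norm (f x - t x)) \<in> borel_measurable M"
  shows "ennreal (norm (Bochner_Integration.simple_bochner_integral M s
      - Bochner_Integration.simple_bochner_integral M t))
    \<le> (\<integral>\<^sup>+x. ennreal (norm (f x - s x)) \<partial>M) + (\<integral>\<^sup>+x. ennreal (norm (f x - t x)) \<partial>M)"
proof -
  have st: "Bochner_Integration.simple_bochner_integrable M (\<lambda>x. s x - t x)"
    using Bochner_Integration.simple_bochner_integrable_compose2[of "(-)" M s t] s t by simp
  then have nst: "Bochner_Integration.simple_bochner_integrable M (\<lambda>x. norm (s x - t x))"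
    using Bochner_Integration.simple_bochner_integrable_compose2[of "\<lambda>x y. norm x" M "\<lambda>x. s x - t x"]
    by auto
  have "norm (Bochner_Integration.simple_bochner_integral M s
      - Bochner_Integration.simple_bochner_integral M t)
      \<le> Bochner_Integration.simple_bochner_integral M (\<lambda>x. norm (s x - t x))"
    using Bochner_Integration.simple_bochner_integral_norm_bound[OF st]
    by (simp add: Bochner_Integration.simple_bochner_integral_diff[OF s t])
  then have "ennreal (norm (Bochner_Integration.simple_bochner_integral M s
      - Bochner_Integration.simple_bochner_integral M t))
      \<le> (\<integral>\<^sup>+x. ennreal (norm (s x - t x)) \<partial>M)"
    using Bochner_Integration.simple_bochner_integral_eq_nn_integral[OF nst]
    by (simp add: ennreal_leI flip: Bochner_Integration.simple_bochner_integral_eq_nn_integral[OF nst])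
  also have "\<dots> \<le> (\<integral>\<^sup>+x. ennreal (norm (f x - s x)) + ennreal (norm (f x - t x)) \<partial>M)"
  proof (rule nn_integral_mono)
    fix x
    have "norm (s x - t x) \<le> norm (f x - s x) + norm (f x - t x)"
      using norm_triangle_ineq4[of "f x - t x" "f x - s x"] by simp
    then show "ennreal (norm (s x - t x)) \<le> ennreal (norm (f x - s x)) + ennreal (norm (f x - t x))"
      by (simp flip: ennreal_plus)
  qed
  also have "\<dots> = (\<integral>\<^sup>+x. ennreal (norm (f x - s x)) \<partial>M) + (\<integral>\<^sup>+x. ennreal (norm (f x - t x)) \<partial>M)"
    by (rule nn_integral_add) measurable
  finally show ?thesis .
qed

text \<open>Bochner's criterion: simple approximations are cut down to converge in L^1, and their
  integrals are then Cauchy by \<open>norm_simple_bochner_integral_diff_le\<close>.\<close>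

lemma (in complete_measure) ex_has_strong_bochner_integral:
  fixes f :: "'a \<Rightarrow> 'b::banach"
  assumes fm: "strongly_measurable M f" and fin: "(\<integral>\<^sup>+x. ennreal (norm (f x)) \<partial>M) < \<infinity>"
  obtains z where "has_strong_bochner_integral M f z"
proof -
  obtain g where g: "\<And>i::nat. simple_function M (g i)" "AE x in M. (\<lambda>i. g i x) \<longlonglongrightarrow> f x"
    using fm by (auto simp: strongly_measurable_def)
  have f_meas [measurable]: "f \<in> borel_measurable M"
    using fm by (rule strongly_measurable_imp_borel_measurable)
  have g_meas [measurable]: "g i \<in> borel_measurable M" for i
    using g(1) by (rule borel_measurable_simple_function)
  \<comment> \<open>The cut yields the integrable majorant 3 |f|. The factor 2 ensures that
    \<open>g i x\<close> eventually passes the test wherever \<open>f x\<close> is nonzero; where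
    \<open>f x = 0\<close> the cut function vanishes.\<close>
  define h where "h i x = (if norm (g i x) \<le> 2 * norm (f x) then g i x else 0)" for i x
  have h: "simple_function M (h i)" for i
    unfolding h_def[abs_def] using g(1) by (intro simple_function_If) measurable
  have hf: "norm (h i x) \<le> 2 * norm (f x)" for i x
    by (simp add: h_def)
  have diff: "norm (f x - h i x) \<le> 3 * norm (f x)" for i x
    using norm_triangle_ineq4[of "f x" "h i x"] hf[of i x] by linarith
  have fin2: "(\<integral>\<^sup>+x. ennreal (c * norm (f x)) \<partial>M) < \<infinity>" if "c \<ge> 0" for c
    using that fin by (simp add: ennreal_mult nn_integral_cmult ennreal_mult_less_top)
  have "(\<integral>\<^sup>+x. ennreal (norm (h i x)) \<partial>M) < \<infinity>" for i
    using hf by (intro le_less_trans[OF nn_integral_mono fin2[of 2]]) (auto intro: ennreal_leI)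
  then have hi: "Bochner_Integration.simple_bochner_integrable M (h i)" for i
    by (intro Bochner_Integration.simple_bochner_integrableI_bounded h)
  have nm [measurable]: "(\<lambda>x. norm (f x - h i x)) \<in> borel_measurable M" for i
  proof -
    have "(\<lambda>x. f x - h i x) \<in> borel_measurable M"
      by (intro strongly_measurable_imp_borel_measurable strongly_measurable_diff fm
          strongly_measurable_simple h)
    then show ?thesis by measurable
  qed
  have lim: "(\<lambda>i. \<integral>\<^sup>+x. ennreal (norm (f x - h i x)) \<partial>M) \<longlonglongrightarrow> (\<integral>\<^sup>+x. 0 \<partial>M)"
  proof (rule nn_integral_dominated_convergence[where w = "\<lambda>x. ennreal (3 * norm (f x))"])
    show "AE x in M. (\<lambda>i. ennreal (norm (f x - h i x))) \<longlonglongrightarrow> 0"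
      using g(2)
    proof eventually_elim
      case (elim x)
      have "(\<lambda>i. h i x) \<longlonglongrightarrow> f x"
      proof (cases "f x = 0")
        case True
        then have "h i x = 0" for i using hf[of i x] by simp
        with True show ?thesis by simp
      next
        case False
        then have "norm (f x) < 2 * norm (f x)" by simp
        then have "\<forall>\<^sub>F i in sequentially. norm (g i x) < 2 * norm (f x)"
          using tendsto_norm[OF elim] order_tendstoD(2) by blast
        then have "\<forall>\<^sub>F i in sequentially. g i x = h i x"
          by eventually_elim (simp add: h_def)
        then show ?thesis using elim by (rule Lim_transform_eventually[rotated])
      qed
      then have "(\<lambda>i. norm (f x - h i x)) \<longlonglongrightarrow> norm (f x - f x)"
        by (intro tendsto_intros)
      then show ?case using tendsto_ennrealI by fastforce
    qed
    show "AE x in M. ennreal (norm (f x - h j x)) \<le> ennreal (3 * norm (f x))" for j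
      using diff by (auto intro: ennreal_leI)
  qed (use fin2[of 3] in auto)
  have lim0: "(\<lambda>i. \<integral>\<^sup>+x. ennreal (norm (f x - h i x)) \<partial>M) \<longlonglongrightarrow> 0"
    using lim by simp
  define z where "z i = Bochner_Integration.simple_bochner_integral M (h i)" for i
  have "Cauchy z"
  proof (rule metric_CauchyI)
    fix e :: real assume e: "e > 0"
    then have "\<forall>\<^sub>F i in sequentially. (\<integral>\<^sup>+x. ennreal (norm (f x - h i x)) \<partial>M) < ennreal (e / 2)"
      using lim0 by (intro order_tendstoD(2)) auto
    then obtain N where N: "\<And>i. i \<ge> N \<Longrightarrow> (\<integral>\<^sup>+x. ennreal (norm (f x - h i x)) \<partial>M) < ennreal (e / 2)"
      by (auto simp: eventually_sequentially)
    have "dist (z m) (z n) < e" if "m \<ge> N" "n \<ge> N" for m n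
    proof -
      have "ennreal (norm (z m - z n)) < ennreal (e / 2) + ennreal (e / 2)"
        using norm_simple_bochner_integral_diff_le[OF hi hi nm nm, of m n] N[OF that(1)] N[OF that(2)]
        unfolding z_def by (meson add_strict_mono le_less_trans)
      also have "\<dots> = ennreal e"
        using e by (simp flip: ennreal_plus)
      finally show ?thesis using e by (simp add: ennreal_less_iff dist_norm)
    qed
    then show "\<exists>N. \<forall>m\<ge>N. \<forall>n\<ge>N. dist (z m) (z n) < e" by blast
  qed
  then obtain z0 where "z \<longlonglongrightarrow> z0"
    by (auto simp: Cauchy_convergent_iff convergent_def)
  then have "has_strong_bochner_integral M f z0"
    unfolding has_strong_bochner_integral_def z_def[abs_def]
    using fm hi lim0 by blast
  then show thesis by (rule that)
qed

text \<open>Measurability of \<open>s \<mapsto> H(s) u(s)\<close> is obtained from joint (sequential) continuity of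
  \<open>(s, v) \<mapsto> H(s) v\<close>, evaluated along simple approximations of both \<open>s\<close> and \<open>u\<close>.\<close>

lemma strongly_measurable_apply:
  fixes H :: "real \<Rightarrow> 'c::real_normed_vector \<Rightarrow> 'd::real_normed_vector"
  assumes u: "strongly_measurable (lebesgue_on S) u"
    and H: "AE s in lebesgue_on S. \<forall>q v. q \<longlonglongrightarrow> s \<longrightarrow> v \<longlonglongrightarrow> u s \<longrightarrow> (\<lambda>i. H (q i) (v i)) \<longlonglongrightarrow> H s (u s)"
  shows "strongly_measurable (lebesgue_on S) (\<lambda>s. H s (u s))"
proof -
  obtain u' where u': "\<And>i::nat. simple_function (lebesgue_on S) (u' i)"
      "AE x in lebesgue_on S. (\<lambda>i. u' i x) \<longlonglongrightarrow> u x"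
    using u unfolding strongly_measurable_def by blast
  have "(\<lambda>s::real. s) \<in> borel_measurable (lebesgue_on S)"
    by (rule measurable_restrict_space1) (simp add: measurable_completion)
  then obtain q where q: "\<And>i. simple_function (lebesgue_on S) (q i)"
      "\<And>s. s \<in> space (lebesgue_on S) \<Longrightarrow> (\<lambda>i. q i s) \<longlonglongrightarrow> s"
    using borel_measurable_implies_sequence_metric[of "\<lambda>s. s" "lebesgue_on S" 0] by blast
  have "AE s in lebesgue_on S. (\<lambda>i. H (q i s) (u' i s)) \<longlonglongrightarrow> H s (u s)"
    using u'(2) H AE_space
  proof eventually_elim
    case (elim s)
    with q(2)[OF elim(3)] show ?case by blast
  qed
  moreover have "simple_function (lebesgue_on S) (\<lambda>s. H (q i s) (u' i s))" for i
    using q(1) u'(1) by (rule simple_function_compose2)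
  ultimately show ?thesis
    unfolding strongly_measurable_def by (rule_tac exI[of _ "\<lambda>i s. H (q i s) (u' i s)"]) simp
qed

lemma strongly_measurable_continuous_AE:
  fixes f :: "real \<Rightarrow> 'd::real_normed_vector"
  assumes "AE s in lebesgue_on S. isCont f s"
  shows "strongly_measurable (lebesgue_on S) f"
proof (rule strongly_measurable_apply[where H = "\<lambda>s v. f s" and u = "\<lambda>_. 0 :: real"])
  show "strongly_measurable (lebesgue_on S) (\<lambda>_. 0 :: real)"
    by (intro strongly_measurable_simple) auto
  show "AE s in lebesgue_on S. \<forall>q v. q \<longlonglongrightarrow> s \<longrightarrow> v \<longlonglongrightarrow> (0::real) \<longrightarrow> (\<lambda>i. f (q i)) \<longlonglongrightarrow> f s"
    using assms by eventually_elim (auto intro: isCont_tendsto_compose)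
qed

section \<open>Scalar integrals\<close>

lemma nn_integral_lebesgue_on:
  assumes "S \<in> sets borel"
  shows "(\<integral>\<^sup>+x. f x \<partial>lebesgue_on S) = (\<integral>\<^sup>+x. f x * indicator S x \<partial>lborel)"
  using assms by (simp add: nn_integral_restrict_space nn_integral_completion)

lemma integral_lebesgue_on_eq_lborel:
  fixes f :: "'a::euclidean_space \<Rightarrow> real"
  assumes "S \<in> sets borel" "(\<lambda>x. indicator S x * f x) \<in> borel_measurable borel"
  shows "(\<integral>x. f x \<partial>lebesgue_on S) = (\<integral>x. indicator S x * f x \<partial>lborel)"
  using assms by (simp add: integral_restrict_space integral_completion)

lemma integrable_lebesgue_on_iff_lborel:
  fixes f :: "'a::euclidean_space \<Rightarrow> real"
  assumes "S \<in> sets borel" "(\<lambda>x. indicator S x * f x) \<in> borel_measurable borel"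
  shows "integrable (lebesgue_on S) f \<longleftrightarrow> integrable lborel (\<lambda>x. indicator S x * f x)"
  using assms by (simp add: integrable_restrict_space integrable_completion)

lemma nn_integral_powr_times_exp_finite:
  assumes "\<alpha> > 0" "\<omega> > 0"
  shows "(\<integral>\<^sup>+t. ennreal (t powr (\<alpha> - 1) * exp (- \<omega> * t)) \<partial>lebesgue_on {0<..}) < \<infinity>"
proof -
  have "integrable (lebesgue_on {0<..})
      (\<lambda>t. complex_of_real t powr (complex_of_real \<alpha> - 1) / of_real (exp (\<omega> * t)))"
    using absolutely_integrable_Gamma_integral[of "complex_of_real \<alpha>" \<omega>] assms
    by (simp add: set_integrable_def integrable_restrict_space)
  then have "(\<integral>\<^sup>+t. ennreal (norm (complex_of_real t powr (complex_of_real \<alpha> - 1)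
      / of_real (exp (\<omega> * t)))) \<partial>lebesgue_on {0<..}) < \<infinity>"
    by (simp add: integrable_iff_bounded)
  also have "(\<integral>\<^sup>+t. ennreal (norm (complex_of_real t powr (complex_of_real \<alpha> - 1)
      / of_real (exp (\<omega> * t)))) \<partial>lebesgue_on {0<..})
    = (\<integral>\<^sup>+t. ennreal (t powr (\<alpha> - 1) * exp (- \<omega> * t)) \<partial>lebesgue_on {0<..})"
    by (intro nn_integral_cong)
       (simp add: norm_divide norm_powr_real_powr exp_minus field_simps)
  finally show ?thesis .
qed

lemma nn_integral_powr_from_0:
  assumes "a > -1" "c \<ge> 0"
  shows "(\<integral>\<^sup>+x. ennreal (x powr a) * indicator {0..c} x \<partial>lborel) = ennreal (c powr (a + 1) / (a + 1))"
  using has_integral_powr_from_0[OF assms]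
  by (intro nn_integral_has_integral_lebesgue') auto

text \<open>The range is split at r = t, with 1/(t+r) <= 1/t before and <= 1/r after; the two pieces
  give 1/(1-\<alpha>) and 1/\<alpha>. The sharp constant is pi / sin(pi \<alpha>), but any finite
  one will do.\<close>

lemma nn_integral_powr_div_add_le:
  assumes \<alpha>: "0 < \<alpha>" "\<alpha> < 1" and t: "t > 0"
  shows "(\<integral>\<^sup>+r. ennreal (r powr (- \<alpha>) / (t + r)) \<partial>lebesgue_on {0<..})
    \<le> ennreal ((1 / (1 - \<alpha>) + 1 / \<alpha>) * t powr (- \<alpha>))"
proof -
  have "(\<integral>\<^sup>+r. ennreal (r powr (- \<alpha>) / (t + r)) \<partial>lebesgue_on {0<..})
      = (\<integral>\<^sup>+r. ennreal (r powr (- \<alpha>) / (t + r)) * indicator {0<..} r \<partial>lborel)"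
    by (rule nn_integral_lebesgue_on) simp
  also have "\<dots> \<le> (\<integral>\<^sup>+r. ennreal (1 / t) * (ennreal (r powr (- \<alpha>)) * indicator {0..t} r)
      + ennreal (r powr (- \<alpha> - 1)) * indicator {t..} r \<partial>lborel)"
  proof (rule nn_integral_mono)
    fix r :: real
    consider "r \<le> 0" | "0 < r" "r < t" | "t \<le> r" by linarith
    then show "ennreal (r powr (- \<alpha>) / (t + r)) * indicator {0<..} r
      \<le> ennreal (1 / t) * (ennreal (r powr (- \<alpha>)) * indicator {0..t} r)
      + ennreal (r powr (- \<alpha> - 1)) * indicator {t..} r"
    proof cases
      case 2
      then have "r powr (- \<alpha>) / (t + r) \<le> 1 / t * r powr (- \<alpha>)"
        using t by (simp add: frac_le)
      then show ?thesis
        using 2 t by (simp add: ennreal_leI flip: ennreal_mult)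
    next
      case 3
      have "r powr (- \<alpha>) / (t + r) \<le> r powr (- \<alpha>) / r"
        using 3 t by (intro divide_left_mono) auto
      also have "\<dots> = r powr (- \<alpha> - 1)"
        using 3 t by (simp add: powr_diff)
      finally have "ennreal (r powr (- \<alpha>) / (t + r)) \<le> ennreal (r powr (- \<alpha> - 1))"
        by (rule ennreal_leI)
      then show ?thesis
        using 3 t by (simp add: add_increasing)
    qed simp
  qed
  also have "\<dots> = ennreal (1 / t) * (\<integral>\<^sup>+r. ennreal (r powr (- \<alpha>)) * indicator {0..t} r \<partial>lborel)
      + (\<integral>\<^sup>+r. ennreal (r powr (- \<alpha> - 1)) * indicator {t..} r \<partial>lborel)"
    by (simp add: nn_integral_add nn_integral_cmult)
  also have "(\<integral>\<^sup>+r. ennreal (r powr (- \<alpha>)) * indicator {0..t} r \<partial>lborel)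
      = ennreal (t powr (1 - \<alpha>) / (1 - \<alpha>))"
    using nn_integral_powr_from_0[of "- \<alpha>" t] \<alpha> t by (simp add: algebra_simps)
  also have "(\<integral>\<^sup>+r. ennreal (r powr (- \<alpha> - 1)) * indicator {t..} r \<partial>lborel) = ennreal (t powr (- \<alpha>) / \<alpha>)"
  proof (rule nn_integral_has_integral_lebesgue')
    show "((\<lambda>x. x powr (- \<alpha> - 1)) has_integral t powr (- \<alpha>) / \<alpha>) {t..}"
      using has_integral_powr_to_inf[of "- \<alpha> - 1" t] \<alpha> t by simp
  qed simp
  also have "ennreal (1 / t) * ennreal (t powr (1 - \<alpha>) / (1 - \<alpha>)) + ennreal (t powr (- \<alpha>) / \<alpha>)
      = ennreal ((1 / (1 - \<alpha>) + 1 / \<alpha>) * t powr (- \<alpha>))"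
    using \<alpha> t
    by (simp add: powr_diff powr_minus field_simps flip: ennreal_mult ennreal_plus)
  finally show ?thesis .
qed

lemma nn_integral_Beta_kernel:
  assumes ab: "a > 0" "b > 0" and \<tau>: "\<tau> > (0::real)"
  shows "(\<integral>\<^sup>+r. ennreal (indicator {0<..<\<tau>} r * r powr (a - 1) * (\<tau> - r) powr (b - 1)) \<partial>lborel)
    = ennreal (\<tau> powr (a + b - 1) * Beta a b)"
proof -
  have "(\<integral>\<^sup>+r. ennreal (indicator {0<..<\<tau>} r * r powr (a - 1) * (\<tau> - r) powr (b - 1)) \<partial>lborel)
    = ennreal \<tau> * (\<integral>\<^sup>+r. ennreal (indicator {0<..<\<tau>} (0 + \<tau> * r) * (0 + \<tau> * r) powr (a - 1)
        * (\<tau> - (0 + \<tau> * r)) powr (b - 1)) \<partial>lborel)"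
    using \<tau> by (subst nn_integral_real_affine[where c = \<tau> and t = 0]) auto
  also have "(\<integral>\<^sup>+r. ennreal (indicator {0<..<\<tau>} (0 + \<tau> * r) * (0 + \<tau> * r) powr (a - 1)
        * (\<tau> - (0 + \<tau> * r)) powr (b - 1)) \<partial>lborel)
      = (\<integral>\<^sup>+r. ennreal (\<tau> powr (a + b - 2)) *
          (ennreal (r powr (a - 1) * (1 - r) powr (b - 1)) * indicator {0..1} r) \<partial>lborel)"
  proof (rule nn_integral_cong_AE)
    have "AE r in lborel. r \<noteq> (0::real)" "AE r in lborel. r \<noteq> (1::real)"
      by (rule AE_lborel_singleton)+
    then show "AE r in lborel. ennreal (indicator {0<..<\<tau>} (0 + \<tau> * r) * (0 + \<tau> * r) powr (a - 1)
        * (\<tau> - (0 + \<tau> * r)) powr (b - 1)) = ennreal (\<tau> powr (a + b - 2)) *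
          (ennreal (r powr (a - 1) * (1 - r) powr (b - 1)) * indicator {0..1} r)"
    proof eventually_elim
      case (elim r)
      show ?case
      proof (cases "0 < r \<and> r < 1")
        case True
        have "\<tau> - \<tau> * r = \<tau> * (1 - r)" by (simp add: algebra_simps)
        moreover have "\<tau> powr (a - 1) * \<tau> powr (b - 1) = \<tau> powr (a + b - 2)"
          by (simp flip: powr_add add: algebra_simps)
        ultimately have "(\<tau> * r) powr (a - 1) * (\<tau> - \<tau> * r) powr (b - 1)
            = \<tau> powr (a + b - 2) * (r powr (a - 1) * (1 - r) powr (b - 1))"
          using True \<tau> by (simp add: powr_mult mult_ac)
        with True \<tau> show ?thesis by (simp flip: ennreal_mult)
      next
        case False
        with elim have "r < 0 \<or> r > 1" by auto
        with \<tau> show ?thesis by (auto simp: indicator_def zero_less_mult_iff)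
      qed
    qed
  qed
  also have "\<dots> = ennreal (\<tau> powr (a + b - 2)) *
      (\<integral>\<^sup>+r. ennreal (r powr (a - 1) * (1 - r) powr (b - 1)) * indicator {0..1} r \<partial>lborel)"
    by (rule nn_integral_cmult) measurable
  also have "(\<integral>\<^sup>+r. ennreal (r powr (a - 1) * (1 - r) powr (b - 1)) * indicator {0..1} r \<partial>lborel)
      = ennreal (Beta a b)"
    using has_integral_Beta_real[OF ab] by (intro nn_integral_has_integral_lebesgue') auto
  also have "ennreal \<tau> * (ennreal (\<tau> powr (a + b - 2)) * ennreal (Beta a b))
      = ennreal (\<tau> powr (a + b - 1) * Beta a b)"
  proof -
    have "\<tau> * \<tau> powr (a + b - 2) = \<tau> powr (a + b - 1)"
      using \<tau> powr_add[of \<tau> 1 "a + b - 2"] by simp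
    moreover have "Beta a b \<ge> 0"
      using ab by (simp add: Beta_def Gamma_real_nonneg)
    ultimately show ?thesis
      using \<tau> by (simp flip: ennreal_mult mult.assoc)
  qed
  finally show ?thesis .
qed

text \<open>Convolution identity behind \<open>(-A)\<^sup>\<alpha>\<^sup>-\<^sup>1 (-A)\<^sup>-\<^sup>\<alpha> = (-A)\<^sup>-\<^sup>1\<close>.\<close>

lemma iterated_fractional_integral:
  fixes f :: "real \<Rightarrow> real"
  assumes \<alpha>: "0 < \<alpha>" "\<alpha> < 1"
    and f: "continuous_on {0<..} f" and int: "integrable (lebesgue_on {0<..}) f"
  shows "(\<integral>r. r powr (- \<alpha>) * (\<integral>s. s powr (\<alpha> - 1) * f (r + s) \<partial>lebesgue_on {0<..}) \<partial>lebesgue_on {0<..})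
    = Beta (1 - \<alpha>) \<alpha> * (\<integral>\<tau>. f \<tau> \<partial>lebesgue_on {0<..})"
proof -
  define g where "g \<tau> = indicator {0<..} \<tau> * f \<tau>" for \<tau>
  have g_meas [measurable]: "g \<in> borel_measurable borel"
    unfolding g_def[abs_def] real_scaleR_def[symmetric]
    by (rule borel_measurable_continuous_on_indicator) (use f in auto)
  have g_int: "integrable lborel g"
    using int g_meas unfolding g_def[abs_def] by (simp add: integrable_lebesgue_on_iff_lborel)
  \<comment> \<open>This is the kernel of the double integral after \<tau> = r + s; the indicator
    encodes r > 0 and s = \<tau> - r > 0.\<close>
  define k where "k r \<tau> = indicator {0<..<\<tau>} r * r powr (- \<alpha>) * (\<tau> - r) powr (\<alpha> - 1)" for r \<tau> :: real
  have k_meas [measurable]: "case_prod k \<in> borel_measurable (borel \<Otimes>\<^sub>M borel)"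
  proof -
    have "case_prod k = (\<lambda>(r, \<tau>). (if 0 < r \<and> r < \<tau> then 1 else 0) * r powr (- \<alpha>) * (\<tau> - r) powr (\<alpha> - 1))"
      by (auto simp: k_def fun_eq_iff)
    then show ?thesis by simp
  qed
  have k_nonneg: "k r \<tau> \<ge> 0" for r \<tau> by (simp add: k_def)
  have Beta_nonneg: "Beta (1 - \<alpha>) \<alpha> \<ge> 0"
    using \<alpha> by (simp add: Beta_def Gamma_real_nonneg)
  \<comment> \<open>The exponents 1-\<alpha> and \<alpha> add up to 1, so the power of \<tau> in
    \<open>nn_integral_Beta_kernel\<close> is \<tau>^0 and the integral over r is independent of
    \<tau>.\<close>
  have nn_k: "(\<integral>\<^sup>+r. ennreal (k r \<tau>) \<partial>lborel) = ennreal (Beta (1 - \<alpha>) \<alpha>)" if "\<tau> > 0" for \<tau>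
    using nn_integral_Beta_kernel[of "1 - \<alpha>" \<alpha> \<tau>] \<alpha> that by (simp add: k_def)
  have int_k: "(\<integral>r. k r \<tau> * g \<tau> \<partial>lborel) = Beta (1 - \<alpha>) \<alpha> * g \<tau>" for \<tau>
  proof (cases "\<tau> > 0")
    case True
    have "(\<lambda>r. k r \<tau>) \<in> borel_measurable lborel" by measurable
    then have "(\<integral>r. k r \<tau> \<partial>lborel) = Beta (1 - \<alpha>) \<alpha>"
      using nn_k[OF True] k_nonneg Beta_nonneg by (simp add: integral_eq_nn_integral)
    then show ?thesis by simp
  next
    case False
    then show ?thesis by (simp add: g_def)
  qed
  \<comment> \<open>By Tonelli with r integrated first, the absolute double integral is at most the
    Beta constant times the L^1 norm of \<open>g\<close>; this justifies Fubini.\<close>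
  have prod_int: "integrable (lborel \<Otimes>\<^sub>M lborel) (\<lambda>(r, \<tau>). k r \<tau> * g \<tau>)"
  proof (rule integrableI_bounded)
    show "(\<lambda>(r, \<tau>). k r \<tau> * g \<tau>) \<in> borel_measurable (lborel \<Otimes>\<^sub>M lborel)"
      by measurable
    have "(\<integral>\<^sup>+z. ennreal (norm (case z of (r, \<tau>) \<Rightarrow> k r \<tau> * g \<tau>)) \<partial>(lborel \<Otimes>\<^sub>M lborel))
      = (\<integral>\<^sup>+\<tau>. \<integral>\<^sup>+r. ennreal (norm (k r \<tau> * g \<tau>)) \<partial>lborel \<partial>lborel)"
      by (subst lborel_pair.nn_integral_snd[symmetric]) auto
    also have "\<dots> \<le> (\<integral>\<^sup>+\<tau>. ennreal (Beta (1 - \<alpha>) \<alpha>) * ennreal (norm (g \<tau>)) \<partial>lborel)"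
    proof (rule nn_integral_mono)
      fix \<tau> :: real
      have "(\<integral>\<^sup>+r. ennreal (norm (k r \<tau> * g \<tau>)) \<partial>lborel)
          = (\<integral>\<^sup>+r. ennreal (k r \<tau>) * ennreal (norm (g \<tau>)) \<partial>lborel)"
        using k_nonneg by (intro nn_integral_cong) (simp add: abs_mult ennreal_mult)
      also have "\<dots> = (\<integral>\<^sup>+r. ennreal (k r \<tau>) \<partial>lborel) * ennreal (norm (g \<tau>))"
        by (rule nn_integral_multc) measurable
      also have "\<dots> \<le> ennreal (Beta (1 - \<alpha>) \<alpha>) * ennreal (norm (g \<tau>))"
        using nn_k[of \<tau>] by (cases "\<tau> > 0") (auto simp: g_def)
      finally show "(\<integral>\<^sup>+r. ennreal (norm (k r \<tau> * g \<tau>)) \<partial>lborel)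
          \<le> ennreal (Beta (1 - \<alpha>) \<alpha>) * ennreal (norm (g \<tau>))" .
    qed
    also have "\<dots> = ennreal (Beta (1 - \<alpha>) \<alpha>) * (\<integral>\<^sup>+\<tau>. ennreal (norm (g \<tau>)) \<partial>lborel)"
      by (rule nn_integral_cmult) measurable
    also have "\<dots> < \<infinity>"
      using g_int by (simp add: integrable_iff_bounded ennreal_mult_less_top)
    finally show "(\<integral>\<^sup>+z. ennreal (norm (case z of (r, \<tau>) \<Rightarrow> k r \<tau> * g \<tau>)) \<partial>(lborel \<Otimes>\<^sub>M lborel)) < \<infinity>" .
  qed
  have inner: "(\<integral>\<tau>. k r \<tau> * g \<tau> \<partial>lborel)
      = indicator {0<..} r * (r powr (- \<alpha>) * (\<integral>s. s powr (\<alpha> - 1) * f (r + s) \<partial>lebesgue_on {0<..}))" for r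
  proof (cases "r > 0")
    case True
    have "(\<integral>\<tau>. k r \<tau> * g \<tau> \<partial>lborel) = (\<integral>s. k r (r + 1 * s) * g (r + 1 * s) \<partial>lborel)"
      by (subst lborel_integral_real_affine[where c = 1 and t = r]) auto
    also have "\<dots> = (\<integral>s. r powr (- \<alpha>) * (indicator {0<..} s * (s powr (\<alpha> - 1) * f (r + s))) \<partial>lborel)"
      using True by (intro Bochner_Integration.integral_cong) (auto simp: k_def g_def indicator_def)
    also have "\<dots> = r powr (- \<alpha>) * (\<integral>s. indicator {0<..} s * (s powr (\<alpha> - 1) * f (r + s)) \<partial>lborel)"
      by simp
    also have "(\<integral>s. indicator {0<..} s * (s powr (\<alpha> - 1) * f (r + s)) \<partial>lborel)
        = (\<integral>s. s powr (\<alpha> - 1) * f (r + s) \<partial>lebesgue_on {0<..})"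
    proof (rule integral_lebesgue_on_eq_lborel[symmetric])
      have "continuous_on {0<..} (\<lambda>s. s powr (\<alpha> - 1) * f (r + s))"
        using True by (intro continuous_intros continuous_on_compose2[OF f]) auto
      then show "(\<lambda>s. indicator {0<..} s * (s powr (\<alpha> - 1) * f (r + s))) \<in> borel_measurable borel"
        unfolding real_scaleR_def[symmetric]
        by (intro borel_measurable_continuous_on_indicator) auto
    qed simp
    finally show ?thesis using True by simp
  next
    case False
    then show ?thesis by (simp add: k_def)
  qed
  have "(\<lambda>r. \<integral>\<tau>. k r \<tau> * g \<tau> \<partial>lborel) \<in> borel_measurable lborel"
    by measurable
  then have m: "(\<lambda>r. indicator {0<..} r * (r powr (- \<alpha>) *
      (\<integral>s. s powr (\<alpha> - 1) * f (r + s) \<partial>lebesgue_on {0<..}))) \<in> borel_measurable borel"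
    by (simp add: inner)
  have "(\<integral>r. r powr (- \<alpha>) * (\<integral>s. s powr (\<alpha> - 1) * f (r + s) \<partial>lebesgue_on {0<..}) \<partial>lebesgue_on {0<..})
    = (\<integral>r. (\<integral>\<tau>. k r \<tau> * g \<tau> \<partial>lborel) \<partial>lborel)"
    using m by (subst integral_lebesgue_on_eq_lborel) (auto simp: inner)
  also have "\<dots> = (\<integral>\<tau>. (\<integral>r. k r \<tau> * g \<tau> \<partial>lborel) \<partial>lborel)"
    using lborel_pair.Fubini_integral[OF prod_int] by simp
  also have "\<dots> = Beta (1 - \<alpha>) \<alpha> * (\<integral>\<tau>. g \<tau> \<partial>lborel)"
    unfolding int_k by simp
  also have "(\<integral>\<tau>. g \<tau> \<partial>lborel) = (\<integral>\<tau>. f \<tau> \<partial>lebesgue_on {0<..})"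
    using g_meas unfolding g_def[abs_def] by (subst integral_lebesgue_on_eq_lborel) auto
  finally show ?thesis .
qed

text \<open>It will be applied to the scalar orbit \<tau> -> \<phi>(T(t+\<tau>)x), which decays at
  infinity, so that integrating its derivative recovers \<phi>(T(t)x).\<close>

lemma integral_derivative_half_line:
  fixes F f :: "real \<Rightarrow> real"
  assumes F: "\<And>t. t > 0 \<Longrightarrow> (F has_real_derivative f t) (at t)"
    and f: "\<And>t. t > 0 \<Longrightarrow> isCont f t"
    and int: "integrable (lebesgue_on {0<..}) f"
    and F0: "isCont F 0" and Finf: "(F \<longlongrightarrow> 0) at_top"
  shows "(\<integral>t. f t \<partial>lebesgue_on {0<..}) = - F 0"
proof -
  have cont: "continuous_on {0<..} f"
    using f by (auto intro: continuous_at_imp_continuous_on)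
  have meas: "(\<lambda>x. indicator {0<..} x * f x) \<in> borel_measurable borel"
    unfolding real_scaleR_def[symmetric]
    by (rule borel_measurable_continuous_on_indicator) (use cont in auto)
  have eint: "einterval 0 \<infinity> = {0<..}"
    by (auto simp: einterval_def)
  have "(LBINT x=0..\<infinity>. f x) = 0 - F 0"
  proof (rule interval_integral_FTC_integrable)
    show "set_integrable lborel (einterval 0 \<infinity>) f"
      using int meas by (simp add: eint set_integrable_def integrable_lebesgue_on_iff_lborel)
    show "((F \<circ> real_of_ereal) \<longlongrightarrow> F 0) (at_right 0)"
      using F0 unfolding zero_ereal_def
      by (simp add: ereal_tendsto_simps1 isCont_def filterlim_at_split)
    show "((F \<circ> real_of_ereal) \<longlongrightarrow> 0) (at_left \<infinity>)"
      using Finf by (simp add: ereal_tendsto_simps1)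
    show "(F has_vector_derivative f x) (at x)" if "0 < ereal x" "ereal x < \<infinity>" for x
      using F[of x] that by (simp add: has_real_derivative_iff_has_vector_derivative)
  qed (use f in auto)
  then have "(\<integral>x. indicator {0<..} x * f x \<partial>lborel) = - F 0"
    by (simp add: interval_lebesgue_integral_def eint set_lebesgue_integral_def)
  then show ?thesis
    using meas by (simp add: integral_lebesgue_on_eq_lborel)
qed

section \<open>Exponentially stable semigroups and their fractional powers\<close>

lemma bounded_clinear_imp_bounded_linear:
  assumes "bounded_clinear f"
  shows "bounded_linear f"
proof -
  obtain K where K: "\<And>x. norm (f x) \<le> K * norm x"
    using assms by (auto simp: bounded_clinear_def)
  have "f (r *\<^sub>R x) = r *\<^sub>R f x" for r x
    using assms by (simp add: bounded_clinear_def clinear_def scaleR_scaleC)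
  then show ?thesis
    using assms K
    by (intro bounded_linear_intro[of f K]) (auto simp: bounded_clinear_def clinear_def mult.commute)
qed

lemma bounded_clinear_scaleC: "bounded_clinear f \<Longrightarrow> f (c *\<^sub>C x) = c *\<^sub>C f x"
  by (simp add: bounded_clinear_def clinear_def)

lemma bounded_clinearI:
  assumes "bounded_linear f" "\<And>c x. f (c *\<^sub>C x) = c *\<^sub>C f x"
  shows "bounded_clinear f"
  using assms bounded_linear.bounded[OF assms(1)] linear_add[OF bounded_linear.linear[OF assms(1)]]
  by (auto simp: bounded_clinear_def clinear_def mult.commute)

lemma bounded_linear_scaleC: "bounded_linear (\<lambda>x. c *\<^sub>C x)"
  by (rule bounded_linear_intro[of _ "cmod c"])
     (simp_all add: scaleC_add_right scaleR_scaleC scaleC_scaleC norm_scaleC mult.commute)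

lemma has_vector_derivative_iff_quotient:
  "(f has_vector_derivative D) (at t) \<longleftrightarrow> ((\<lambda>y. (f y - f t) /\<^sub>R (y - t)) \<longlongrightarrow> D) (at t)"
proof -
  have "(f has_vector_derivative D) (at t)
      \<longleftrightarrow> ((\<lambda>y. norm ((f y - f t - (y - t) *\<^sub>R D) /\<^sub>R norm (y - t))) \<longlongrightarrow> 0) (at t)"
    by (simp only: has_vector_derivative_def has_derivative_at_within tendsto_norm_zero_iff
        bounded_linear_scaleR_left simp_thms)
  also have "\<dots> \<longleftrightarrow> ((\<lambda>y. norm ((f y - f t) /\<^sub>R (y - t) - D)) \<longlongrightarrow> 0) (at t)"
  proof (rule tendsto_cong)
    show "\<forall>\<^sub>F y in at t. norm ((f y - f t - (y - t) *\<^sub>R D) /\<^sub>R norm (y - t))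
        = norm ((f y - f t) /\<^sub>R (y - t) - D)"
      using eventually_neq_at_within[of t t UNIV]
    proof eventually_elim
      case (elim y)
      then have "f y - f t - (y - t) *\<^sub>R D = (y - t) *\<^sub>R ((f y - f t) /\<^sub>R (y - t) - D)"
        by (simp add: scaleR_right_diff_distrib)
      then show ?case using elim by (simp add: abs_mult)
    qed
  qed
  also have "\<dots> \<longleftrightarrow> ((\<lambda>y. (f y - f t) /\<^sub>R (y - t)) \<longlongrightarrow> D) (at t)"
    by (simp only: tendsto_norm_zero_iff LIM_zero_iff)
  finally show ?thesis .
qed

section \<open>Strong continuity and integral powers of an exponentially stable semigroup\<close>

locale stable_semigroup =
  fixes T :: "real \<Rightarrow> 'a::cbanach \<Rightarrow> 'a" and M \<omega> :: real
  assumes C0: "C0_semigroup T" and \<omega>_pos: "\<omega> > 0" and M_ge_1: "M \<ge> 1"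
    and norm_T: "\<And>t x. t \<ge> 0 \<Longrightarrow> norm (T t x) \<le> M * exp (- \<omega> * t) * norm x"
begin

lemma T_bounded_clinear: "t \<ge> 0 \<Longrightarrow> bounded_clinear (T t)"
  using C0 by (simp add: C0_semigroup_def)

lemma T_bounded_linear: "t \<ge> 0 \<Longrightarrow> bounded_linear (T t)"
  by (intro bounded_clinear_imp_bounded_linear T_bounded_clinear)

lemma T_diff: "t \<ge> 0 \<Longrightarrow> T t (x - y) = T t x - T t y"
  by (rule linear_diff[OF bounded_linear.linear[OF T_bounded_linear]])

lemma T_add: "s \<ge> 0 \<Longrightarrow> t \<ge> 0 \<Longrightarrow> T (s + t) x = T s (T t x)"
  using C0 by (simp add: C0_semigroup_def)

lemma T_commute: "s \<ge> 0 \<Longrightarrow> t \<ge> 0 \<Longrightarrow> T s (T t x) = T t (T s x)"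
  by (simp add: add.commute flip: T_add)

lemma T_right_cont: "((\<lambda>t. T t x) \<longlongrightarrow> x) (at_right 0)"
  using C0 by (simp add: C0_semigroup_def)

lemma norm_T_le: "t \<ge> 0 \<Longrightarrow> norm (T t x) \<le> M * norm x"
  using norm_T[of t x] M_ge_1 \<omega>_pos
  by (auto intro!: order_trans[OF norm_T] mult_right_mono simp: mult_le_cancel_left1)

text \<open>Factoring out the operator at the earlier of the two times reduces both one-sided limits
  to strong continuity at 0. To the left of \<open>s\<close> that factor varies with t, which is why
  the uniform bound \<open>M\<close> is needed.\<close>

lemma T_isCont:
  assumes "s > 0"
  shows "isCont (\<lambda>t. T t x) s"
proof -
  have le: "norm (T t x - T s x) \<le> M * norm (T \<bar>t - s\<bar> x - x)" if "t > 0" for t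
  proof (cases "t \<ge> s")
    case True
    then have "T t x - T s x = T s (T \<bar>t - s\<bar> x - x)"
      using assms T_add[of s "t - s" x] by (simp add: T_diff)
    then show ?thesis using assms by (simp add: norm_T_le)
  next
    case False
    then have "T s x - T t x = T t (T \<bar>t - s\<bar> x - x)"
      using that T_add[of t "s - t" x] by (simp add: T_diff)
    then show ?thesis using that by (metis norm_T_le less_imp_le norm_minus_commute)
  qed
  have "filterlim (\<lambda>t. \<bar>t - s\<bar>) (at_right 0) (at s)"
    unfolding filterlim_at
    by (auto simp: eventually_at_filter intro!: tendsto_eq_intros)
  from filterlim_compose[OF T_right_cont this]
  have "((\<lambda>t. M * norm (T \<bar>t - s\<bar> x - x)) \<longlongrightarrow> M * norm (x - x)) (at s)"
    by (intro tendsto_intros)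
  then have "((\<lambda>t. M * norm (T \<bar>t - s\<bar> x - x)) \<longlongrightarrow> 0) (at s)" by simp
  moreover have "\<forall>\<^sub>F t in at s. norm (T t x - T s x) \<le> M * norm (T \<bar>t - s\<bar> x - x)"
  proof -
    have "\<forall>\<^sub>F t in at s. t \<in> {0<..}"
      using assms by (intro eventually_at_in_open') auto
    then show ?thesis by eventually_elim (simp add: le)
  qed
  ultimately have "((\<lambda>t. T t x - T s x) \<longlongrightarrow> 0) (at s)"
    by (rule Lim_null_comparison[rotated])
  then show ?thesis
    unfolding isCont_def by (rule LIM_zero_cancel)
qed

lemma T_tendsto:
  assumes s: "s > 0" and q: "q \<longlonglongrightarrow> s" and v: "v \<longlonglongrightarrow> x"
  shows "(\<lambda>i. T (q i) (v i)) \<longlonglongrightarrow> T s x"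
proof -
  have "\<forall>\<^sub>F i in sequentially. q i > 0"
    using q s by (rule order_tendstoD)
  then have "\<forall>\<^sub>F i in sequentially. norm (T (q i) (v i) - T (q i) x) \<le> M * norm (v i - x)"
  proof eventually_elim
    case (elim i)
    then show ?case using norm_T_le[of "q i" "v i - x"] by (simp add: T_diff)
  qed
  moreover have "(\<lambda>i. M * norm (v i - x)) \<longlonglongrightarrow> 0"
    using tendsto_norm_zero[OF LIM_zero[OF v]] by (intro tendsto_mult_right_zero)
  ultimately have "(\<lambda>i. T (q i) (v i) - T (q i) x) \<longlonglongrightarrow> 0"
    by (rule Lim_null_comparison)
  from tendsto_add[OF this isCont_tendsto_compose[OF T_isCont[OF s, of x] q]]
  show ?thesis by simp
qed

lemma T_inverse_Suc: "(\<lambda>n. T (inverse (real (Suc n))) x) \<longlonglongrightarrow> x"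
proof -
  have "filterlim (\<lambda>n. inverse (real (Suc n))) (at_right 0) sequentially"
    unfolding filterlim_at using LIMSEQ_inverse_real_of_nat by auto
  from filterlim_compose[OF T_right_cont this] show ?thesis .
qed

text \<open>This is (-A)^(-\<alpha>) without the factor 1/Gamma(\<alpha>), which is thereby kept out
  of the estimates and returns with \<open>frac_norm\<close>.\<close>

definition P :: "real \<Rightarrow> 'a \<Rightarrow> 'a"
  where "P \<alpha> x = strong_bochner_integral (lebesgue_on {0<..}) (\<lambda>t. (t powr (\<alpha> - 1)) *\<^sub>R T t x)"

lemma neg_frac_power_eq: "neg_frac_power T \<alpha> x = (1 / Gamma \<alpha>) *\<^sub>R P \<alpha> x"
  by (simp add: neg_frac_power_def P_def)

sublocale half_line: complete_measure "lebesgue_on {0::real<..}"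
  by (rule complete_measure_lebesgue_on) simp

text \<open>For \<alpha> > 0 the value is Gamma(\<alpha>) \<omega>^(-\<alpha>); only its finiteness
  and sign are needed.\<close>

definition weight_integral :: "real \<Rightarrow> real"
  where "weight_integral \<alpha> = enn2real (\<integral>\<^sup>+t. ennreal (t powr (\<alpha> - 1) * exp (- \<omega> * t)) \<partial>lebesgue_on {0<..})"

lemma weight_integral:
  assumes "\<alpha> > 0"
  shows "(\<integral>\<^sup>+t. ennreal (t powr (\<alpha> - 1) * exp (- \<omega> * t)) \<partial>lebesgue_on {0<..}) = ennreal (weight_integral \<alpha>)"
    and "weight_integral \<alpha> \<ge> 0"
  using nn_integral_powr_times_exp_finite[OF assms \<omega>_pos]
  by (auto simp: weight_integral_def ennreal_enn2real_if)

lemma nn_integral_weight_le: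
  fixes f :: "real \<Rightarrow> 'b::real_normed_vector"
  assumes \<alpha>: "\<alpha> > 0" and c: "c \<ge> 0"
    and f: "\<And>t. t > 0 \<Longrightarrow> norm (f t) \<le> c * (t powr (\<alpha> - 1) * exp (- \<omega> * t))"
  shows "(\<integral>\<^sup>+t. ennreal (norm (f t)) \<partial>lebesgue_on {0<..}) \<le> ennreal (c * weight_integral \<alpha>)"
proof -
  have "(\<integral>\<^sup>+t. ennreal (norm (f t)) \<partial>lebesgue_on {0<..})
      \<le> (\<integral>\<^sup>+t. ennreal c * ennreal (t powr (\<alpha> - 1) * exp (- \<omega> * t)) \<partial>lebesgue_on {0<..})"
    using f c by (intro nn_integral_mono) (auto simp: ennreal_mult'[symmetric] intro!: ennreal_leI)
  also have "\<dots> = ennreal c * (\<integral>\<^sup>+t. ennreal (t powr (\<alpha> - 1) * exp (- \<omega> * t)) \<partial>lebesgue_on {0<..})"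
    by (rule nn_integral_cmult) (simp add: measurable_restrict_space1 measurable_completion)
  finally show ?thesis
    using c weight_integral[OF \<alpha>] by (simp add: ennreal_mult)
qed

text \<open>Continuity is asked only almost everywhere because \<open>tail_integral\<close> applies
  this to an integrand that jumps at 1.\<close>

lemma ex_has_integral_half_line:
  fixes f :: "real \<Rightarrow> 'b::banach"
  assumes \<alpha>: "\<alpha> > 0" and c: "c \<ge> 0"
    and cont: "AE t in lebesgue_on {0<..}. isCont f t"
    and f: "\<And>t. t > 0 \<Longrightarrow> norm (f t) \<le> c * (t powr (\<alpha> - 1) * exp (- \<omega> * t))"
  obtains z where "has_strong_bochner_integral (lebesgue_on {0<..}) f z" "norm z \<le> c * weight_integral \<alpha>"
proof -
  have le: "(\<integral>\<^sup>+t. ennreal (norm (f t)) \<partial>lebesgue_on {0<..}) \<le> ennreal (c * weight_integral \<alpha>)"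
    using \<alpha> c f by (rule nn_integral_weight_le)
  then have "(\<integral>\<^sup>+t. ennreal (norm (f t)) \<partial>lebesgue_on {0<..}) < \<infinity>"
    by (rule le_less_trans) simp
  then obtain z where z: "has_strong_bochner_integral (lebesgue_on {0<..}) f z"
    using half_line.ex_has_strong_bochner_integral[OF strongly_measurable_continuous_AE[OF cont]]
    by blast
  moreover have "norm z \<le> c * weight_integral \<alpha>"
    using half_line.has_strong_bochner_integral_norm_le[OF z le] c weight_integral(2)[OF \<alpha>] by simp
  ultimately show thesis by (rule that)
qed

lemma
  assumes \<alpha>: "\<alpha> > 0"
  shows P_has_integral:
      "has_strong_bochner_integral (lebesgue_on {0<..}) (\<lambda>t. (t powr (\<alpha> - 1)) *\<^sub>R T t x) (P \<alpha> x)"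
    and norm_P_le: "norm (P \<alpha> x) \<le> M * weight_integral \<alpha> * norm x"
proof -
  obtain z where z: "has_strong_bochner_integral (lebesgue_on {0<..}) (\<lambda>t. (t powr (\<alpha> - 1)) *\<^sub>R T t x) z"
      "norm z \<le> (M * norm x) * weight_integral \<alpha>"
  proof (rule ex_has_integral_half_line[OF \<alpha>])
    show "M * norm x \<ge> 0" using M_ge_1 by simp
    show "AE t in lebesgue_on {0<..}. isCont (\<lambda>t. (t powr (\<alpha> - 1)) *\<^sub>R T t x) t"
    proof (rule AE_I2)
      fix t :: real assume "t \<in> space (lebesgue_on {0<..})"
      then show "isCont (\<lambda>t. (t powr (\<alpha> - 1)) *\<^sub>R T t x) t"
        by (intro continuous_scaleR continuous_at_within_powr T_isCont continuous_ident continuous_const) auto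
    qed
    show "norm ((t powr (\<alpha> - 1)) *\<^sub>R T t x) \<le> M * norm x * (t powr (\<alpha> - 1) * exp (- \<omega> * t))"
      if "t > 0" for t
      using mult_left_mono[OF norm_T[of t x], of "t powr (\<alpha> - 1)"] that by (simp add: mult_ac)
  qed (rule that)
  moreover from z(1) have "P \<alpha> x = z"
    unfolding P_def by (rule half_line.strong_bochner_integral_eq)
  ultimately show "has_strong_bochner_integral (lebesgue_on {0<..}) (\<lambda>t. (t powr (\<alpha> - 1)) *\<^sub>R T t x) (P \<alpha> x)"
    "norm (P \<alpha> x) \<le> M * weight_integral \<alpha> * norm x"
    by (simp_all add: mult_ac)
qed

lemma functional_P:
  fixes \<phi> :: "'a \<Rightarrow> real"
  assumes "\<alpha> > 0" "bounded_linear \<phi>"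
  shows "has_bochner_integral (lebesgue_on {0<..}) (\<lambda>t. t powr (\<alpha> - 1) * \<phi> (T t x)) (\<phi> (P \<alpha> x))"
  using half_line.has_strong_bochner_integral_functional[OF assms(2) P_has_integral[OF assms(1)]]
  by (simp add: linear_scale[OF bounded_linear.linear[OF assms(2)]])

text \<open>A bounded operator passes under the integral, and uniqueness of the integral identifies
  the two sides. It is applied to real scalars, to \<open>T t\<close> and to the resolvent.\<close>

lemma P_commute:
  assumes \<alpha>: "\<alpha> > 0" and L: "bounded_linear L" and "\<And>t x. t > 0 \<Longrightarrow> L (T t x) = T t (L x)"
  shows "L (P \<alpha> x) = P \<alpha> (L x)"
proof (rule half_line.has_strong_bochner_integral_unique)
  have "has_strong_bochner_integral (lebesgue_on {0<..}) (\<lambda>t. L ((t powr (\<alpha> - 1)) *\<^sub>R T t x)) (L (P \<alpha> x))"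
    using L P_has_integral[OF \<alpha>] by (rule half_line.has_strong_bochner_integral_bounded_linear)
  then show "has_strong_bochner_integral (lebesgue_on {0<..}) (\<lambda>t. (t powr (\<alpha> - 1)) *\<^sub>R T t (L x)) (L (P \<alpha> x))"
    by (rule has_strong_bochner_integral_cong_AE)
       (use assms in \<open>auto simp: linear_scale[OF bounded_linear.linear[OF L]]\<close>)
  show "has_strong_bochner_integral (lebesgue_on {0<..}) (\<lambda>t. (t powr (\<alpha> - 1)) *\<^sub>R T t (L x)) (P \<alpha> (L x))"
    using \<alpha> by (rule P_has_integral)
qed

lemma P_bounded_linear:
  assumes \<alpha>: "\<alpha> > 0"
  shows "bounded_linear (P \<alpha>)"
proof (rule bounded_linear_intro[of _ "M * weight_integral \<alpha>"])
  show "P \<alpha> (x + y) = P \<alpha> x + P \<alpha> y" for x y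
  proof (rule functionals_separate)
    fix \<phi> :: "'a \<Rightarrow> real" assume \<phi>: "bounded_linear \<phi>"
    note lin = bounded_linear.linear[OF \<phi>]
    have "has_bochner_integral (lebesgue_on {0<..})
        (\<lambda>t. t powr (\<alpha> - 1) * \<phi> (T t x) + t powr (\<alpha> - 1) * \<phi> (T t y)) (\<phi> (P \<alpha> x) + \<phi> (P \<alpha> y))"
      by (intro has_bochner_integral_add functional_P \<alpha> \<phi>)
    moreover have "has_bochner_integral (lebesgue_on {0<..})
        (\<lambda>t. t powr (\<alpha> - 1) * \<phi> (T t x) + t powr (\<alpha> - 1) * \<phi> (T t y)) (\<phi> (P \<alpha> (x + y)))"
    proof (rule has_bochner_integral_cong[THEN iffD1, OF refl _ refl])
      show "has_bochner_integral (lebesgue_on {0<..}) (\<lambda>t. t powr (\<alpha> - 1) * \<phi> (T t (x + y))) (\<phi> (P \<alpha> (x + y)))"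
        using \<alpha> \<phi> by (rule functional_P)
    qed (simp add: linear_add[OF bounded_linear.linear[OF T_bounded_linear]] linear_add[OF lin] algebra_simps)
    ultimately show "\<phi> (P \<alpha> (x + y)) = \<phi> (P \<alpha> x + P \<alpha> y)"
      by (simp add: has_bochner_integral_eq linear_add[OF lin])
  qed
  show "P \<alpha> (r *\<^sub>R x) = r *\<^sub>R P \<alpha> x" for r x
    by (rule P_commute[OF \<alpha>, symmetric])
       (auto simp: bounded_linear_scaleR_right linear_scale[OF bounded_linear.linear[OF T_bounded_linear]])
  show "norm (P \<alpha> x) \<le> norm x * (M * weight_integral \<alpha>)" for x
    using norm_P_le[OF \<alpha>, of x] by (simp add: mult_ac)
qed

end

text \<open>\<open>L t\<close> is the bounded operator \<open>A T(t)\<close>.\<close>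

locale stable_differentiable_semigroup = stable_semigroup +
  fixes L :: "real \<Rightarrow> 'a \<Rightarrow> 'a"
  assumes L_bounded_linear: "\<And>t. t > 0 \<Longrightarrow> bounded_linear (L t)"
    and T_deriv: "\<And>t x. t > 0 \<Longrightarrow> ((\<lambda>t. T t x) has_vector_derivative L t x) (at t)"
begin

text \<open>The orbit \<tau> -> T(\<tau>+r)x equals both T(\<tau>)T(r)x and T(r)T(\<tau>)x for
  \<tau> > 0; its derivative at t, computed in these three ways, is unique.\<close>

lemma L_add:
  assumes t: "t > 0" and r: "r \<ge> 0"
  shows "L t (T r x) = L (t + r) x" and "T r (L t x) = L (t + r) x"
proof -
  have "((\<lambda>\<tau>. T (\<tau> + r) x) has_vector_derivative L (t + r) x) (at t)"
    using t r T_deriv[of "t + r" x] by (simp add: has_vector_derivative_def has_derivative_at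
        flip: add_diff_eq) (simp add: algebra_simps)
  then have "((\<lambda>\<tau>. T \<tau> (T r x)) has_vector_derivative L (t + r) x) (at t)"
    by (rule has_vector_derivative_transform_within_open[of _ _ _ "{0<..}"])
       (use t r in \<open>auto simp: T_add\<close>)
  with T_deriv[OF t] show 1: "L t (T r x) = L (t + r) x"
    by (rule vector_derivative_unique_at)
  have "((\<lambda>\<tau>. T r (T \<tau> x)) has_vector_derivative T r (L t x)) (at t)"
    using T_bounded_linear[OF r] T_deriv[OF t] by (rule bounded_linear.has_vector_derivative)
  then have "((\<lambda>\<tau>. T \<tau> (T r x)) has_vector_derivative T r (L t x)) (at t)"
    by (rule has_vector_derivative_transform_within_open[of _ _ _ "{0<..}"])
       (use t r in \<open>auto simp: T_commute\<close>)
  with T_deriv[OF t] show "T r (L t x) = L (t + r) x"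
    using 1 by (metis vector_derivative_unique_at)
qed

text \<open>The two-sided derivative at t > 0 becomes the right derivative at 0 of the orbit through
  \<open>T t x\<close>. Hence T(t) maps into the domain of the generator, which is what makes
  \<open>Q t\<close> a preimage under the resolvent.\<close>

lemma L_generator:
  assumes t: "t > 0"
  shows "((\<lambda>h. (T h (T t x) - T t x) /\<^sub>R h) \<longlongrightarrow> L t x) (at_right 0)"
proof -
  have q: "((\<lambda>y. (T y x - T t x) /\<^sub>R (y - t)) \<longlongrightarrow> L t x) (at t)"
    using T_deriv[OF t, of x] by (simp add: has_vector_derivative_iff_quotient)
  have "((\<lambda>h. (T (t + h) x - T t x) /\<^sub>R h) \<longlongrightarrow> L t x) (at 0)"
    using LIM_offset_zero[OF q] by simp
  then have "((\<lambda>h. (T (t + h) x - T t x) /\<^sub>R h) \<longlongrightarrow> L t x) (at_right 0)"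
    by (rule filterlim_mono) (auto simp: at_within_le_at)
  moreover have "\<forall>\<^sub>F h in at_right 0. (T (t + h) x - T t x) /\<^sub>R h = (T h (T t x) - T t x) /\<^sub>R h"
    using eventually_at_right_less[of 0]
    by eventually_elim (use t T_add[of _ t x] in \<open>simp add: add.commute\<close>)
  ultimately show ?thesis by (rule Lim_transform_eventually)
qed

end

locale stable_analytic_semigroup = stable_differentiable_semigroup +
  fixes C :: real
  assumes norm_L: "\<And>t x. t > 0 \<Longrightarrow> norm (L t x) \<le> C / t * norm x"
    and C_nonneg: "C \<ge> 0"
begin

text \<open>Formally \<open>P (1 - \<alpha>) (P \<alpha> x)\<close> is Gamma(1-\<alpha>)
  Gamma(\<alpha>) (-A)^(-1) x, and this product of Gamma values is Beta(1-\<alpha>, \<alpha>).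
  Applying \<open>A T(t)\<close> leaves -T(t)x times that constant.\<close>

lemma functional_T_eq_functional_L:
  fixes \<phi> :: "'a \<Rightarrow> real"
  assumes \<phi>: "bounded_linear \<phi>" and t: "t > 0" and \<alpha>: "0 < \<alpha>" "\<alpha> < 1"
  shows "Beta (1 - \<alpha>) \<alpha> * \<phi> (T t x) = - \<phi> (L t (P (1 - \<alpha>) (P \<alpha> x)))"
proof -
  \<comment> \<open>Absorbing \<open>L t\<close> into the functional hides the unbounded generator:
    \<psi> is bounded because t > 0.\<close>
  define \<psi> where "\<psi> y = \<phi> (L t y)" for y
  have \<psi>: "bounded_linear \<psi>"
    unfolding \<psi>_def by (rule bounded_linear_compose[OF \<phi> L_bounded_linear[OF t]])
  have \<psi>T: "bounded_linear (\<lambda>y. \<psi> (T r y))" if "r > 0" for r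
    using \<psi> T_bounded_linear that by (intro bounded_linear_compose[of \<psi> "T r"]) auto
  define f where "f \<tau> = \<psi> (T \<tau> x)" for \<tau>
  have f_cont: "isCont f \<tau>" if "\<tau> > 0" for \<tau>
    unfolding f_def using that by (intro bounded_linear.isCont[OF \<psi>] T_isCont)
  \<comment> \<open>This is the case \<alpha> = 1 of \<open>functional_P\<close>, whose weight is
    constantly 1 on the open half-line.\<close>
  have f_int: "integrable (lebesgue_on {0<..}) f"
  proof (rule Bochner_Integration.integrable_cong[THEN iffD1, OF refl])
    show "integrable (lebesgue_on {0<..}) (\<lambda>\<tau>. \<tau> powr (1 - 1) * \<psi> (T \<tau> x))"
      using functional_P[of 1, OF _ \<psi>, of x] by (simp only: has_bochner_integral_iff)
  qed (simp add: f_def)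
  have "\<psi> (P (1 - \<alpha>) (P \<alpha> x)) = (\<integral>r. r powr (- \<alpha>) * \<psi> (T r (P \<alpha> x)) \<partial>lebesgue_on {0<..})"
    using functional_P[of "1 - \<alpha>", OF _ \<psi>, of "P \<alpha> x"] \<alpha> by (simp add: has_bochner_integral_iff)
  also have "\<dots> = (\<integral>r. r powr (- \<alpha>) * (\<integral>s. s powr (\<alpha> - 1) * f (r + s) \<partial>lebesgue_on {0<..}) \<partial>lebesgue_on {0<..})"
  proof (rule Bochner_Integration.integral_cong[OF refl])
    fix r :: real assume "r \<in> space (lebesgue_on {0<..})"
    then have r: "r > 0" by simp
    have "\<psi> (T r (P \<alpha> x)) = (\<integral>s. s powr (\<alpha> - 1) * \<psi> (T r (T s x)) \<partial>lebesgue_on {0<..})"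
      using functional_P[OF \<alpha>(1) \<psi>T[OF r], of x] by (simp add: has_bochner_integral_iff)
    also have "\<dots> = (\<integral>s. s powr (\<alpha> - 1) * f (r + s) \<partial>lebesgue_on {0<..})"
      using r by (intro Bochner_Integration.integral_cong) (auto simp: f_def T_add)
    finally show "r powr (- \<alpha>) * \<psi> (T r (P \<alpha> x))
        = r powr (- \<alpha>) * (\<integral>s. s powr (\<alpha> - 1) * f (r + s) \<partial>lebesgue_on {0<..})"
      by simp
  qed
  also have "\<dots> = Beta (1 - \<alpha>) \<alpha> * (\<integral>\<tau>. f \<tau> \<partial>lebesgue_on {0<..})"
    using \<alpha> f_cont f_int
    by (intro iterated_fractional_integral) (auto intro: continuous_at_imp_continuous_on)
  \<comment> \<open>The antiderivative of \<open>f\<close> is \<tau> -> \<phi>(T(t+\<tau>)x); since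
    t > 0, it is differentiable at \<tau> = 0 too.\<close>
  also have "(\<integral>\<tau>. f \<tau> \<partial>lebesgue_on {0<..}) = - \<phi> (T (t + 0) x)"
  proof (rule integral_derivative_half_line)
    have D: "((\<lambda>\<tau>. \<phi> (T (t + \<tau>) x)) has_real_derivative \<phi> (L (t + \<tau>) x)) (at \<tau>)" if "\<tau> \<ge> 0" for \<tau>
    proof -
      have "((\<lambda>\<tau>. T (t + \<tau>) x) has_vector_derivative L (t + \<tau>) x) (at \<tau>)"
        using t that T_deriv[of "t + \<tau>" x]
        by (simp add: has_vector_derivative_def has_derivative_at algebra_simps)
      from bounded_linear.has_vector_derivative[OF \<phi> this] show ?thesis
        by (simp add: has_real_derivative_iff_has_vector_derivative)
    qed
    show "((\<lambda>\<tau>. \<phi> (T (t + \<tau>) x)) has_real_derivative f \<tau>) (at \<tau>)" if "\<tau> > 0" for \<tau>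
      using D[of \<tau>] that t by (simp add: f_def \<psi>_def L_add)
    show "isCont (\<lambda>\<tau>. \<phi> (T (t + \<tau>) x)) 0"
      using D[of 0] by (intro DERIV_isCont) auto
    obtain K' where K': "\<And>y. \<bar>\<phi> y\<bar> \<le> norm y * K'" "K' > 0"
      using bounded_linear.pos_bounded[OF \<phi>] by auto
    have lim: "((\<lambda>\<tau>. M * exp (- \<omega> * (t + \<tau>)) * norm x * K') \<longlongrightarrow> 0) at_top"
    proof -
      have "filterlim (\<lambda>\<tau>. \<omega> * (t + \<tau>)) at_top at_top"
        using \<omega>_pos
        by (intro filterlim_tendsto_pos_mult_at_top[OF tendsto_const] filterlim_tendsto_add_at_top[OF tendsto_const] filterlim_ident)
      then have "filterlim (\<lambda>\<tau>. - (\<omega> * (t + \<tau>))) at_bot at_top"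
        by (simp add: filterlim_uminus_at_top)
      then have "((\<lambda>\<tau>. exp (- (\<omega> * (t + \<tau>)))) \<longlongrightarrow> 0) at_top"
        by (rule filterlim_compose[OF exp_at_bot])
      then have "((\<lambda>\<tau>. M * norm x * K' * exp (- (\<omega> * (t + \<tau>)))) \<longlongrightarrow> 0) at_top"
        by (rule tendsto_mult_right_zero)
      then show ?thesis by (simp add: mult_ac)
    qed
    show "((\<lambda>\<tau>. \<phi> (T (t + \<tau>) x)) \<longlongrightarrow> 0) at_top"
    proof (rule Lim_null_comparison[OF _ lim])
      show "\<forall>\<^sub>F \<tau> in at_top. norm (\<phi> (T (t + \<tau>) x)) \<le> M * exp (- \<omega> * (t + \<tau>)) * norm x * K'"
        using eventually_ge_at_top[of 0]
      proof eventually_elim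
        case (elim \<tau>)
        have "norm (\<phi> (T (t + \<tau>) x)) \<le> norm (T (t + \<tau>) x) * K'" using K'(1) by simp
        also have "\<dots> \<le> M * exp (- \<omega> * (t + \<tau>)) * norm x * K'"
          using elim t K'(2) by (intro mult_right_mono norm_T) auto
        finally show ?case .
      qed
    qed
  qed (use f_cont f_int in auto)
  finally show ?thesis by (simp add: \<psi>_def)
qed

text \<open>In the identity for T(t)x, the outer integral \<open>P (1 - \<alpha>)\<close> puts
  \<open>L t (T r y) = L (t + r) y\<close> against r^(-\<alpha>). Integrating the bound C/(t+r)
  produces t^(-\<alpha>). The identity is scalar, so it is tested on a functional norming
  \<open>T t x\<close>.\<close>

theorem norm_T_le_norm_P:
  assumes \<alpha>: "0 < \<alpha>" "\<alpha> < 1"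
  obtains K where "K \<ge> 0" "\<And>t x. t > 0 \<Longrightarrow> norm (T t x) \<le> K * t powr (- \<alpha>) * norm (P \<alpha> x)"
proof
  define b where "b = Beta (1 - \<alpha>) \<alpha>"
  define c where "c = 1 / (1 - \<alpha>) + 1 / \<alpha>"
  have b: "b > 0"
    using \<alpha> unfolding b_def Beta_def by (simp add: Gamma_real_pos)
  have c: "c \<ge> 0" using \<alpha> by (simp add: c_def)
  show "C * c / b \<ge> 0" using C_nonneg b c by simp
  fix t x assume t: "t > (0::real)"
  obtain \<phi> :: "'a \<Rightarrow> real" where \<phi>: "bounded_linear \<phi>" "\<And>x. \<bar>\<phi> x\<bar> \<le> norm x" "\<phi> (T t x) = norm (T t x)"
    by (rule norming_functional[of "T t x"]) (rule that)
  define y where "y = P \<alpha> x"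
  have \<psi>: "bounded_linear (\<lambda>z. \<phi> (L t z))"
    by (rule bounded_linear_compose[OF \<phi>(1) L_bounded_linear[OF t]])
  have meas: "(\<lambda>r. ennreal (r powr (- \<alpha>) / (t + r))) \<in> borel_measurable (lebesgue_on {0<..})"
    by (simp add: measurable_restrict_space1 measurable_completion)
  have "has_bochner_integral (lebesgue_on {0<..}) (\<lambda>r. r powr (1 - \<alpha> - 1) * \<phi> (L t (T r y))) (\<phi> (L t (P (1 - \<alpha>) y)))"
    using \<alpha> by (intro functional_P[OF _ \<psi>]) simp
  then have "ennreal (norm (\<phi> (L t (P (1 - \<alpha>) y))))
      \<le> (\<integral>\<^sup>+r. ennreal (norm (r powr (1 - \<alpha> - 1) * \<phi> (L t (T r y)))) \<partial>lebesgue_on {0<..})"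
    by (rule has_bochner_integral_norm_bound)
  also have "\<dots> \<le> (\<integral>\<^sup>+r. ennreal (C * norm y) * ennreal (r powr (- \<alpha>) / (t + r)) \<partial>lebesgue_on {0<..})"
  proof (rule nn_integral_mono)
    fix r :: real assume "r \<in> space (lebesgue_on {0<..})"
    then have r: "r > 0" by simp
    have "\<bar>\<phi> (L t (T r y))\<bar> \<le> C / (t + r) * norm y"
      using \<phi>(2)[of "L t (T r y)"] norm_L[of "t + r" y] t r by (simp add: L_add)
    from mult_left_mono[OF this, of "r powr (- \<alpha>)"]
    have "norm (r powr (1 - \<alpha> - 1) * \<phi> (L t (T r y))) \<le> r powr (- \<alpha>) * (C / (t + r) * norm y)"
      by (simp add: abs_mult)
    also have "\<dots> = (C * norm y) * (r powr (- \<alpha>) / (t + r))" by simp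
    finally show "ennreal (norm (r powr (1 - \<alpha> - 1) * \<phi> (L t (T r y))))
        \<le> ennreal (C * norm y) * ennreal (r powr (- \<alpha>) / (t + r))"
      using C_nonneg by (simp add: ennreal_leI flip: ennreal_mult')
  qed
  also have "\<dots> = ennreal (C * norm y) * (\<integral>\<^sup>+r. ennreal (r powr (- \<alpha>) / (t + r)) \<partial>lebesgue_on {0<..})"
    using meas by (rule nn_integral_cmult)
  also have "\<dots> \<le> ennreal (C * norm y) * ennreal (c * t powr (- \<alpha>))"
    unfolding c_def using \<alpha> t by (intro mult_left_mono nn_integral_powr_div_add_le) auto
  also have "\<dots> = ennreal (C * norm y * (c * t powr (- \<alpha>)))"
    using C_nonneg c by (simp add: ennreal_mult)
  finally have "norm (\<phi> (L t (P (1 - \<alpha>) y))) \<le> C * norm y * (c * t powr (- \<alpha>))"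
    using C_nonneg c by (simp add: ennreal_le_iff)
  moreover have "b * norm (T t x) = - \<phi> (L t (P (1 - \<alpha>) y))"
    using functional_T_eq_functional_L[OF \<phi>(1) t \<alpha>, of x] by (simp add: \<phi>(3) b_def y_def)
  ultimately have "b * norm (T t x) \<le> C * norm y * (c * t powr (- \<alpha>))" by simp
  then show "norm (T t x) \<le> C * c / b * t powr (- \<alpha>) * norm (P \<alpha> x)"
    using b by (simp add: y_def field_simps)
qed

end

section \<open>Explicit constants from stability and analyticity\<close>

lemma exponentially_stableE:
  assumes T: "C0_semigroup T" "exponentially_stable T"
  obtains M \<omega> where "stable_semigroup T M \<omega>"
proof -
  have "Inf (ereal ` {\<omega>. \<exists>M\<ge>1. \<forall>t\<ge>0. onorm (T t) \<le> M * exp (\<omega> * t)}) < 0"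
    using T(2) by (simp add: exponentially_stable_def growth_bound_def)
  then obtain w M where w: "w < 0" "M \<ge> 1" "\<And>t. t \<ge> 0 \<Longrightarrow> onorm (T t) \<le> M * exp (w * t)"
    by (auto simp: Inf_less_iff)
  have "norm (T t x) \<le> M * exp (- (- w) * t) * norm x" if "t \<ge> 0" for t x
  proof -
    have "bounded_linear (T t)"
      using T(1) that by (simp add: C0_semigroup_def bounded_clinear_imp_bounded_linear)
    then have "norm (T t x) \<le> onorm (T t) * norm x" by (rule onorm)
    also have "\<dots> \<le> M * exp (w * t) * norm x"
      using w(3)[OF that] by (intro mult_right_mono) auto
    finally show ?thesis by simp
  qed
  with T(1) w(1,2) have "stable_semigroup T M (- w)"
    by unfold_locales auto
  then show thesis by (rule that)
qed

lemma of_real_in_sector: "t > 0 \<Longrightarrow> \<phi> > 0 \<Longrightarrow> complex_of_real t \<in> sector \<phi>"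
  by (simp add: sector_def Arg_of_real)

text \<open>Sectors are invariant under dilation, so one ball about 1 suffices; its radius comes
  from continuity of \<open>Arg\<close> at 1, and \<kappa> < 1 keeps 0 outside. A radius
  proportional to t is what turns Cauchy's estimate into C/t.\<close>

lemma cball_subset_sector:
  assumes "\<psi> > 0"
  obtains \<kappa> where "0 < \<kappa>" "\<kappa> < 1" "\<And>t. t > 0 \<Longrightarrow> cball (complex_of_real t) (\<kappa> * t) \<subseteq> sector \<psi>"
proof -
  have "isCont Arg 1"
    by (rule continuous_at_Arg) (simp add: complex_nonpos_Reals_iff)
  then obtain d where d: "d > 0" "\<And>w. dist w 1 < d \<Longrightarrow> dist (Arg w) (Arg 1) < \<psi>"
    using assms unfolding continuous_at_eps_delta by blast
  define \<kappa> where "\<kappa> = min (d / 2) (1 / 2)"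
  have \<kappa>: "0 < \<kappa>" "\<kappa> < 1" "\<kappa> < d" using d(1) by (auto simp: \<kappa>_def)
  show thesis
  proof (rule that[OF \<kappa>(1,2)], rule subsetI)
    fix t :: real and z assume t: "t > 0" and z: "z \<in> cball (complex_of_real t) (\<kappa> * t)"
    define w where "w = z / of_real t"
    have zw: "z = of_real t * w" using t by (simp add: w_def)
    have "norm (of_real t - z) = t * norm (1 - w)"
    proof -
      have "of_real t - z = of_real t * (1 - w)" by (simp add: zw algebra_simps)
      then show ?thesis using t by (simp add: norm_mult)
    qed
    with z t have w: "norm (1 - w) \<le> \<kappa>" by (simp add: dist_norm mult.commute)
    then have "w \<noteq> 0" using \<kappa>(2) by auto
    moreover have "\<bar>Arg w\<bar> < \<psi>"
      using d(2)[of w] w \<kappa>(3) by (simp add: dist_norm norm_minus_commute)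
    ultimately show "z \<in> sector \<psi>"
      using t by (simp add: zw sector_def Arg_times_of_real)
  qed
qed

text \<open>The complexification \<phi>(x) - i \<phi>(ix) of a real norming functional. The crude
  factor 2 is harmless; complex homogeneity is what makes scalar Cauchy estimates applicable to
  \<open>S z x\<close>.\<close>

lemma complex_functional:
  fixes x0 :: "'a::cbanach"
  obtains \<psi> :: "'a \<Rightarrow> complex"
  where "bounded_linear \<psi>" "\<And>c x. \<psi> (c *\<^sub>C x) = c * \<psi> x" "\<And>x. norm (\<psi> x) \<le> 2 * norm x"
    "norm x0 \<le> norm (\<psi> x0)"
proof -
  obtain \<phi> :: "'a \<Rightarrow> real" where \<phi>: "bounded_linear \<phi>" "\<And>x. \<bar>\<phi> x\<bar> \<le> norm x" "\<phi> x0 = norm x0"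
    by (rule norming_functional[of x0]) (rule that)
  note lin = bounded_linear.linear[OF \<phi>(1)]
  define \<psi> where "\<psi> x = Complex (\<phi> x) (- \<phi> (\<i> *\<^sub>C x))" for x
  have add: "\<psi> (x + y) = \<psi> x + \<psi> y" for x y
    by (simp add: \<psi>_def complex_eq_iff linear_add[OF lin] scaleC_add_right)
  have scale: "\<psi> (c *\<^sub>C x) = c * \<psi> x" for c x
  proof -
    have "c *\<^sub>C x = Re c *\<^sub>R x + Im c *\<^sub>R (\<i> *\<^sub>C x)"
      by (simp add: scaleR_scaleC scaleC_scaleC flip: scaleC_add_left)
        (metis complex_eq mult.commute)
    moreover have "\<i> *\<^sub>C c *\<^sub>C x = Re c *\<^sub>R (\<i> *\<^sub>C x) - Im c *\<^sub>R x"
    proof -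
      have "\<i> * c = of_real (Re c) * \<i> + of_real (- Im c)"
        by (simp add: complex_eq_iff)
      then have "\<i> *\<^sub>C c *\<^sub>C x = Re c *\<^sub>R (\<i> *\<^sub>C x) + (- Im c) *\<^sub>R x"
        by (simp only: scaleR_scaleC scaleC_scaleC flip: scaleC_add_left)
      then show ?thesis by simp
    qed
    ultimately show ?thesis
      by (simp add: \<psi>_def complex_eq_iff linear_add[OF lin] linear_diff[OF lin] linear_scale[OF lin])
  qed
  have bd: "norm (\<psi> x) \<le> 2 * norm x" for x
    using cmod_le[of "\<psi> x"] \<phi>(2)[of x] \<phi>(2)[of "\<i> *\<^sub>C x"] by (simp add: \<psi>_def norm_scaleC)
  have "bounded_linear \<psi>"
    by (rule bounded_linear_intro[of _ 2])
       (use bd add scale in \<open>auto simp: scaleR_scaleC scaleC_complex_def mult.commute\<close>)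
  moreover have "norm x0 \<le> norm (\<psi> x0)"
    using complex_Re_le_cmod[of "\<psi> x0"] \<phi>(3) by (simp add: \<psi>_def)
  ultimately show thesis using that scale bd by blast
qed

lemma op_holomorphic_pointwise:
  assumes bl: "\<And>w. w \<in> \<Omega> \<Longrightarrow> bounded_linear (S w)" and z: "z \<in> \<Omega>" and L: "bounded_linear L"
    and lim: "((\<lambda>w. onorm (\<lambda>x. inverse (w - z) *\<^sub>C (S w x - S z x) - L x)) \<longlongrightarrow> 0) (at z within \<Omega>)"
  shows "((\<lambda>w. inverse (w - z) *\<^sub>C (S w x - S z x)) \<longlongrightarrow> L x) (at z within \<Omega>)"
proof -
  have "((\<lambda>w. inverse (w - z) *\<^sub>C (S w x - S z x) - L x) \<longlongrightarrow> 0) (at z within \<Omega>)"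
  proof (rule Lim_null_comparison)
    show "\<forall>\<^sub>F w in at z within \<Omega>. norm (inverse (w - z) *\<^sub>C (S w x - S z x) - L x)
        \<le> onorm (\<lambda>x. inverse (w - z) *\<^sub>C (S w x - S z x) - L x) * norm x"
      unfolding eventually_at_filter
    proof (rule always_eventually, intro allI impI)
      fix w assume "w \<in> \<Omega>"
      then have "bounded_linear (\<lambda>x. inverse (w - z) *\<^sub>C (S w x - S z x) - L x)"
        using z bl L
        by (intro bounded_linear_sub bounded_linear_compose[OF bounded_linear_scaleC]) auto
      then show "norm (inverse (w - z) *\<^sub>C (S w x - S z x) - L x)
        \<le> onorm (\<lambda>x. inverse (w - z) *\<^sub>C (S w x - S z x) - L x) * norm x"
        by (rule onorm)
    qed
    show "((\<lambda>w. onorm (\<lambda>x. inverse (w - z) *\<^sub>C (S w x - S z x) - L x) * norm x) \<longlongrightarrow> 0) (at z within \<Omega>)"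
      using lim by (rule tendsto_mult_left_zero)
  qed
  then show ?thesis by (rule LIM_zero_cancel)
qed

text \<open>Otherwise there are points z_n -> 0 in the domain whose operators exceed n on some
  vector. Yet \<open>S (z n) y\<close> converges for each y, so these operators are pointwise, hence
  uniformly, bounded.\<close>

lemma bounded_near_zero_of_strongly_continuous:
  fixes S :: "complex \<Rightarrow> 'a::banach \<Rightarrow> 'a"
  assumes bl: "\<And>z. z \<in> \<Omega> \<Longrightarrow> bounded_linear (S z)" and "0 \<notin> \<Omega>"
    and lim: "\<And>x. ((\<lambda>z. S z x) \<longlongrightarrow> x) (at 0 within \<Omega>)"
  obtains \<delta> K where "\<delta> > 0" "K \<ge> 0" "\<And>z x. z \<in> \<Omega> \<Longrightarrow> norm z < \<delta> \<Longrightarrow> norm (S z x) \<le> K * norm x"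
proof (rule ccontr)
  assume neg: "\<not> thesis"
  note obtained = that
  have "\<exists>z x. z \<in> \<Omega> \<and> norm z < \<delta> \<and> norm (S z x) > K * norm x" if "\<delta> > 0" "K \<ge> 0" for \<delta> K
  proof (rule ccontr)
    assume "\<not> ?thesis"
    then have "norm (S z x) \<le> K * norm x" if "z \<in> \<Omega>" "norm z < \<delta>" for z x
      using that by (auto simp: not_less)
    from obtained[OF that this] neg show False by blast
  qed
  then have "\<forall>n. \<exists>z x. z \<in> \<Omega> \<and> norm z < inverse (real (Suc n)) \<and> norm (S z x) > real n * norm x"
    by auto
  then obtain z x where z: "\<And>n. z n \<in> \<Omega>" "\<And>n. norm (z n) < inverse (real (Suc n))"
      "\<And>n. norm (S (z n) (x n)) > real n * norm (x n)"
    by metis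
  have "z \<longlonglongrightarrow> 0"
    by (rule Lim_null_comparison[OF _ LIMSEQ_inverse_real_of_nat])
       (use z(2) in \<open>auto intro: always_eventually less_imp_le\<close>)
  moreover have "z n \<noteq> 0" for n using z(1)[of n] assms(2) by auto
  ultimately have "filterlim z (at 0 within \<Omega>) sequentially"
    using z(1) by (simp add: filterlim_at)
  then have zlim: "(\<lambda>n. S (z n) y) \<longlonglongrightarrow> y" for y
    by (rule filterlim_compose[OF lim])
  have bdd: "\<exists>K. \<forall>n. norm (S (z n) y) \<le> K" for y
  proof -
    have "Bseq (\<lambda>n. S (z n) y)"
      by (rule convergent_imp_Bseq[OF convergentI[OF zlim]])
    then show ?thesis by (auto simp: Bseq_def)
  qed
  obtain K where K: "\<And>n y. norm (S (z n) y) \<le> K * norm y"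
    by (rule uniform_boundedness_sequence[of "\<lambda>n. S (z n)"]) (use bl z(1) bdd in blast)+
  obtain n where "real n > K" using reals_Archimedean2 by blast
  then have "K * norm (x n) \<le> real n * norm (x n)" by (intro mult_right_mono) auto
  with z(3)[of n] K[of n "x n"] show False by simp
qed

text \<open>For small t the bound C/t is Cauchy's estimate on a circle of radius \<kappa> t about t.
  For large t a fixed fraction of time is spent on smoothing, and exponential decay of the rest is
  weakened to 1/t.\<close>

lemma analytic_semigroupE:
  assumes an: "analytic_semigroup T" and st: "exponentially_stable T"
  obtains M \<omega> L C where "stable_analytic_semigroup T M \<omega> L C"
proof -
  have C0: "C0_semigroup T" using an by (simp add: analytic_semigroup_def)
  obtain M \<omega> where "stable_semigroup T M \<omega>"
    using C0 st by (rule exponentially_stableE)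
  then interpret stable_semigroup T M \<omega> .
  obtain \<phi> S where \<phi>: "0 < \<phi>" "\<phi> \<le> pi / 2"
    and S_T: "\<And>t. t \<ge> 0 \<Longrightarrow> S (complex_of_real t) = T t"
    and S_bl: "\<And>z. z \<in> sector \<phi> \<Longrightarrow> bounded_clinear (S z)"
    and S_hol: "op_holomorphic_on S (sector \<phi>)"
    and S_lim: "\<And>\<psi> x. 0 < \<psi> \<Longrightarrow> \<psi> < \<phi> \<Longrightarrow> ((\<lambda>z. S z x) \<longlongrightarrow> x) (at 0 within sector \<psi>)"
    using an unfolding analytic_semigroup_def by blast
  have S_blr: "bounded_linear (S z)" if "z \<in> sector \<phi>" for z
    using S_bl[OF that] by (rule bounded_clinear_imp_bounded_linear)
  obtain D where D: "\<And>z. z \<in> sector \<phi> \<Longrightarrow> bounded_clinear (D z)"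
    and D_lim: "\<And>z. z \<in> sector \<phi> \<Longrightarrow>
      ((\<lambda>w. onorm (\<lambda>x. inverse (w - z) *\<^sub>C (S w x - S z x) - D z x)) \<longlongrightarrow> 0) (at z within sector \<phi>)"
    using bchoice[OF S_hol[unfolded op_holomorphic_on_def]] by blast
  have quot: "((\<lambda>w. inverse (w - z) *\<^sub>C (S w x - S z x)) \<longlongrightarrow> D z x) (at z within sector \<phi>)"
    if "z \<in> sector \<phi>" for z x
    using S_blr that bounded_clinear_imp_bounded_linear[OF D[OF that]] D_lim[OF that]
    by (rule op_holomorphic_pointwise)
  define L where "L t = D (complex_of_real t)" for t
  interpret stable_differentiable_semigroup T M \<omega> L
  proof (intro stable_differentiable_semigroup.intro stable_differentiable_semigroup_axioms.intro
      stable_semigroup_axioms)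
    show "bounded_linear (L t)" if "t > 0" for t
      unfolding L_def using D[OF of_real_in_sector[OF that \<phi>(1)]]
      by (rule bounded_clinear_imp_bounded_linear)
    fix t :: real and x assume t: "t > 0"
    let ?z = "complex_of_real t"
    have z: "?z \<in> sector \<phi>" using t \<phi>(1) by (rule of_real_in_sector)
    \<comment> \<open>Restricting the complex difference quotient to the real axis gives the real
      derivative of the orbit.\<close>
    have "filterlim complex_of_real (at ?z within sector \<phi>) (at t)"
      unfolding filterlim_at
    proof
      have "\<forall>\<^sub>F y in at t. y \<in> {0<..} - {t}"
        using t by (intro eventually_at_in_open) auto
      then show "\<forall>\<^sub>F y in at t. complex_of_real y \<in> sector \<phi> \<and> complex_of_real y \<noteq> ?z"
        by eventually_elim (auto simp: of_real_in_sector \<phi>)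
    qed (intro tendsto_intros)
    from filterlim_compose[OF quot[OF z, of x] this]
    have "((\<lambda>y. inverse (complex_of_real y - ?z) *\<^sub>C (S (complex_of_real y) x - S ?z x)) \<longlongrightarrow> L t x) (at t)"
      by (simp add: L_def)
    moreover have "\<forall>\<^sub>F y in at t. inverse (complex_of_real y - ?z) *\<^sub>C (S (complex_of_real y) x - S ?z x)
        = (T y x - T t x) /\<^sub>R (y - t)"
    proof -
      have "\<forall>\<^sub>F y in at t. y \<in> {0<..}"
        using t by (intro eventually_at_in_open') auto
      then show ?thesis
      proof eventually_elim
        case (elim y)
        then show ?case
          using t by (simp add: S_T scaleR_scaleC)
      qed
    qed
    ultimately show "((\<lambda>t. T t x) has_vector_derivative L t x) (at t)"
      unfolding has_vector_derivative_iff_quotient by (rule Lim_transform_eventually)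
  qed
  \<comment> \<open>Strong continuity at 0 is granted only on strictly smaller sectors; half the
    angle is one of them.\<close>
  define \<psi> where "\<psi> = \<phi> / 2"
  have \<psi>: "0 < \<psi>" "\<psi> < \<phi>" using \<phi>(1) by (auto simp: \<psi>_def)
  have sub: "sector \<psi> \<subseteq> sector \<phi>" using \<psi>(2) by (auto simp: sector_def)
  obtain \<delta> K where \<delta>: "\<delta> > 0" and K: "K \<ge> 0"
    and SK: "\<And>z x. z \<in> sector \<psi> \<Longrightarrow> norm z < \<delta> \<Longrightarrow> norm (S z x) \<le> K * norm x"
  proof (rule bounded_near_zero_of_strongly_continuous[of "sector \<psi>" S])
    show "bounded_linear (S z)" if "z \<in> sector \<psi>" for z using that sub S_blr by blast
    show "0 \<notin> sector \<psi>" by (simp add: sector_def)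
    show "((\<lambda>z. S z x) \<longlongrightarrow> x) (at 0 within sector \<psi>)" for x using \<psi> by (rule S_lim)
  qed (rule that)
  obtain \<kappa> where \<kappa>: "0 < \<kappa>" "\<kappa> < 1"
    and cb: "\<And>t. t > 0 \<Longrightarrow> cball (complex_of_real t) (\<kappa> * t) \<subseteq> sector \<psi>"
    by (rule cball_subset_sector[OF \<psi>(1)]) (rule that)
  \<comment> \<open>The 2 is the bound of the complex functional, \<open>K\<close> bounds S on the
    circle, and \<kappa> is the relative radius of the circle.\<close>
  define C\<^sub>0 where "C\<^sub>0 = 2 * K / \<kappa>"
  have C\<^sub>0: "C\<^sub>0 \<ge> 0" using K \<kappa> by (simp add: C\<^sub>0_def)
  have small: "norm (L t x) \<le> C\<^sub>0 / t * norm x" if t: "0 < t" "t < \<delta> / 2" for t x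
  proof -
    let ?z = "complex_of_real t"
    obtain \<theta> :: "'a \<Rightarrow> complex" where \<theta>: "bounded_linear \<theta>" "\<And>c x. \<theta> (c *\<^sub>C x) = c * \<theta> x"
        "\<And>x. norm (\<theta> x) \<le> 2 * norm x" "norm (L t x) \<le> norm (\<theta> (L t x))"
      by (rule complex_functional[of "L t x"]) (rule that)
    define f where "f z = \<theta> (S z x)" for z
    have deriv: "(f has_field_derivative \<theta> (D z x)) (at z within sector \<phi>)" if "z \<in> sector \<phi>" for z
    proof -
      have "((\<lambda>w. \<theta> (inverse (w - z) *\<^sub>C (S w x - S z x))) \<longlongrightarrow> \<theta> (D z x)) (at z within sector \<phi>)"
        using \<theta>(1) quot[OF that] by (rule bounded_linear.tendsto)
      moreover have "\<theta> (inverse (w - z) *\<^sub>C (S w x - S z x)) = (f w - f z) / (w - z)" for w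
        by (simp add: \<theta>(2) f_def linear_diff[OF bounded_linear.linear[OF \<theta>(1)]] divide_inverse mult.commute)
      ultimately show ?thesis
        by (simp add: has_field_derivative_iff)
    qed
    have sub': "cball ?z (\<kappa> * t) \<subseteq> sector \<phi>" using cb[OF t(1)] sub by blast
    have hol: "f holomorphic_on cball ?z (\<kappa> * t)"
      using deriv sub' by (auto simp: holomorphic_on_def field_differentiable_def
          intro: DERIV_subset)
    have "norm ((deriv ^^ 1) f ?z) \<le> fact 1 * (2 * (K * norm x)) / (\<kappa> * t) ^ 1"
    proof (rule Cauchy_inequality)
      show "f holomorphic_on ball ?z (\<kappa> * t)"
        using hol by (rule holomorphic_on_subset) auto
      show "continuous_on (cball ?z (\<kappa> * t)) f"
        using hol by (rule holomorphic_on_imp_continuous_on)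
      show "0 < \<kappa> * t" using \<kappa> t by simp
      \<comment> \<open>On the circle |z| <= t + \<kappa> t <= 2t, which is why t < \<delta>/2 is
        the range of the local bound.\<close>
      fix z assume z: "norm (?z - z) = \<kappa> * t"
      then have "z \<in> sector \<psi>" using cb[OF t(1)] by (auto simp: dist_norm)
      moreover have "norm z < \<delta>"
      proof -
        have "norm z \<le> norm ?z + norm (?z - z)"
          by (metis norm_minus_commute norm_triangle_sub)
        also have "\<dots> = t + \<kappa> * t" using t z by simp
        also have "\<dots> \<le> 2 * t" using \<kappa> t by simp
        finally show ?thesis using t by simp
      qed
      ultimately have "norm (S z x) \<le> K * norm x" by (rule SK)
      then show "norm (f z) \<le> 2 * (K * norm x)"
        unfolding f_def using \<theta>(3)[of "S z x"] by linarith
    qed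
    moreover have "deriv f ?z = \<theta> (L t x)"
    proof (rule DERIV_imp_deriv)
      have "(f has_field_derivative \<theta> (D ?z x)) (at ?z within ball ?z (\<kappa> * t))"
        using sub' t by (intro DERIV_subset[OF deriv] of_real_in_sector \<phi>(1)) auto
      then show "(f has_field_derivative \<theta> (L t x)) (at ?z)"
        using \<kappa> t by (simp add: L_def at_within_open[of _ "ball ?z (\<kappa> * t)"])
    qed
    ultimately have "norm (\<theta> (L t x)) \<le> 2 * (K * norm x) / (\<kappa> * t)" by simp
    with \<theta>(4) show ?thesis by (simp add: C\<^sub>0_def)
  qed
  \<comment> \<open>A fixed time inside the range already treated; it performs the smoothing for all
    later times.\<close>
  define t\<^sub>0 where "t\<^sub>0 = \<delta> / 4"
  have t\<^sub>0: "0 < t\<^sub>0" "t\<^sub>0 < \<delta> / 2" using \<delta> by (auto simp: t\<^sub>0_def)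
  define C\<^sub>1 where "C\<^sub>1 = C\<^sub>0 / t\<^sub>0 * M * (exp (\<omega> * t\<^sub>0) / \<omega>)"
  have large: "norm (L t x) \<le> C\<^sub>1 / t * norm x" if t: "t \<ge> \<delta> / 2" for t x
  proof -
    have tp: "t > 0" "t \<ge> t\<^sub>0" using t t\<^sub>0 \<delta> by auto
    \<comment> \<open>Equivalently exp(-\<omega> t) <= 1/(\<omega> t): decay is traded for the
      factor 1/t.\<close>
    have "\<omega> * t \<le> exp (\<omega> * t)" using exp_ge_add_one_self[of "\<omega> * t"] by linarith
    then have e: "exp (- \<omega> * (t - t\<^sub>0)) \<le> exp (\<omega> * t\<^sub>0) / \<omega> / t"
      using \<omega>_pos tp by (simp add: field_simps exp_diff exp_minus)
    have "L t x = L t\<^sub>0 (T (t - t\<^sub>0) x)" using L_add(1)[of t\<^sub>0 "t - t\<^sub>0" x] t\<^sub>0 tp by simp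
    then have "norm (L t x) \<le> C\<^sub>0 / t\<^sub>0 * norm (T (t - t\<^sub>0) x)" using small[OF t\<^sub>0] by simp
    also have "\<dots> \<le> C\<^sub>0 / t\<^sub>0 * (M * exp (- \<omega> * (t - t\<^sub>0)) * norm x)"
      using C\<^sub>0 t\<^sub>0 tp by (intro mult_left_mono norm_T) auto
    also have "\<dots> \<le> C\<^sub>0 / t\<^sub>0 * (M * (exp (\<omega> * t\<^sub>0) / \<omega> / t) * norm x)"
      using C\<^sub>0 t\<^sub>0 M_ge_1 e by (intro mult_left_mono mult_right_mono) auto
    finally show ?thesis by (simp add: C\<^sub>1_def)
  qed
  have "stable_analytic_semigroup T M \<omega> L (max C\<^sub>0 C\<^sub>1)"
  proof
    show "norm (L t x) \<le> max C\<^sub>0 C\<^sub>1 / t * norm x" if t: "t > 0" for t x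
    proof (cases "t < \<delta> / 2")
      case True
      have "C\<^sub>0 / t * norm x \<le> max C\<^sub>0 C\<^sub>1 / t * norm x"
        using t by (intro mult_right_mono divide_right_mono) auto
      with small[OF t True, of x] show ?thesis by linarith
    next
      case False
      have "C\<^sub>1 / t * norm x \<le> max C\<^sub>0 C\<^sub>1 / t * norm x"
        using t by (intro mult_right_mono divide_right_mono) auto
      with large[of t x] False show ?thesis by linarith
    qed
    show "max C\<^sub>0 C\<^sub>1 \<ge> 0" using C\<^sub>0 by simp
  qed
  then show thesis by (rule that)
qed

section \<open>The extrapolation space\<close>

lemma clinear_diff:
  assumes "clinear f"
  shows "f (x - y) = f x - f y"
proof -
  have "f ((x - y) + y) = f (x - y) + f y"
    using assms unfolding clinear_def by blast
  then show ?thesis by simp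
qed

text \<open>Extension by continuity from a dense range. It is used in both directions between
  \<iota> and the resolvent, which have equal norms, to produce the mutually inverse maps
  \<open>J\<close> and \<open>K\<close>.\<close>

lemma isometric_extension:
  fixes f :: "'c::cbanach \<Rightarrow> 'a::cbanach" and g :: "'c \<Rightarrow> 'b::cbanach"
  assumes f: "clinear f" and g: "clinear g" and eq: "\<And>x. norm (g x) = norm (f x)"
    and dense: "closure (range f) = UNIV"
  obtains J where "bounded_clinear J" "\<And>x. J (f x) = g x" "\<And>z. norm (J z) = norm z"
proof -
  have "\<exists>x. (\<lambda>n. f (x n)) \<longlonglongrightarrow> z" for z
  proof -
    obtain y where y: "\<And>n. y n \<in> range f" "y \<longlonglongrightarrow> z"
      using dense closure_sequential[of z "range f"] by auto
    then have "\<forall>n. \<exists>x. y n = f x" by auto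
    then obtain x where "\<forall>n. y n = f (x n)" by (rule choice[THEN exE])
    then have "y = (\<lambda>n. f (x n))" by auto
    with y(2) show ?thesis by auto
  qed
  then obtain X where X: "\<And>z. (\<lambda>n. f (X z n)) \<longlonglongrightarrow> z" by metis
  have "convergent (\<lambda>n. g (X z n))" for z
  proof -
    have "Cauchy (\<lambda>n. f (X z n))" using X by (rule LIMSEQ_imp_Cauchy)
    moreover have "dist (g (X z m)) (g (X z n)) = dist (f (X z m)) (f (X z n))" for m n
      by (simp add: dist_norm eq flip: clinear_diff[OF f] clinear_diff[OF g])
    ultimately have "Cauchy (\<lambda>n. g (X z n))" by (simp add: Cauchy_def)
    then show ?thesis by (rule Cauchy_convergent)
  qed
  then obtain J where J: "\<And>z. (\<lambda>n. g (X z n)) \<longlonglongrightarrow> J z"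
    unfolding convergent_def by metis
  have lim: "(\<lambda>n. g (x n)) \<longlonglongrightarrow> J z" if "(\<lambda>n. f (x n)) \<longlonglongrightarrow> z" for x z
  proof -
    have "(\<lambda>n. norm (f (x n) - f (X z n))) \<longlonglongrightarrow> norm (z - z)"
      by (intro tendsto_norm tendsto_diff that X)
    then have "(\<lambda>n. norm (g (x n) - g (X z n))) \<longlonglongrightarrow> 0"
      by (simp add: eq flip: clinear_diff[OF f] clinear_diff[OF g])
    then have "(\<lambda>n. g (x n) - g (X z n)) \<longlonglongrightarrow> 0" by (rule tendsto_norm_zero_cancel)
    from tendsto_add[OF this J[of z]] show ?thesis by simp
  qed
  have add: "J (z + w) = J z + J w" for z w
  proof (rule LIMSEQ_unique)
    have "(\<lambda>n. f (X z n + X w n)) \<longlonglongrightarrow> z + w"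
      using tendsto_add[OF X[of z] X[of w]] f by (simp add: clinear_def)
    then show "(\<lambda>n. g (X z n + X w n)) \<longlonglongrightarrow> J (z + w)" by (rule lim)
    show "(\<lambda>n. g (X z n + X w n)) \<longlonglongrightarrow> J z + J w"
      using tendsto_add[OF J[of z] J[of w]] g by (simp add: clinear_def)
  qed
  have scale: "J (c *\<^sub>C z) = c *\<^sub>C J z" for c z
  proof (rule LIMSEQ_unique)
    have "(\<lambda>n. f (c *\<^sub>C X z n)) \<longlonglongrightarrow> c *\<^sub>C z"
      using bounded_linear.tendsto[OF bounded_linear_scaleC X[of z]] f by (simp add: clinear_def)
    then show "(\<lambda>n. g (c *\<^sub>C X z n)) \<longlonglongrightarrow> J (c *\<^sub>C z)" by (rule lim)
    show "(\<lambda>n. g (c *\<^sub>C X z n)) \<longlonglongrightarrow> c *\<^sub>C J z"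
      using bounded_linear.tendsto[OF bounded_linear_scaleC J[of z]] g by (simp add: clinear_def)
  qed
  have norm: "norm (J z) = norm z" for z
  proof (rule LIMSEQ_unique)
    show "(\<lambda>n. norm (g (X z n))) \<longlonglongrightarrow> norm (J z)" using J by (rule tendsto_norm)
    show "(\<lambda>n. norm (g (X z n))) \<longlonglongrightarrow> norm z" unfolding eq using X by (rule tendsto_norm)
  qed
  have "J (f x) = g x" for x
    using lim[of "\<lambda>n. x" "f x"] by (auto intro: LIMSEQ_unique)
  moreover have "bounded_clinear J"
    unfolding bounded_clinear_def clinear_def using add scale norm by (auto intro: exI[of _ 1])
  ultimately show thesis using norm that by blast
qed

lemma bounded_linear_eq_on_dense:
  assumes "bounded_linear f" "bounded_linear g" and dense: "closure S = UNIV"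
    and eq: "\<And>x. x \<in> S \<Longrightarrow> f x = g x"
  shows "f = g"
proof
  fix x
  have "closed {x. f x = g x}"
    using assms(1,2) by (intro closed_Collect_eq linear_continuous_on)
  then have "closure S \<subseteq> {x. f x = g x}"
    using eq by (intro closure_minimal) auto
  with dense show "f x = g x" by auto
qed

text \<open>\<open>J\<close> identifies \<open>X\<^sub>-\<^sub>1\<close> isometrically with \<open>X\<close>, with inverse \<open>K\<close>, so that \<open>\<iota>\<close> becomes the
  resolvent \<open>R\<close>; \<open>Q t\<close> is \<open>(s - A) T(t)\<close>, i.e. the smoothing map \<open>T(t) : X\<^sub>-\<^sub>1 \<rightarrow> X\<close>.\<close>

locale extrapolated_semigroup = stable_analytic_semigroup T M \<omega> L C
  for T :: "real \<Rightarrow> 'a::cbanach \<Rightarrow> 'a" and M \<omega> L C +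
  fixes R :: "'a \<Rightarrow> 'a" and Q :: "real \<Rightarrow> 'a \<Rightarrow> 'a"
    and \<iota> :: "'a \<Rightarrow> 'b::cbanach" and J :: "'b \<Rightarrow> 'a" and K :: "'a \<Rightarrow> 'b"
  assumes R_bounded_linear: "bounded_linear R" and R_inj: "\<And>x y. R x = R y \<Longrightarrow> x = y"
    and R_T: "\<And>t x. t \<ge> 0 \<Longrightarrow> R (T t x) = T t (R x)"
    and Q_bounded_linear: "\<And>t. t > 0 \<Longrightarrow> bounded_linear (Q t)"
    and R_Q: "\<And>t x. t > 0 \<Longrightarrow> R (Q t x) = T t x"
    and J_bounded_linear: "bounded_linear J" and K_bounded_linear: "bounded_linear K"
    and JK: "\<And>x. J (K x) = x" and KJ: "\<And>z. K (J z) = z"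
    and J_\<iota>: "\<And>x. J (\<iota> x) = R x"
    and ext: "\<And>t z. t \<ge> 0 \<Longrightarrow> extended_semigroup \<iota> T t z = K (T t (J z))"
begin

lemma \<iota>_eq: "\<iota> x = K (R x)"
  by (metis KJ J_\<iota>)

lemma \<iota>_bounded_linear: "bounded_linear \<iota>"
  unfolding \<iota>_eq[abs_def] by (rule bounded_linear_compose[OF K_bounded_linear R_bounded_linear])

text \<open>Both identities follow by cancelling the injective \<open>R\<close>, which sends
  \<open>Q\<close> to \<open>T\<close>.\<close>

lemma Q_add:
  assumes "t > 0" "r \<ge> 0"
  shows "Q t (T r x) = Q (t + r) x" "T r (Q t x) = Q (t + r) x"
proof -
  have "R (Q t (T r x)) = R (Q (t + r) x)"
    using assms by (simp add: R_Q T_add)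
  then show "Q t (T r x) = Q (t + r) x" by (rule R_inj)
  have "R (T r (Q t x)) = T r (T t x)"
    using assms by (simp add: R_Q R_T)
  also have "\<dots> = R (Q (t + r) x)"
    using assms by (simp add: R_Q add.commute[of t r] T_add)
  finally show "T r (Q t x) = Q (t + r) x" by (rule R_inj)
qed

text \<open>Half of the time is spent on smoothing: \<open>Q (q i)\<close> is the fixed bounded
  operator \<open>Q (t / 2)\<close> after \<open>T (q i - t / 2)\<close>, so joint continuity of
  \<open>T\<close> carries over.\<close>

lemma Q_tendsto:
  assumes t: "t > 0" and q: "q \<longlonglongrightarrow> t" and v: "v \<longlonglongrightarrow> x"
  shows "(\<lambda>i. Q (q i) (v i)) \<longlonglongrightarrow> Q t x"
proof -
  have "(\<lambda>i. T (q i - t / 2) (v i)) \<longlonglongrightarrow> T (t - t / 2) x"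
    using t by (intro T_tendsto tendsto_diff q v tendsto_const) simp
  then have "(\<lambda>i. Q (t / 2) (T (q i - t / 2) (v i))) \<longlonglongrightarrow> Q (t / 2) (T (t - t / 2) x)"
    using t by (intro bounded_linear.tendsto[OF Q_bounded_linear]) auto
  moreover have "\<forall>\<^sub>F i in sequentially. Q (t / 2) (T (q i - t / 2) (v i)) = Q (q i) (v i)"
  proof -
    have "\<forall>\<^sub>F i in sequentially. q i > t / 2"
      using q t by (intro order_tendstoD) auto
    then show ?thesis by eventually_elim (use t in \<open>simp add: Q_add\<close>)
  qed
  ultimately have "(\<lambda>i. Q (q i) (v i)) \<longlonglongrightarrow> Q (t / 2) (T (t - t / 2) x)"
    by (rule Lim_transform_eventually)
  moreover have "Q (t / 2) (T (t - t / 2) x) = Q t x"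
    using t by (simp add: Q_add)
  ultimately show ?thesis by simp
qed

lemma R_P: "\<alpha> > 0 \<Longrightarrow> R (P \<alpha> x) = P \<alpha> (R x)"
  by (rule P_commute) (auto simp: R_bounded_linear R_T)

lemma T_P: "\<alpha> > 0 \<Longrightarrow> t \<ge> 0 \<Longrightarrow> T t (P \<alpha> x) = P \<alpha> (T t x)"
  by (rule P_commute) (auto simp: T_bounded_linear T_commute)

text \<open>\<open>y = (-A)\<^sup>-\<^sup>\<alpha> z\<close>, up to the factor \<open>\<Gamma>(\<alpha>)\<close>, is expressed by \<open>R y = P \<alpha> (J z)\<close>.\<close>

lemma P_Q:
  assumes \<alpha>: "\<alpha> > 0" and t: "t > 0" and y: "R y = P \<alpha> w"
  shows "P \<alpha> (Q t w) = T t y"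
proof (rule R_inj)
  have "R (P \<alpha> (Q t w)) = T t (P \<alpha> w)"
    using \<alpha> t by (simp add: R_P R_Q T_P)
  also have "\<dots> = R (T t y)" using t y by (simp add: R_T)
  finally show "R (P \<alpha> (Q t w)) = R (T t y)" .
qed

section \<open>The spaces of negative order described inside X\<close>

lemma frac_norm_eq: "\<alpha> > 0 \<Longrightarrow> frac_norm T \<alpha> x = norm (P \<alpha> x) / Gamma \<alpha>"
  by (simp add: frac_norm_def neg_frac_power_eq Gamma_real_pos less_imp_le)

lemma represents_frac_iff:
  assumes \<alpha>: "\<alpha> > 0"
  shows "represents_frac \<iota> T \<alpha> x z \<longleftrightarrow> Cauchy (\<lambda>n. P \<alpha> (x n)) \<and> (\<lambda>n. R (x n)) \<longlonglongrightarrow> J z"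
proof -
  have \<Gamma>: "Gamma \<alpha> > 0" using \<alpha> by (rule Gamma_real_pos)
  have "frac_norm T \<alpha> (x m - x n) < e \<longleftrightarrow> dist (P \<alpha> (x m)) (P \<alpha> (x n)) < e * Gamma \<alpha>" for m n e
    using \<alpha> \<Gamma> by (simp add: frac_norm_eq dist_norm divide_less_eq
        linear_diff[OF bounded_linear.linear[OF P_bounded_linear[OF \<alpha>]]])
  moreover have "(\<forall>e>0. \<exists>N. \<forall>m\<ge>N. \<forall>n\<ge>N. dist (P \<alpha> (x m)) (P \<alpha> (x n)) < e * Gamma \<alpha>)
      \<longleftrightarrow> Cauchy (\<lambda>n. P \<alpha> (x n))" (is "?l \<longleftrightarrow> _")
  proof
    assume l: ?l
    show "Cauchy (\<lambda>n. P \<alpha> (x n))"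
    proof (rule metric_CauchyI)
      fix e :: real assume "e > 0"
      then have "e / Gamma \<alpha> > 0" using \<Gamma> by simp
      from l[rule_format, OF this] \<Gamma>
      show "\<exists>N. \<forall>m\<ge>N. \<forall>n\<ge>N. dist (P \<alpha> (x m)) (P \<alpha> (x n)) < e" by simp
    qed
  next
    assume "Cauchy (\<lambda>n. P \<alpha> (x n))"
    then show ?l using \<Gamma> by (simp add: Cauchy_def)
  qed
  moreover have "(\<lambda>n. \<iota> (x n)) \<longlonglongrightarrow> z \<longleftrightarrow> (\<lambda>n. R (x n)) \<longlonglongrightarrow> J z"
    using bounded_linear.tendsto[OF J_bounded_linear, of "\<lambda>n. \<iota> (x n)" z]
      bounded_linear.tendsto[OF K_bounded_linear, of "\<lambda>n. R (x n)" "J z"]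
    by (auto simp: KJ JK \<iota>_eq)
  ultimately show ?thesis by (simp add: represents_frac_def)
qed

lemma represents_frac_limit:
  assumes \<alpha>: "\<alpha> > 0" and rep: "represents_frac \<iota> T \<alpha> x z"
  obtains y where "(\<lambda>n. P \<alpha> (x n)) \<longlonglongrightarrow> y" "R y = P \<alpha> (J z)"
proof -
  have x: "Cauchy (\<lambda>n. P \<alpha> (x n))" "(\<lambda>n. R (x n)) \<longlonglongrightarrow> J z"
    using rep by (simp_all add: represents_frac_iff[OF \<alpha>])
  then obtain y where y: "(\<lambda>n. P \<alpha> (x n)) \<longlonglongrightarrow> y"
    by (auto simp: Cauchy_convergent_iff convergent_def)
  have "R y = P \<alpha> (J z)"
  proof (rule LIMSEQ_unique)
    show "(\<lambda>n. R (P \<alpha> (x n))) \<longlonglongrightarrow> R y"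
      using R_bounded_linear y by (rule bounded_linear.tendsto)
    show "(\<lambda>n. R (P \<alpha> (x n))) \<longlonglongrightarrow> P \<alpha> (J z)"
      unfolding R_P[OF \<alpha>] using P_bounded_linear[OF \<alpha>] x(2) by (rule bounded_linear.tendsto)
  qed
  with y show thesis by (rule that)
qed

text \<open>The canonical representing sequence is T(1/(n+1)) z, an element of X by smoothing. By
  \<open>P_Q\<close> its image under \<open>P \<alpha>\<close> is T(1/(n+1)) y, which converges to
  y.\<close>

lemma represents_frac_Q:
  assumes \<alpha>: "\<alpha> > 0" and y: "R y = P \<alpha> (J z)"
  shows "represents_frac \<iota> T \<alpha> (\<lambda>n. Q (inverse (real (Suc n))) (J z)) z"
proof -
  have "(\<lambda>n. P \<alpha> (Q (inverse (real (Suc n))) (J z))) \<longlonglongrightarrow> y"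
    using T_inverse_Suc[of y] by (simp add: P_Q[OF \<alpha> _ y])
  then have "Cauchy (\<lambda>n. P \<alpha> (Q (inverse (real (Suc n))) (J z)))"
    by (rule LIMSEQ_imp_Cauchy)
  moreover have "(\<lambda>n. R (Q (inverse (real (Suc n))) (J z))) \<longlonglongrightarrow> J z"
    using T_inverse_Suc[of "J z"] by (simp add: R_Q)
  ultimately show ?thesis by (simp add: represents_frac_iff[OF \<alpha>])
qed

lemma X_neg_iff:
  assumes "\<alpha> > 0"
  shows "z \<in> X_neg \<iota> T \<alpha> \<longleftrightarrow> (\<exists>y. R y = P \<alpha> (J z))"
  unfolding X_neg_def
  by (auto elim: represents_frac_limit[OF assms] intro: represents_frac_Q[OF assms])

text \<open>All representing sequences have the same limit under \<open>P \<alpha>\<close>, because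
  \<open>R\<close> is injective; so the definite description for the norm is well defined.\<close>

lemma norm_X_neg_eq:
  assumes \<alpha>: "\<alpha> > 0" and y: "R y = P \<alpha> (J z)"
  shows "norm_X_neg \<iota> T \<alpha> z = norm y / Gamma \<alpha>"
proof -
  have lim: "(\<lambda>n. frac_norm T \<alpha> (x n)) \<longlonglongrightarrow> norm y / Gamma \<alpha>" if rep: "represents_frac \<iota> T \<alpha> x z" for x
  proof -
    obtain y' where y': "(\<lambda>n. P \<alpha> (x n)) \<longlonglongrightarrow> y'" "R y' = P \<alpha> (J z)"
      by (rule represents_frac_limit[OF \<alpha> rep]) (rule that)
    then have "y' = y" using y R_inj by simp
    moreover have "Gamma \<alpha> \<noteq> 0" using Gamma_real_pos[OF \<alpha>] by simp
    ultimately show ?thesis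
      unfolding frac_norm_eq[OF \<alpha>] using y'(1) by (intro tendsto_intros) auto
  qed
  show ?thesis
    unfolding norm_X_neg_def
  proof (rule the_equality)
    show "\<exists>x. represents_frac \<iota> T \<alpha> x z \<and> (\<lambda>n. frac_norm T \<alpha> (x n)) \<longlonglongrightarrow> norm y / Gamma \<alpha>"
      using represents_frac_Q[OF \<alpha> y] lim by blast
    show "r = norm y / Gamma \<alpha>"
      if "\<exists>x. represents_frac \<iota> T \<alpha> x z \<and> (\<lambda>n. frac_norm T \<alpha> (x n)) \<longlonglongrightarrow> r" for r
      using that lim LIMSEQ_unique by blast
  qed
qed

lemma bounded_into_X_neg_iff:
  assumes \<alpha>: "\<alpha> > 0"
  shows "bounded_into_X_neg \<iota> T \<alpha> B \<longleftrightarrow>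
    clinear B \<and> (\<exists>c\<ge>0. \<forall>v. \<exists>y. R y = P \<alpha> (J (B v)) \<and> norm y \<le> c * norm v)" (is "_ \<longleftrightarrow> ?r")
proof
  have \<Gamma>: "Gamma \<alpha> > 0" using \<alpha> by (rule Gamma_real_pos)
  {
    assume "bounded_into_X_neg \<iota> T \<alpha> B"
    then obtain c where c: "clinear B" "\<And>v. B v \<in> X_neg \<iota> T \<alpha>" "\<And>v. norm_X_neg \<iota> T \<alpha> (B v) \<le> c * norm v"
      unfolding bounded_into_X_neg_def by blast
    \<comment> \<open>The bound in the definition carries no sign condition, hence the absolute
      value.\<close>
    have "\<exists>y. R y = P \<alpha> (J (B v)) \<and> norm y \<le> (\<bar>c\<bar> * Gamma \<alpha>) * norm v" for v
    proof -
      obtain y where y: "R y = P \<alpha> (J (B v))" using c(2)[of v] X_neg_iff[OF \<alpha>] by blast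
      have "norm y / Gamma \<alpha> \<le> c * norm v" using c(3)[of v] by (simp add: norm_X_neg_eq[OF \<alpha> y])
      also have "\<dots> \<le> \<bar>c\<bar> * norm v" by (intro mult_right_mono) auto
      finally show ?thesis using y \<Gamma> by (auto simp: field_simps)
    qed
    then show ?r using c(1) \<Gamma> by (intro conjI exI[of _ "\<bar>c\<bar> * Gamma \<alpha>"]) auto
  }
  assume ?r
  then obtain c where c: "clinear B" "\<And>v. \<exists>y. R y = P \<alpha> (J (B v)) \<and> norm y \<le> c * norm v"
    by blast
  have "norm_X_neg \<iota> T \<alpha> (B v) \<le> c / Gamma \<alpha> * norm v" for v
    using c(2)[of v] norm_X_neg_eq[OF \<alpha>] \<Gamma> by (auto simp: divide_right_mono)
  moreover have "range B \<subseteq> X_neg \<iota> T \<alpha>"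
    using c(2) X_neg_iff[OF \<alpha>] by blast
  ultimately show "bounded_into_X_neg \<iota> T \<alpha> B"
    unfolding bounded_into_X_neg_def using c(1) by blast
qed

text \<open>The estimate for T on X is applied to \<open>Q h w\<close>, whose image under
  \<open>P \<alpha>\<close> is \<open>T h y\<close>. Since \<open>T h (Q t w) = T t (Q h w)\<close>,
  letting h tend to 0 carries it to all of \<open>X_{-\<alpha>}\<close>.\<close>

lemma norm_Q_le:
  assumes \<alpha>: "0 < \<alpha>" "\<alpha> < 1"
  obtains c where "c \<ge> 0" "\<And>t w y. t > 0 \<Longrightarrow> R y = P \<alpha> w \<Longrightarrow> norm (Q t w) \<le> c * t powr (- \<alpha>) * norm y"
proof -
  obtain c where c: "c \<ge> 0" "\<And>t x. t > 0 \<Longrightarrow> norm (T t x) \<le> c * t powr (- \<alpha>) * norm (P \<alpha> x)"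
    by (rule norm_T_le_norm_P[OF \<alpha>]) (rule that)
  have "norm (Q t w) \<le> c * t powr (- \<alpha>) * norm y" if t: "t > 0" and y: "R y = P \<alpha> w" for t w y
  proof (rule LIMSEQ_le)
    let ?h = "\<lambda>n. inverse (real (Suc n))"
    show "(\<lambda>n. norm (T (?h n) (Q t w))) \<longlonglongrightarrow> norm (Q t w)"
      by (intro tendsto_norm T_inverse_Suc)
    show "(\<lambda>n. c * t powr (- \<alpha>) * norm (T (?h n) y)) \<longlonglongrightarrow> c * t powr (- \<alpha>) * norm y"
      by (intro tendsto_mult tendsto_const tendsto_norm T_inverse_Suc)
    show "\<exists>N. \<forall>n\<ge>N. norm (T (?h n) (Q t w)) \<le> c * t powr (- \<alpha>) * norm (T (?h n) y)"
    proof (intro exI allI impI)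
      fix n
      have h: "?h n > 0" by simp
      have "T (?h n) (Q t w) = T t (Q (?h n) w)"
        using t h by (simp add: Q_add add.commute del: of_nat_Suc)
      then show "norm (T (?h n) (Q t w)) \<le> c * t powr (- \<alpha>) * norm (T (?h n) y)"
        using c(2)[OF t, of "Q (?h n) w"] P_Q[OF \<alpha>(1) h y] by simp
    qed
  qed
  with c(1) show thesis by (rule that)
qed

end

section \<open>Singular kernels acting on Lebesgue-Bochner spaces\<close>

text \<open>Hoelder's inequality from Young's inequality after normalising \<open>f\<close>.
  Normalising only \<open>f\<close> gives c/q + 1/p in place of the sharp c^(1/q); a bound linear in
  the norm of \<open>f\<close> is all that is needed.\<close>

lemma nn_integral_mult_le_powr_norm:
  fixes k f :: "'s \<Rightarrow> real"
  assumes p: "p > 1" and q: "q = p / (p - 1)"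
    and [measurable]: "k \<in> borel_measurable M" "f \<in> borel_measurable M"
    and pos: "\<And>x. k x \<ge> 0" "\<And>x. f x \<ge> 0"
    and c: "(\<integral>\<^sup>+x. ennreal (k x powr q) \<partial>M) \<le> ennreal c" "c \<ge> 0"
    and fin: "(\<integral>\<^sup>+x. ennreal (f x powr p) \<partial>M) < \<infinity>"
  shows "(\<integral>\<^sup>+x. ennreal (k x * f x) \<partial>M)
    \<le> ennreal ((c / q + 1 / p) * enn2real (\<integral>\<^sup>+x. ennreal (f x powr p) \<partial>M) powr (1 / p))"
proof -
  define I where "I = enn2real (\<integral>\<^sup>+x. ennreal (f x powr p) \<partial>M)"
  have I: "(\<integral>\<^sup>+x. ennreal (f x powr p) \<partial>M) = ennreal I" "I \<ge> 0"
    using fin by (simp_all add: I_def)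
  have q1: "q > 1" and pq: "1 / p + 1 / q = 1"
    using p by (simp_all add: q field_simps)
  show ?thesis
  proof (cases "I = 0")
    case True
    then have "(\<integral>\<^sup>+x. ennreal (f x powr p) \<partial>M) = 0" using I by simp
    then have "AE x in M. ennreal (f x powr p) = 0"
      by (subst (asm) nn_integral_0_iff_AE) auto
    then have "AE x in M. ennreal (k x * f x) = 0"
      by eventually_elim (auto simp: ennreal_eq_0_iff powr_eq_0_iff)
    then have "(\<integral>\<^sup>+x. ennreal (k x * f x) \<partial>M) = 0"
      by (subst nn_integral_0_iff_AE) auto
    then show ?thesis by simp
  next
    case False
    \<comment> \<open>This is the L^p norm of \<open>f\<close>, so f/N has norm 1. The case I = 0
      had to be separated to allow this division.\<close>
    define N where "N = I powr (1 / p)"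
    have N: "N > 0" "N powr p = I"
      using False I p by (simp_all add: N_def powr_powr)
    have "(\<integral>\<^sup>+x. ennreal (k x * f x) \<partial>M)
        \<le> (\<integral>\<^sup>+x. ennreal (N / q) * ennreal (k x powr q) + ennreal (N / (p * I)) * ennreal (f x powr p) \<partial>M)"
    proof (rule nn_integral_mono)
      fix x
      have "f x / N * k x \<le> (f x / N) powr p / p + k x powr q / q"
        using p q1 pq pos N by (intro Youngs_inequality) auto
      also have "(f x / N) powr p = f x powr p / I"
        using pos N by (simp add: powr_divide)
      finally have "N * (f x / N * k x) \<le> N * (f x powr p / I / p + k x powr q / q)"
        using N by (intro mult_left_mono) auto
      then have "k x * f x \<le> N / q * k x powr q + N / (p * I) * f x powr p"
        using N by (simp add: field_simps)
      then have "ennreal (k x * f x) \<le> ennreal (N / q * k x powr q + N / (p * I) * f x powr p)"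
        by (rule ennreal_leI)
      also have "\<dots> = ennreal (N / q) * ennreal (k x powr q) + ennreal (N / (p * I)) * ennreal (f x powr p)"
        using N I p q1 by (simp add: ennreal_mult del: times_divide_eq_left)
      finally show "ennreal (k x * f x)
          \<le> ennreal (N / q) * ennreal (k x powr q) + ennreal (N / (p * I)) * ennreal (f x powr p)" .
    qed
    also have "\<dots> = ennreal (N / q) * (\<integral>\<^sup>+x. ennreal (k x powr q) \<partial>M)
        + ennreal (N / (p * I)) * (\<integral>\<^sup>+x. ennreal (f x powr p) \<partial>M)"
      by (simp add: nn_integral_add nn_integral_cmult)
    also have "\<dots> \<le> ennreal (N / q) * ennreal c + ennreal (N / (p * I)) * ennreal I"
      unfolding I(1) using c by (intro add_mono mult_left_mono) auto
    also have "\<dots> = ennreal (N / q * c + N / (p * I) * I)"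
    proof -
      have nn: "N / q \<ge> 0" "N / (p * I) \<ge> 0" using N I p q1 by auto
      show ?thesis
        by (simp only: ennreal_plus[OF mult_nonneg_nonneg[OF nn(1) c(2)] mult_nonneg_nonneg[OF nn(2) I(2)]]
            ennreal_mult[OF nn(1) c(2)] ennreal_mult[OF nn(2) I(2)])
    qed
    also have "N / q * c + N / (p * I) * I = (c / q + 1 / p) * N"
      using False p q1 by (simp add: field_simps)
    finally show ?thesis by (simp add: N_def I_def)
  qed
qed

lemma nn_integral_reflected_powr:
  assumes "a > -1" "t \<ge> 0"
  shows "(\<integral>\<^sup>+s. ennreal ((t - s) powr a) \<partial>lebesgue_on {0..t}) = ennreal (t powr (a + 1) / (a + 1))"
proof -
  have "(\<integral>\<^sup>+s. ennreal ((t - s) powr a) \<partial>lebesgue_on {0..t})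
      = (\<integral>\<^sup>+s. ennreal ((t - s) powr a) * indicator {0..t} s \<partial>lborel)"
    by (rule nn_integral_lebesgue_on) simp
  also have "\<dots> = (\<integral>\<^sup>+s. ennreal ((t - (t + (-1) * s)) powr a) * indicator {0..t} (t + (-1) * s) \<partial>lborel)"
    by (subst nn_integral_real_affine[where c = "-1" and t = t]) auto
  also have "\<dots> = (\<integral>\<^sup>+s. ennreal (s powr a) * indicator {0..t} s \<partial>lborel)"
    by (intro nn_integral_cong) (auto simp: indicator_def)
  finally show ?thesis using nn_integral_powr_from_0[OF assms] by simp
qed

text \<open>The exponent \<alpha> and the constant are fixed before \<open>u\<close>, as the
  quantifiers of admissibility demand.\<close>

lemma Lp_singular_kernel_bound:
  fixes p :: ennreal
  assumes \<beta>: "0 < \<beta>" "\<beta> < 1" and p: "p > ennreal (1 / (1 - \<beta>))" and t: "t \<ge> 0"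
  obtains \<alpha> c where "\<beta> < \<alpha>" "\<alpha> < 1" "c \<ge> 0"
    "\<And>u :: real \<Rightarrow> 'u::real_normed_vector. u \<in> Lp_space (lebesgue_on {0..t}) p \<Longrightarrow>
      (\<integral>\<^sup>+s. ennreal ((t - s) powr (- \<alpha>) * norm (u s)) \<partial>lebesgue_on {0..t})
        \<le> ennreal (c * Lp_norm (lebesgue_on {0..t}) p u)"
proof -
  interpret complete_measure "lebesgue_on {0..t}"
    by (rule complete_measure_lebesgue_on) simp
  have k_meas [measurable]: "(\<lambda>s. (t - s) powr a) \<in> borel_measurable (lebesgue_on {0..t})" for a
    by (simp add: measurable_restrict_space1 measurable_completion)
  have u_meas: "(\<lambda>s. norm (u s)) \<in> borel_measurable (lebesgue_on {0..t})"
    if "u \<in> Lp_space (lebesgue_on {0..t}) p" for u :: "real \<Rightarrow> 'u"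
    using that strongly_measurable_imp_borel_measurable[of u] by (auto simp: Lp_space_def)
  show thesis
  proof (cases "p = \<infinity>")
    case True
    \<comment> \<open>For bounded inputs only integrability of the kernel counts, so any exponent
      between \<beta> and 1 is admissible.\<close>
    define \<alpha> where "\<alpha> = (\<beta> + 1) / 2"
    have \<alpha>: "\<beta> < \<alpha>" "\<alpha> < 1" using \<beta> by (auto simp: \<alpha>_def)
    define c where "c = t powr (1 - \<alpha>) / (1 - \<alpha>)"
    have c: "c \<ge> 0" using \<alpha> by (simp add: c_def)
    show thesis
    proof (rule that[OF \<alpha> c])
      fix u :: "real \<Rightarrow> 'u" assume u: "u \<in> Lp_space (lebesgue_on {0..t}) p"
      define E where "E = Lp_norm (lebesgue_on {0..t}) p u"
      have E0: "E \<ge> 0" by (simp add: E_def Lp_norm_def True)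
      have E: "esssup (lebesgue_on {0..t}) (\<lambda>s. ennreal (norm (u s))) = ennreal E"
        using u True by (simp add: E_def Lp_norm_def Lp_space_def)
      have "AE s in lebesgue_on {0..t}. ennreal (norm (u s)) \<le> ennreal E"
        using esssup_AE[of "\<lambda>s. ennreal (norm (u s))" "lebesgue_on {0..t}"] by (simp add: E)
      then have "(\<integral>\<^sup>+s. ennreal ((t - s) powr (- \<alpha>) * norm (u s)) \<partial>lebesgue_on {0..t})
          \<le> (\<integral>\<^sup>+s. ennreal ((t - s) powr (- \<alpha>)) * ennreal E \<partial>lebesgue_on {0..t})"
        by (intro nn_integral_mono_AE, eventually_elim) (auto simp: ennreal_mult intro: mult_left_mono)
      also have "\<dots> = (\<integral>\<^sup>+s. ennreal ((t - s) powr (- \<alpha>)) \<partial>lebesgue_on {0..t}) * ennreal E"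
        by (rule nn_integral_multc) measurable
      also have "\<dots> = ennreal (c * E)"
        using nn_integral_reflected_powr[of "- \<alpha>" t] \<alpha> t c E0
        by (simp add: ennreal_mult add.commute flip: c_def)
      finally show "(\<integral>\<^sup>+s. ennreal ((t - s) powr (- \<alpha>) * norm (u s)) \<partial>lebesgue_on {0..t})
          \<le> ennreal (c * Lp_norm (lebesgue_on {0..t}) p u)"
        by (simp add: E_def)
    qed
  next
    case False
    define r where "r = enn2real p"
    have pr: "p = ennreal r" using False by (simp add: r_def less_top)
    have rb: "1 / (1 - \<beta>) < r"
      using p \<beta> unfolding pr by (subst (asm) ennreal_less_iff) auto
    moreover have "1 < 1 / (1 - \<beta>)" using \<beta> by simp
    ultimately have r1: "r > 1" by linarith
    have "1 < (1 - \<beta>) * r" using rb \<beta> by (simp add: field_simps)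
    with r1 have br: "\<beta> < 1 - 1 / r" by (simp add: field_simps)
    \<comment> \<open>Below 1 - 1/r = 1/q the kernel belongs to L^q for the conjugate exponent q;
      the hypothesis on p says exactly that \<beta> lies below this threshold.\<close>
    define \<alpha> where "\<alpha> = (\<beta> + (1 - 1 / r)) / 2"
    have \<alpha>: "\<beta> < \<alpha>" "\<alpha> < 1 - 1 / r" using br by (auto simp: \<alpha>_def)
    have \<alpha>1: "\<alpha> < 1"
      using \<alpha>(2) r1 by (smt (verit) divide_pos_pos)
    define q where "q = r / (r - 1)"
    have "\<alpha> * q < (1 - 1 / r) * q"
      using \<alpha> r1 by (intro mult_strict_right_mono) (auto simp: q_def)
    also have "\<dots> = 1" using r1 by (simp add: q_def field_simps)
    finally have aq: "\<alpha> * q < 1" .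
    define c where "c = t powr (1 - \<alpha> * q) / (1 - \<alpha> * q)"
    have c: "c \<ge> 0" using aq by (simp add: c_def)
    have q0: "q > 0" using r1 by (simp add: q_def)
    have kq: "(\<integral>\<^sup>+s. ennreal (((t - s) powr (- \<alpha>)) powr q) \<partial>lebesgue_on {0..t}) = ennreal c"
      using nn_integral_reflected_powr[of "- \<alpha> * q" t] aq t
      by (simp add: powr_powr c_def add.commute)
    show thesis
    proof (rule that[of \<alpha> "c / q + 1 / r"])
      show "c / q + 1 / r \<ge> 0" using c q0 r1 by simp
      fix u :: "real \<Rightarrow> 'u" assume u: "u \<in> Lp_space (lebesgue_on {0..t}) p"
      have "(\<integral>\<^sup>+s. ennreal ((t - s) powr (- \<alpha>) * norm (u s)) \<partial>lebesgue_on {0..t})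
        \<le> ennreal ((c / q + 1 / r) *
            enn2real (\<integral>\<^sup>+s. ennreal (norm (u s) powr r) \<partial>lebesgue_on {0..t}) powr (1 / r))"
        using r1 q_def k_meas u_meas[OF u] _ _ kq[THEN eq_refl] c
        by (rule nn_integral_mult_le_powr_norm) (use u False in \<open>auto simp: Lp_space_def r_def\<close>)
      then show "(\<integral>\<^sup>+s. ennreal ((t - s) powr (- \<alpha>) * norm (u s)) \<partial>lebesgue_on {0..t})
          \<le> ennreal ((c / q + 1 / r) * Lp_norm (lebesgue_on {0..t}) p u)"
        using False by (simp add: Lp_norm_def r_def)
    qed (use \<alpha> \<alpha>1 in auto)
  qed
qed

text \<open>The substitution t = 1 - s moves the convolution integral of admissibility onto the
  half-line, where the tail and \<open>P\<close> live; the lost point 0 is null.\<close>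

lemma has_bochner_integral_reflect_unit:
  fixes f :: "real \<Rightarrow> real"
  assumes "has_bochner_integral (lebesgue_on {0..1}) (\<lambda>s. f (1 - s)) i"
  shows "has_bochner_integral (lebesgue_on {0<..}) (\<lambda>t. if t \<le> 1 then f t else 0) i"
proof -
  have "has_bochner_integral lebesgue (\<lambda>s. indicator {0..1} s * f (1 - s)) i"
    using assms by (simp add: has_bochner_integral_restrict_space)
  then have "has_bochner_integral lebesgue (\<lambda>s. indicator {0..1} (1 + (-1) * s) * f (1 - (1 + (-1) * s))) i"
    using has_bochner_integral_lebesgue_real_affine_iff[of "-1" "\<lambda>s. indicator {0..1} s * f (1 - s)" i 1]
    by simp
  then have r: "has_bochner_integral lebesgue (\<lambda>s. indicator {0..1} s * f s) i"
    by (simp add: indicator_def conj_commute cong: if_cong conj_cong)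
  have ae: "AE s in lebesgue. indicator {0..1} s * f s = indicator {0<..} s *\<^sub>R (if s \<le> 1 then f s else 0)"
  proof -
    have "AE s in lebesgue. s \<noteq> (0::real)"
      using AE_completion[OF AE_lborel_singleton[of "0::real"]] .
    then show ?thesis by eventually_elim (auto simp: indicator_def)
  qed
  have "(\<lambda>s. indicator {0<..} s *\<^sub>R (if s \<le> 1 then f s else 0)) \<in> borel_measurable lebesgue"
    using borel_measurable_has_bochner_integral[OF r] ae by (rule completion.borel_measurable_cong_AE)
  then have "has_bochner_integral lebesgue (\<lambda>s. indicator {0<..} s *\<^sub>R (if s \<le> 1 then f s else 0)) i"
    using has_bochner_integral_cong_AE[OF borel_measurable_has_bochner_integral[OF r] _ ae] r by blast
  then show ?thesis
    by (simp add: has_bochner_integral_restrict_space)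
qed

lemma AE_lebesgue_on_neq:
  assumes "S \<in> sets lebesgue"
  shows "AE s in lebesgue_on S. s \<noteq> (a::real)"
proof -
  have "AE s in lebesgue. s \<noteq> a"
    by (rule AE_completion[OF AE_lborel_singleton])
  then have "AE s in lebesgue. s \<in> S \<longrightarrow> s \<noteq> a" by eventually_elim simp
  with assms show ?thesis by (simp add: AE_restrict_space_iff)
qed

section \<open>Admissibility\<close>

context extrapolated_semigroup
begin

lemma admissible_of_bounded_into_X_neg:
  fixes B :: "'u::cbanach \<Rightarrow> 'b" and p :: ennreal
  assumes B: "bounded_clinear B" and \<beta>: "0 < \<beta>" "\<beta> < 1" and p: "p > ennreal (1 / (1 - \<beta>))"
    and b: "\<And>\<alpha>. \<beta> < \<alpha> \<Longrightarrow> \<alpha> \<le> 1 \<Longrightarrow> bounded_into_X_neg \<iota> T \<alpha> B"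
  shows "Lp_admissible \<iota> T p B"
  unfolding Lp_admissible_def
proof (intro allI impI)
  fix t :: real assume t: "t \<ge> 0"
  interpret Ml: complete_measure "lebesgue_on {0..t}"
    by (rule complete_measure_lebesgue_on) simp
  obtain \<alpha> c where \<alpha>: "\<beta> < \<alpha>" "\<alpha> < 1" and c: "c \<ge> 0"
    and ker: "\<And>u :: real \<Rightarrow> 'u. u \<in> Lp_space (lebesgue_on {0..t}) p \<Longrightarrow>
      (\<integral>\<^sup>+s. ennreal ((t - s) powr (- \<alpha>) * norm (u s)) \<partial>lebesgue_on {0..t})
        \<le> ennreal (c * Lp_norm (lebesgue_on {0..t}) p u)"
    by (rule Lp_singular_kernel_bound[OF \<beta> p t, where ?'u = 'u]) (rule that)
  have \<alpha>0: "\<alpha> > 0" using \<alpha> \<beta> by simp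
  obtain d where d: "d \<ge> 0" "\<And>v. \<exists>y. R y = P \<alpha> (J (B v)) \<and> norm y \<le> d * norm v"
    using b[of \<alpha>] \<alpha> bounded_into_X_neg_iff[OF \<alpha>0, of B] by auto
  obtain e where e: "e \<ge> 0"
    "\<And>t w y. t > 0 \<Longrightarrow> R y = P \<alpha> w \<Longrightarrow> norm (Q t w) \<le> e * t powr (- \<alpha>) * norm y"
    by (rule norm_Q_le[OF \<alpha>0 \<alpha>(2)]) (rule that)
  have Q_le: "norm (Q \<tau> (J (B v))) \<le> (e * d) * (\<tau> powr (- \<alpha>) * norm v)" if \<tau>: "\<tau> > 0" for \<tau> v
  proof -
    obtain y where y: "R y = P \<alpha> (J (B v))" "norm y \<le> d * norm v" using d(2) by blast
    have "norm (Q \<tau> (J (B v))) \<le> e * \<tau> powr (- \<alpha>) * norm y" using \<tau> y(1) by (rule e(2))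
    also have "\<dots> \<le> e * \<tau> powr (- \<alpha>) * (d * norm v)"
      using e(1) y(2) by (intro mult_left_mono) auto
    finally show ?thesis by (simp add: mult_ac)
  qed
  have JB: "bounded_linear (\<lambda>v. J (B v))"
    by (rule bounded_linear_compose[OF J_bounded_linear bounded_clinear_imp_bounded_linear[OF B]])
  have ae: "AE s in lebesgue_on {0..t}. s < t"
    using AE_lebesgue_on_neq[of "{0..t}" t] AE_space[of "lebesgue_on {0..t}"]
    by (auto elim: eventually_elim2)
  show "\<exists>C>0. \<forall>u\<in>Lp_space (lebesgue_on {0..t}) p. \<exists>x.
      has_strong_bochner_integral (lebesgue_on {0..t})
        (\<lambda>s. extended_semigroup \<iota> T (t - s) (B (u s))) (\<iota> x) \<and>
      norm x \<le> C * Lp_norm (lebesgue_on {0..t}) p u"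
  \<comment> \<open>The summand 1 makes the constant positive, as the definition of admissibility
    requires.\<close>
  proof (intro exI[of _ "e * d * c + 1"] conjI ballI)
    show "e * d * c + 1 > 0" using e d c by (simp add: add_nonneg_pos)
    fix u :: "real \<Rightarrow> 'u" assume u: "u \<in> Lp_space (lebesgue_on {0..t}) p"
    define N where "N = Lp_norm (lebesgue_on {0..t}) p u"
    have N: "N \<ge> 0" by (simp add: N_def Lp_norm_def)
    \<comment> \<open>This is T(t-s) B u(s) as an element of X. It is meaningful only for s < t,
      hence the repeated use of \<open>ae\<close>.\<close>
    define W where "W s = Q (t - s) (J (B (u s)))" for s
    have um: "strongly_measurable (lebesgue_on {0..t}) u" using u by (simp add: Lp_space_def)
    have "strongly_measurable (lebesgue_on {0..t}) (\<lambda>s. (\<lambda>s v. Q (t - s) (J (B v))) s (u s))"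
      using um
    proof (rule strongly_measurable_apply)
      show "AE s in lebesgue_on {0..t}. \<forall>q v. q \<longlonglongrightarrow> s \<longrightarrow> v \<longlonglongrightarrow> u s \<longrightarrow>
          (\<lambda>i. Q (t - q i) (J (B (v i)))) \<longlonglongrightarrow> Q (t - s) (J (B (u s)))"
        using ae
      proof eventually_elim
        case (elim s)
        then show ?case
          by (intro allI impI Q_tendsto tendsto_diff tendsto_const bounded_linear.tendsto[OF JB]) auto
      qed
    qed
    then have Wm: "strongly_measurable (lebesgue_on {0..t}) W" by (simp add: W_def[abs_def])
    have km: "(\<lambda>s. (t - s) powr (- \<alpha>) * norm (u s)) \<in> borel_measurable (lebesgue_on {0..t})"
    proof -
      have "(\<lambda>s. norm (u s)) \<in> borel_measurable (lebesgue_on {0..t})"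
        using Ml.strongly_measurable_imp_borel_measurable[OF um] by measurable
      moreover have "(\<lambda>s. (t - s) powr (- \<alpha>)) \<in> borel_measurable (lebesgue_on {0..t})"
        by (simp add: measurable_restrict_space1 measurable_completion)
      ultimately show ?thesis by measurable
    qed
    have "(\<integral>\<^sup>+s. ennreal (norm (W s)) \<partial>lebesgue_on {0..t})
        \<le> (\<integral>\<^sup>+s. ennreal (e * d) * ennreal ((t - s) powr (- \<alpha>) * norm (u s)) \<partial>lebesgue_on {0..t})"
    proof (rule nn_integral_mono_AE, use ae in eventually_elim)
      fix s assume "s < t"
      then have "norm (W s) \<le> (e * d) * ((t - s) powr (- \<alpha>) * norm (u s))"
        unfolding W_def by (intro Q_le) simp
      then show "ennreal (norm (W s)) \<le> ennreal (e * d) * ennreal ((t - s) powr (- \<alpha>) * norm (u s))"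
        using e(1) d(1) by (simp add: ennreal_leI flip: ennreal_mult')
    qed
    also have "\<dots> = ennreal (e * d) * (\<integral>\<^sup>+s. ennreal ((t - s) powr (- \<alpha>) * norm (u s)) \<partial>lebesgue_on {0..t})"
      by (intro nn_integral_cmult measurable_compose[OF km measurable_ennreal])
    also have "\<dots> \<le> ennreal (e * d) * ennreal (c * N)"
      unfolding N_def using u by (intro mult_left_mono ker) auto
    also have "\<dots> = ennreal (e * d * c * N)"
      using e d c N by (simp add: mult_ac flip: ennreal_mult)
    finally have W_le: "(\<integral>\<^sup>+s. ennreal (norm (W s)) \<partial>lebesgue_on {0..t}) \<le> ennreal (e * d * c * N)" .
    then have "(\<integral>\<^sup>+s. ennreal (norm (W s)) \<partial>lebesgue_on {0..t}) < \<infinity>"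
      by (rule le_less_trans) simp
    then obtain x where x: "has_strong_bochner_integral (lebesgue_on {0..t}) W x"
      using Ml.ex_has_strong_bochner_integral[OF Wm] by blast
    have "norm x \<le> e * d * c * N"
      using e d c N by (intro Ml.has_strong_bochner_integral_norm_le[OF x W_le]) simp
    also have "\<dots> \<le> (e * d * c + 1) * N" using N by (simp add: algebra_simps)
    finally have "norm x \<le> (e * d * c + 1) * N" .
    moreover have "has_strong_bochner_integral (lebesgue_on {0..t})
        (\<lambda>s. extended_semigroup \<iota> T (t - s) (B (u s))) (\<iota> x)"
    proof (rule has_strong_bochner_integral_cong_AE)
      show "has_strong_bochner_integral (lebesgue_on {0..t}) (\<lambda>s. \<iota> (W s)) (\<iota> x)"
        using \<iota>_bounded_linear x by (rule Ml.has_strong_bochner_integral_bounded_linear)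
      \<comment> \<open>Here \<iota> after \<open>Q\<close> is \<open>K\<close> after
        \<open>T\<close>, which is the extended semigroup read through \<open>J\<close>.\<close>
      show "AE s in lebesgue_on {0..t}. \<iota> (W s) = extended_semigroup \<iota> T (t - s) (B (u s))"
        using ae by eventually_elim (simp add: W_def \<iota>_eq R_Q ext)
    qed
    ultimately show "\<exists>x. has_strong_bochner_integral (lebesgue_on {0..t})
        (\<lambda>s. extended_semigroup \<iota> T (t - s) (B (u s))) (\<iota> x) \<and>
      norm x \<le> (e * d * c + 1) * Lp_norm (lebesgue_on {0..t}) p u"
      unfolding N_def by blast
  qed
qed

text \<open>For t > 1 the integrand is \<open>R\<close> of the weighted
  \<open>Q t w = Q 1 (T (t - 1) w)\<close>, which decays exponentially in X; so the integral may be
  taken in X first and \<open>R\<close> applied afterwards.\<close>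

lemma tail_integral:
  assumes \<alpha>: "\<alpha> > 0"
  obtains c where "c \<ge> 0" "\<And>w. \<exists>x. norm x \<le> c * norm w \<and>
    has_strong_bochner_integral (lebesgue_on {0<..})
      (\<lambda>t. if t \<le> 1 then 0 else (t powr (\<alpha> - 1)) *\<^sub>R T t w) (R x)"
proof -
  obtain k where k: "k > 0" "\<And>w. norm (Q 1 w) \<le> norm w * k"
    using bounded_linear.pos_bounded[OF Q_bounded_linear[of 1]] by auto
  \<comment> \<open>Here k bounds \<open>Q 1\<close>, and M exp \<omega> comes from T(t-1), as
    exp(-\<omega>(t-1)) = exp \<omega> exp(-\<omega> t).\<close>
  define c where "c = k * M * exp \<omega>"
  have c: "c \<ge> 0" using k M_ge_1 by (simp add: c_def)
  have "\<exists>x. norm x \<le> c * weight_integral \<alpha> * norm w \<and>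
    has_strong_bochner_integral (lebesgue_on {0<..})
      (\<lambda>t. if t \<le> 1 then 0 else (t powr (\<alpha> - 1)) *\<^sub>R T t w) (R x)" for w
  proof -
    define f where "f t = (if t \<le> 1 then 0 else (t powr (\<alpha> - 1)) *\<^sub>R Q t w)" for t
    obtain x where x: "has_strong_bochner_integral (lebesgue_on {0<..}) f x"
      "norm x \<le> (c * norm w) * weight_integral \<alpha>"
    proof (rule ex_has_integral_half_line[OF \<alpha>, of "c * norm w" f])
      show "c * norm w \<ge> 0" using c by simp
      have "AE t in lebesgue_on {0<..}. t \<noteq> (1::real)"
        by (rule AE_lebesgue_on_neq) simp
      then show "AE t in lebesgue_on {0<..}. isCont f t"
      proof eventually_elim
        case (elim t)
        then consider "t < 1" | "t > 1" by linarith
        then show ?case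
        proof cases
          case 1
          have "\<forall>\<^sub>F y in nhds t. f y = 0"
            using eventually_nhds_in_open[of "{..<1}" t] 1 by (auto elim!: eventually_mono simp: f_def)
          then show ?thesis by (simp add: isCont_cong)
        next
          case 2
          have "isCont (\<lambda>t. Q t w) t"
            using 2 by (auto simp: continuous_at_sequentially o_def intro!: Q_tendsto)
          then have "isCont (\<lambda>t. (t powr (\<alpha> - 1)) *\<^sub>R Q t w) t"
            using 2 by (intro continuous_scaleR continuous_at_within_powr continuous_ident continuous_const) auto
          moreover have "\<forall>\<^sub>F y in nhds t. f y = (y powr (\<alpha> - 1)) *\<^sub>R Q y w"
            using eventually_nhds_in_open[of "{1<..}" t] 2 by (auto elim!: eventually_mono simp: f_def)
          ultimately show ?thesis by (simp add: isCont_cong)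
        qed
      qed
      fix t :: real assume t: "t > 0"
      show "norm (f t) \<le> c * norm w * (t powr (\<alpha> - 1) * exp (- \<omega> * t))"
      proof (cases "t \<le> 1")
        case False
        then have "Q t w = Q 1 (T (t - 1) w)" by (simp add: Q_add)
        then have "norm (Q t w) \<le> norm (T (t - 1) w) * k" using k(2) by simp
        also have "\<dots> \<le> M * exp (- \<omega> * (t - 1)) * norm w * k"
          using k(1) False by (intro mult_right_mono norm_T) auto
        also have "\<dots> = c * norm w * exp (- \<omega> * t)"
          by (simp add: c_def right_diff_distrib exp_diff exp_minus exp_add field_simps)
        finally have "t powr (\<alpha> - 1) * norm (Q t w) \<le> t powr (\<alpha> - 1) * (c * norm w * exp (- \<omega> * t))"
          by (intro mult_left_mono) auto
        with False show ?thesis by (simp add: f_def mult_ac)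
      qed (use c in \<open>simp add: f_def\<close>)
    qed (rule that)
    have "has_strong_bochner_integral (lebesgue_on {0<..}) (\<lambda>t. R (f t)) (R x)"
      using R_bounded_linear x(1) by (rule half_line.has_strong_bochner_integral_bounded_linear)
    moreover have "R (f t) = (if t \<le> 1 then 0 else (t powr (\<alpha> - 1)) *\<^sub>R T t w)" for t
      using bounded_linear.linear[OF R_bounded_linear] by (simp add: f_def linear_0 linear_scale R_Q)
    ultimately show ?thesis using x(2) by (auto simp: mult_ac)
  qed
  then show thesis
    using c weight_integral(2)[OF \<alpha>] by (intro that[of "c * weight_integral \<alpha>"]) auto
qed

lemma bounded_into_X_neg_of_admissible:
  fixes B :: "'u::cbanach \<Rightarrow> 'b"
  assumes B: "bounded_clinear B" and \<alpha>: "0 < \<alpha>" "\<alpha> \<le> 1" and p: "p \<ge> 1" "p * (1 - \<alpha>) < 1"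
    and adm: "Lp_admissible \<iota> T (ennreal p) B"
  shows "bounded_into_X_neg \<iota> T \<alpha> B"
proof -
  interpret Ml: complete_measure "lebesgue_on {0..1::real}"
    by (rule complete_measure_lebesgue_on) simp
  obtain C\<^sub>0 where C\<^sub>0: "C\<^sub>0 > 0" "\<And>u. u \<in> Lp_space (lebesgue_on {0..1}) (ennreal p) \<Longrightarrow> \<exists>x.
      has_strong_bochner_integral (lebesgue_on {0..1})
        (\<lambda>s. extended_semigroup \<iota> T (1 - s) (B (u s))) (\<iota> x) \<and>
      norm x \<le> C\<^sub>0 * Lp_norm (lebesgue_on {0..1}) (ennreal p) u"
    using adm unfolding Lp_admissible_def by (meson zero_le_one)
  obtain c where c: "c \<ge> 0" "\<And>w. \<exists>x. norm x \<le> c * norm w \<and>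
    has_strong_bochner_integral (lebesgue_on {0<..})
      (\<lambda>t. if t \<le> 1 then 0 else (t powr (\<alpha> - 1)) *\<^sub>R T t w) (R x)"
    by (rule tail_integral[OF \<alpha>(1)]) (rule that)
  \<comment> \<open>The integral of (1-s)^((\<alpha>-1)p) over [0,1], finite because p(1-\<alpha>) <
    1; the input \<open>u\<close> then has norm I^(1/p) |v|.\<close>
  define I where "I = 1 / ((\<alpha> - 1) * p + 1)"
  have ap: "(\<alpha> - 1) * p > -1" using p by (simp add: algebra_simps)
  have I: "I > 0" using ap by (simp add: I_def)
  have lin: "linear B" "linear J"
    using bounded_linear.linear[OF bounded_clinear_imp_bounded_linear[OF B]]
      bounded_linear.linear[OF J_bounded_linear] by auto
  have JB: "bounded_linear (\<lambda>v. J (B v))"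
    by (rule bounded_linear_compose[OF J_bounded_linear bounded_clinear_imp_bounded_linear[OF B]])
  obtain k where k: "k > 0" "\<And>v. norm (J (B v)) \<le> norm v * k"
    using bounded_linear.pos_bounded[OF JB] by auto
  have "\<exists>y. R y = P \<alpha> (J (B v)) \<and> norm y \<le> (C\<^sub>0 * I powr (1 / p) + c * k) * norm v" for v
  proof -
    define u where "u s = ((1 - s) powr (\<alpha> - 1)) *\<^sub>R v" for s :: real
    have nn: "(\<integral>\<^sup>+s. ennreal (norm (u s) powr p) \<partial>lebesgue_on {0..1}) = ennreal (I * norm v powr p)"
    proof -
      have "(\<integral>\<^sup>+s. ennreal (norm (u s) powr p) \<partial>lebesgue_on {0..1})
          = (\<integral>\<^sup>+s. ennreal ((1 - s) powr ((\<alpha> - 1) * p)) * ennreal (norm v powr p) \<partial>lebesgue_on {0..1})"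
        by (intro nn_integral_cong) (simp add: u_def powr_mult powr_powr flip: ennreal_mult)
      also have "\<dots> = (\<integral>\<^sup>+s. ennreal ((1 - s) powr ((\<alpha> - 1) * p)) \<partial>lebesgue_on {0..1}) * ennreal (norm v powr p)"
        by (rule nn_integral_multc) (simp add: measurable_restrict_space1 measurable_completion)
      also have "\<dots> = ennreal (I * norm v powr p)"
        using nn_integral_reflected_powr[OF ap, of 1] I by (simp add: ennreal_mult flip: I_def)
      finally show ?thesis .
    qed
    have "strongly_measurable (lebesgue_on {0..1}) u"
    proof (rule strongly_measurable_continuous_AE)
      have "AE s in lebesgue_on {0..1}. s \<noteq> (1::real)"
        by (rule AE_lebesgue_on_neq) simp
      then show "AE s in lebesgue_on {0..1}. isCont u s"
      proof eventually_elim
        case (elim s)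
        then show ?case
          unfolding u_def[abs_def]
          by (intro continuous_scaleR continuous_at_within_powr continuous_diff continuous_ident continuous_const) auto
      qed
    qed
    then have "u \<in> Lp_space (lebesgue_on {0..1}) (ennreal p)"
      using p nn by (simp add: Lp_space_def)
    then obtain x where x: "has_strong_bochner_integral (lebesgue_on {0..1})
          (\<lambda>s. extended_semigroup \<iota> T (1 - s) (B (u s))) (\<iota> x)"
        "norm x \<le> C\<^sub>0 * Lp_norm (lebesgue_on {0..1}) (ennreal p) u"
      using C\<^sub>0(2) by blast
    have "Lp_norm (lebesgue_on {0..1}) (ennreal p) u = I powr (1 / p) * norm v"
      using p I by (simp add: Lp_norm_def nn powr_mult powr_powr)
    with x(2) have nx: "norm x \<le> C\<^sub>0 * I powr (1 / p) * norm v" by simp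
    obtain x' where x': "norm x' \<le> c * norm (J (B v))" "has_strong_bochner_integral (lebesgue_on {0<..})
        (\<lambda>t. if t \<le> 1 then 0 else (t powr (\<alpha> - 1)) *\<^sub>R T t (J (B v))) (R x')"
      using c(2) by blast
    have "has_strong_bochner_integral (lebesgue_on {0..1})
        (\<lambda>s. J (extended_semigroup \<iota> T (1 - s) (B (u s)))) (J (\<iota> x))"
      using J_bounded_linear x(1) by (rule Ml.has_strong_bochner_integral_bounded_linear)
    then have Jx: "has_strong_bochner_integral (lebesgue_on {0..1})
        (\<lambda>s. ((1 - s) powr (\<alpha> - 1)) *\<^sub>R T (1 - s) (J (B v))) (R x)"
      unfolding J_\<iota>
      by (rule has_strong_bochner_integral_cong_AE)
         (auto simp: ext JK u_def linear_scale[OF lin(1)] linear_scale[OF lin(2)]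
            linear_scale[OF bounded_linear.linear[OF T_bounded_linear]])
    \<comment> \<open>Head and tail add up to the full integral. The head was obtained over [0,1] in
      the reflected variable, so the identity is verified on functionals.\<close>
    have "R x + R x' = P \<alpha> (J (B v))"
    proof (rule functionals_separate)
      fix \<phi> :: "'a \<Rightarrow> real" assume \<phi>: "bounded_linear \<phi>"
      note lin\<phi> = bounded_linear.linear[OF \<phi>]
      define h where "h t = t powr (\<alpha> - 1) * \<phi> (T t (J (B v)))" for t
      have "has_bochner_integral (lebesgue_on {0..1}) (\<lambda>s. h (1 - s)) (\<phi> (R x))"
        using Ml.has_strong_bochner_integral_functional[OF \<phi> Jx]
        by (simp add: h_def linear_scale[OF lin\<phi>])
      then have "has_bochner_integral (lebesgue_on {0<..}) (\<lambda>t. if t \<le> 1 then h t else 0) (\<phi> (R x))"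
        by (rule has_bochner_integral_reflect_unit)
      moreover have "has_bochner_integral (lebesgue_on {0<..}) (\<lambda>t. if t \<le> 1 then 0 else h t) (\<phi> (R x'))"
        using half_line.has_strong_bochner_integral_functional[OF \<phi> x'(2)]
        by (simp add: h_def linear_scale[OF lin\<phi>] linear_0[OF lin\<phi>] if_distrib[of \<phi>] cong: if_cong)
      ultimately have "has_bochner_integral (lebesgue_on {0<..})
          (\<lambda>t. (if t \<le> 1 then h t else 0) + (if t \<le> 1 then 0 else h t)) (\<phi> (R x) + \<phi> (R x'))"
        by (rule has_bochner_integral_add)
      moreover have "(\<lambda>t. (if t \<le> 1 then h t else 0) + (if t \<le> 1 then 0 else h t)) = h"
        by auto
      ultimately have "has_bochner_integral (lebesgue_on {0<..}) h (\<phi> (R x) + \<phi> (R x'))"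
        by simp
      moreover have "has_bochner_integral (lebesgue_on {0<..}) h (\<phi> (P \<alpha> (J (B v))))"
        unfolding h_def[abs_def] using \<alpha>(1) \<phi> by (rule functional_P)
      ultimately show "\<phi> (R x + R x') = \<phi> (P \<alpha> (J (B v)))"
        by (simp add: has_bochner_integral_eq linear_add[OF lin\<phi>])
    qed
    then have "R (x + x') = P \<alpha> (J (B v))"
      by (simp add: linear_add[OF bounded_linear.linear[OF R_bounded_linear]])
    moreover have "norm (x + x') \<le> (C\<^sub>0 * I powr (1 / p) + c * k) * norm v"
    proof -
      have "norm x' \<le> c * (norm v * k)"
        using x'(1) mult_left_mono[OF k(2) c(1)] by (rule order_trans)
      with nx norm_triangle_ineq[of x x'] show ?thesis by (simp add: algebra_simps)
    qed
    ultimately show ?thesis by blast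
  qed
  moreover have "C\<^sub>0 * I powr (1 / p) + c * k \<ge> 0"
    using C\<^sub>0(1) c(1) k(1) by simp
  ultimately show ?thesis
    unfolding bounded_into_X_neg_iff[OF \<alpha>(1)] using B by (auto simp: bounded_clinear_def)
qed

end

text \<open>The generator is eliminated here: everything afterwards uses only the algebra of
  \<open>T\<close>, \<open>L\<close>, \<open>R\<close>, \<open>Q\<close>, \<open>J\<close>,
  \<open>K\<close> recorded in the locale.\<close>

lemma extrapolated_semigroupE:
  fixes T :: "real \<Rightarrow> 'a::cbanach \<Rightarrow> 'a" and \<iota> :: "'a \<Rightarrow> 'b::cbanach"
  assumes an: "analytic_semigroup T" and st: "exponentially_stable T"
    and gen: "is_generator D A T" and s: "s \<in> resolvent_set D A"
    and compl: "is_completion (\<lambda>x. norm (resolvent D A s x)) \<iota>"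
  obtains M \<omega> L C R Q J K where "extrapolated_semigroup T M \<omega> L C R Q \<iota> J K"
proof -
  obtain M \<omega> L C where "stable_analytic_semigroup T M \<omega> L C"
    using an st by (rule analytic_semigroupE)
  then interpret stable_analytic_semigroup T M \<omega> L C .
  define R where "R = resolvent D A s"
  have bij: "bij_betw (\<lambda>x. s *\<^sub>C x - A x) D UNIV" and R_bcl: "bounded_clinear R"
    using s by (simp_all add: resolvent_set_def R_def)
  have R_D: "R y \<in> D" and R_right: "s *\<^sub>C R y - A (R y) = y" for y
    using bij_betw_inv_into_right[OF bij, of y] bij inv_into_into[of y "\<lambda>x. s *\<^sub>C x - A x" D]
    by (auto simp: R_def resolvent_def bij_betw_def)
  have R_left: "R (s *\<^sub>C x - A x) = x" if "x \<in> D" for x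
    using bij_betw_inv_into_left[OF bij that] by (simp add: R_def resolvent_def)
  have D_I: "x \<in> D \<and> A x = y" if "((\<lambda>h. (T h x - x) /\<^sub>R h) \<longlongrightarrow> y) (at_right 0)" for x y
  proof -
    have "x \<in> D" using gen that by (auto simp: is_generator_def)
    then have "((\<lambda>h. (T h x - x) /\<^sub>R h) \<longlongrightarrow> A x) (at_right 0)"
      using gen by (auto simp: is_generator_def)
    with that have "A x = y" by (intro tendsto_unique[OF trivial_limit_at_right_real])
    with \<open>x \<in> D\<close> show ?thesis by simp
  qed
  have T_D: "T t x \<in> D \<and> A (T t x) = T t (A x)" if "x \<in> D" "t \<ge> 0" for t x
  proof (rule D_I)
    have "((\<lambda>h. (T h x - x) /\<^sub>R h) \<longlongrightarrow> A x) (at_right 0)"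
      using gen that by (auto simp: is_generator_def)
    then have "((\<lambda>h. T t ((T h x - x) /\<^sub>R h)) \<longlongrightarrow> T t (A x)) (at_right 0)"
      by (rule bounded_linear.tendsto[OF T_bounded_linear[OF that(2)]])
    moreover have "\<forall>\<^sub>F h in at_right 0. T t ((T h x - x) /\<^sub>R h) = (T h (T t x) - T t x) /\<^sub>R h"
      using eventually_at_right_less[of 0]
    proof eventually_elim
      case (elim h)
      have "T t ((T h x - x) /\<^sub>R h) = (T t (T h x) - T t x) /\<^sub>R h"
        using that by (simp add: linear_scale[OF bounded_linear.linear[OF T_bounded_linear]] T_diff)
      then show ?case using elim that T_commute[of t h x] by simp
    qed
    ultimately show "((\<lambda>h. (T h (T t x) - T t x) /\<^sub>R h) \<longlongrightarrow> T t (A x)) (at_right 0)"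
      by (rule Lim_transform_eventually)
  qed
  have R_T: "R (T t x) = T t (R x)" if "t \<ge> 0" for t x
  proof -
    have "T t (R x) \<in> D" "A (T t (R x)) = T t (A (R x))"
      using T_D[OF R_D that] by auto
    then have "T t (R x) = R (s *\<^sub>C T t (R x) - T t (A (R x)))"
      using R_left[of "T t (R x)"] by simp
    also have "s *\<^sub>C T t (R x) - T t (A (R x)) = T t (s *\<^sub>C R x - A (R x))"
      using that by (simp add: T_diff bounded_clinear_scaleC[OF T_bounded_clinear])
    finally show ?thesis by (simp add: R_right)
  qed
  define Q where "Q t x = s *\<^sub>C T t x - L t x" for t x
  have R_Q: "R (Q t x) = T t x" if "t > 0" for t x
    using D_I[OF L_generator[OF that, of x]] R_left[of "T t x"] by (simp add: Q_def)
  have Q_bl: "bounded_linear (Q t)" if "t > 0" for t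
    unfolding Q_def[abs_def] using that
    by (intro bounded_linear_sub bounded_linear_compose[OF bounded_linear_scaleC]
        T_bounded_linear L_bounded_linear) auto
  \<comment> \<open>Smoothing puts each T(1/(n+1)) x into the range of \<open>R\<close>, and these
    vectors converge to x.\<close>
  have dense_R: "closure (range R) = UNIV"
  proof -
    have "x \<in> closure (range R)" for x
      unfolding closure_sequential
    proof (intro exI conjI allI)
      show "T (inverse (real (Suc n))) x \<in> range R" for n
        using R_Q[of "inverse (real (Suc n))" x] by (metis inverse_positive_iff_positive of_nat_0_less_iff range_eqI zero_less_Suc)
    qed (rule T_inverse_Suc)
    then show ?thesis by blast
  qed
  have \<iota>: "clinear \<iota>" "\<And>x. norm (\<iota> x) = norm (R x)" "closure (range \<iota>) = UNIV"
    using compl by (auto simp: is_completion_def R_def)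
  have clR: "clinear R" using R_bcl by (simp add: bounded_clinear_def)
  obtain J where J: "bounded_clinear J" "\<And>x. J (\<iota> x) = R x"
    by (rule isometric_extension[OF \<iota>(1) clR _ \<iota>(3)]) (auto simp: \<iota>(2))
  obtain K where K: "bounded_clinear K" "\<And>x. K (R x) = \<iota> x"
    by (rule isometric_extension[OF clR \<iota>(1) _ dense_R]) (auto simp: \<iota>(2))
  note Jb = bounded_clinear_imp_bounded_linear[OF J(1)]
  note Kb = bounded_clinear_imp_bounded_linear[OF K(1)]
  have JK: "(\<lambda>x. J (K x)) = (\<lambda>x. x)"
    by (rule bounded_linear_eq_on_dense[OF bounded_linear_compose[OF Jb Kb] bounded_linear_ident dense_R])
       (auto simp: J K)
  have KJ: "(\<lambda>z. K (J z)) = (\<lambda>z. z)"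
    by (rule bounded_linear_eq_on_dense[OF bounded_linear_compose[OF Kb Jb] bounded_linear_ident \<iota>(3)])
       (auto simp: J K)
  \<comment> \<open>The definite description defining the extension is resolved by density of the
    range of \<iota>.\<close>
  have ext: "extended_semigroup \<iota> T t z = K (T t (J z))" if t: "t \<ge> 0" for t z
  proof -
    have b: "bounded_clinear (\<lambda>z. K (T t (J z)))"
    proof (rule bounded_clinearI)
      show "bounded_linear (\<lambda>z. K (T t (J z)))"
        by (rule bounded_linear_compose[OF Kb bounded_linear_compose[OF T_bounded_linear[OF t] Jb]])
    qed (simp add: bounded_clinear_scaleC[OF K(1)] bounded_clinear_scaleC[OF J(1)]
        bounded_clinear_scaleC[OF T_bounded_clinear[OF t]])
    have i: "K (T t (J (\<iota> x))) = \<iota> (T t x)" for x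
      using t by (simp add: J(2) K(2) flip: R_T)
    have "extended_semigroup \<iota> T t = (\<lambda>z. K (T t (J z)))"
      unfolding extended_semigroup_def
    proof (rule the_equality)
      fix S assume S: "bounded_clinear S \<and> (\<forall>x. S (\<iota> x) = \<iota> (T t x))"
      show "S = (\<lambda>z. K (T t (J z)))"
      proof (rule bounded_linear_eq_on_dense[OF _ _ \<iota>(3)])
        show "bounded_linear S" "bounded_linear (\<lambda>z. K (T t (J z)))"
          using S b by (blast intro: bounded_clinear_imp_bounded_linear)+
      qed (use S i in auto)
    qed (use b i in blast)
    then show ?thesis by simp
  qed
  have "extrapolated_semigroup T M \<omega> L C R Q \<iota> J K"
  proof (intro extrapolated_semigroup.intro extrapolated_semigroup_axioms.intro
      stable_analytic_semigroup_axioms)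
    show "bounded_linear R" by (rule bounded_clinear_imp_bounded_linear[OF R_bcl])
    show "x = y" if "R x = R y" for x y
      by (metis R_right that)
  qed (fact R_T Q_bl R_Q Jb Kb fun_cong[OF JK] fun_cong[OF KJ] J(2) ext)+
  then show thesis by (rule that)
qed

theorem theorem2p5:
  fixes T :: "real \<Rightarrow> 'a::cbanach \<Rightarrow> 'a"
    and D :: "'a set" and A :: "'a \<Rightarrow> 'a"
    and s :: complex
    and \<iota> :: "'a \<Rightarrow> 'b::cbanach"
    and B :: "'u::cbanach \<Rightarrow> 'b"
    and \<beta> :: real
  assumes "C0_semigroup T"
    and "analytic_semigroup T"
    and "exponentially_stable T"
    and "is_generator D A T"
    and "s \<in> resolvent_set D A"
    and "is_completion (\<lambda>x. norm (resolvent D A s x)) \<iota>"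
    and "bounded_clinear B"
    and "0 < \<beta>" and "\<beta> < 1"
  shows "(\<forall>p::ennreal. p > ennreal (1 / (1 - \<beta>)) \<longrightarrow> Lp_admissible \<iota> T p B) \<longleftrightarrow>
         (\<forall>\<alpha>::real. \<beta> < \<alpha> \<and> \<alpha> \<le> 1 \<longrightarrow> bounded_into_X_neg \<iota> T \<alpha> B)"
proof -
  note \<beta> = \<open>0 < \<beta>\<close> \<open>\<beta> < 1\<close>
  obtain M \<omega> L C R Q J K where "extrapolated_semigroup T M \<omega> L C R Q \<iota> J K"
    using assms(2-6) by (rule extrapolated_semigroupE)
  then interpret extrapolated_semigroup T M \<omega> L C R Q \<iota> J K .
  show ?thesis
  proof (intro iffI allI impI)
    fix \<alpha> :: real
    assume adm: "\<forall>p::ennreal. p > ennreal (1 / (1 - \<beta>)) \<longrightarrow> Lp_admissible \<iota> T p B"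
      and \<alpha>: "\<beta> < \<alpha> \<and> \<alpha> \<le> 1"
    have b1: "1 / (1 - \<beta>) > 1" using \<beta> by simp
    \<comment> \<open>Any p strictly between 1/(1-\<beta>) and 1/(1-\<alpha>) will do. For \<alpha>
      = 1 there is no upper restriction, while the formal quotient 1/(1-\<alpha>) would be 0, so
      that case stands apart.\<close>
    obtain p where p: "p > 1 / (1 - \<beta>)" "p * (1 - \<alpha>) < 1"
    proof (cases "\<alpha> = 1")
      case True
      then show thesis using that[of "1 / (1 - \<beta>) + 1"] by simp
    next
      case False
      then have "1 / (1 - \<beta>) < 1 / (1 - \<alpha>)"
        using \<alpha> by (intro divide_strict_left_mono) auto
      then obtain p where "1 / (1 - \<beta>) < p" "p < 1 / (1 - \<alpha>)" using dense by blast
      then show thesis using False \<alpha> by (intro that[of p]) (auto simp: field_simps)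
    qed
    then have p1: "p \<ge> 1" using b1 by linarith
    have "ennreal (1 / (1 - \<beta>)) < ennreal p"
      using p b1 by (intro ennreal_lessI) auto
    with adm have "Lp_admissible \<iota> T (ennreal p) B" by blast
    then show "bounded_into_X_neg \<iota> T \<alpha> B"
      using assms(7) \<alpha> \<beta> p p1 by (intro bounded_into_X_neg_of_admissible[of B \<alpha> p]) auto
  next
    fix p :: ennreal
    assume "\<forall>\<alpha>::real. \<beta> < \<alpha> \<and> \<alpha> \<le> 1 \<longrightarrow> bounded_into_X_neg \<iota> T \<alpha> B" "p > ennreal (1 / (1 - \<beta>))"
    then show "Lp_admissible \<iota> T p B"
      using assms(7) \<beta> by (intro admissible_of_bounded_into_X_neg[of B \<beta> p]) auto
  qed
qed

end
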